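(* Let $\{F_{a,b}\}$ be a family in Class $\mathcal{N}$. Fix a parameter value $b_0$ (on or above the critical line), fix $\frac{p}{q}\in\mathbb{Q}\cap[0,1]$ with $\frac{p}{q}=\frac{p_1}{q_1}\oplus\frac{p_2}{q_2}$ (Farey sum, with left parent $\frac{p_1}{q_1}$ and right parent $\frac{p_2}{q_2}$), and for $j\ge0$ let $l_j=\frac{jp+p_1}{jq+q_1}$ and $r_j=\frac{jp+p_2}{jq+q_2}$. For each $j\ge 0$ let $L_j$ denote the first coordinate of the point of $\mathcal{L}_{r_j}$ which lies on the horizontal line $b=b_0$, and let $R_j$ denote the first coordinate of the point of $\mathcal{R}_{l_j}$ which lies on the horizontal line $b=b_0$. Set $\Psi_1=\Psi_1(b_0)$ and $\Psi_2=\Psi_2(b_0)$ (for $\frac{p}{q}$). Then exactly one of the following holds: (1) $L_0>L_1>\cdots>L_j>\cdots>\Psi_2>\Psi_1>\cdots>R_j>\cdots>R_1>R_0$; (2) $L_0<L_1<\cdots<L_j<\cdots<\Psi_2<\Psi_1<\cdots<R_j<\cdots<R_1<R_0$; (3) $L_0=L_1=\cdots=L_j=\cdots=\Psi_1=\Psi_2=\cdots=R_j=\cdots=R_1=R_0$.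
   Context: A degree-one lift is a continuous $F:\mathbb{R}\to\mathbb{R}$ with $F(x+1)=F(x)+1$ for all $x$. Its rotation set $Rot(F)$ is the set of all values $\lim_{m\to\infty}\frac{F^m(x)-x}{m}$ over those $x\in\mathbb{R}$ for which the limit exists; it is a single point or a nondegenerate closed interval. Its lower and upper monotone bounds are $F_l(x)=\inf\{F(y)\mid y\ge x\}$ and $F_u(x)=\sup\{F(y)\mid y\le x\}$. Class $\mathcal{B}$: lifts $F$ of degree-one circle maps that are $C^3$, piecewise strictly monotone, have at most two critical points (per fundamental domain $[0,1)$), both turning points when there are two, and have negative Schwarzian derivative $S(F)=\frac{F'''}{F'}-\frac32\left(\frac{F''}{F'}\right)^2$ (where defined) when they have two critical points. When $F$ has two turning points per fundamental domain, the origin is chosen so that the locations in $[0,1)$ of the maximum, $C$, and the minimum, $K$, satisfy $C<K$. $K^-$ is the closest point to $K$ below $K$ with $F(K^-)=F(K)$, and $C^+$ is the closest point to $C$ above $C$ with $F(C^+)=F(C)$. Class $\mathcal{N}$: two-parameter families of lifts $\{F_{a,b}\}$ (with $a\in\mathbb{R}$ and $b$ real) such that (i) each $F_{a,b}$ is in Class $\mathcal{B}$; (ii) $F_{a,b}$ and $\frac{d}{dx}F_{a,b}$ depend continuously on $(a,b)$; (iii) $a$ is a translation parameter: $F_{a,b}=F_{0,b}+a$; (iv) the Hausdorff distance $\Delta$ between (the graphs of) the upper and lower monotone bounds of $F_{a,b}$ is a nondecreasing function of $b$ such that the value $0$ can be attained and the value $1$ can be exceeded. The critical line is the horizontal line $b=\max\{b\mid\Delta=0\}$.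 On it $F_{a,b}$ has a unique critical point in $[0,1)$, and above it $F_{a,b}$ has two. On the critical line one sets $K^-=C=K=C^+$ equal to this critical point. The origin is chosen so that $0<K^-\le C\le K\le C^+<1$ when $0\le\Delta<1$. The points $K^-,C,K,C^+$ depend on $b$ but not on $a$. For $\frac{p}{q}\in\mathbb{Q}\cap[0,1]$ in lowest terms define the loci (on or above the critical line) $\mathcal{R}_{\frac{p}{q}}=\{(a,b)\mid F_{a,b}^q(K^-)=C^++p;\ F_{a,b}^i(K^-)\notin(K^-,K]+\mathbb{Z}\text{ for }0<i\le q;\ F_{a,b}^i(K^-)\ne C^++p\text{ for }0<i<q\}$, $\mathcal{L}_{\frac{p}{q}}=\{(a,b)\mid F_{a,b}^q(C^+)=K^-+p;\ F_{a,b}^i(C^+)\notin[C,C^+)+\mathbb{Z}\text{ for }0<i\le q;\ F_{a,b}^i(C^+)\ne K^-+p\text{ for }0<i<q\}$, where on the critical line the second and third restrictions are dropped in each case. Each of these loci meets every horizontal line on or above the critical line in exactly one point. For fixed $\frac{p}{q}$ and $b$: the set of $a$ for which the left endpoint of $Rot(F_{a,b})$ is $\frac{p}{q}$ is a closed interval $[\Psi_1(b),\Phi_1(b)]$, and the set of $a$ for which the right endpoint of $Rot(F_{a,b})$ is $\frac{p}{q}$ is a closed interval $[\Phi_2(b),\Psi_2(b)]$; this defines $\Psi_1(b)$ and $\Psi_2(b)$ (it may happen that $\Psi_1(b)>\Psi_2(b)$). All fractions are in lowest terms and in $[0,1]$. Fractions $\frac{p_1}{q_1},\frac{p_2}{q_2}$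 are Farey neighbors if $p_1q_2-p_2q_1=\pm1$; their Farey sum is then $\frac{p_1}{q_1}\oplus\frac{p_2}{q_2}=\frac{p_1+p_2}{q_1+q_2}$. Every rational in $(0,1)$ is uniquely a Farey sum $\frac{p_1}{q_1}\oplus\frac{p_2}{q_2}$ with $\frac{p_1}{q_1}<\frac{p_2}{q_2}$; $\frac{p_1}{q_1}$ is its left parent and $\frac{p_2}{q_2}$ its right parent. *)

theory Defs
  imports "HOL-Analysis.Analysis"
begin

definition degree_one_lift :: "(real \<Rightarrow> real) \<Rightarrow> bool" where
  "degree_one_lift f \<longleftrightarrow> continuous_on UNIV f \<and> (\<forall>x. f (x + 1) = f x + 1)"

definition rotation_set :: "(real \<Rightarrow> real) \<Rightarrow> real set" where
  "rotation_set f = {\<rho>. \<exists>x. (\<lambda>m. ((f ^^ m) x - x) / real m) \<longlonglongrightarrow> \<rho>}"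

definition lower_bound_map :: "(real \<Rightarrow> real) \<Rightarrow> real \<Rightarrow> real" where
  "lower_bound_map f x = (INF y\<in>{x..}. f y)"

definition upper_bound_map :: "(real \<Rightarrow> real) \<Rightarrow> real \<Rightarrow> real" where
  "upper_bound_map f x = (SUP y\<in>{..x}. f y)"

definition graph_of :: "(real \<Rightarrow> real) \<Rightarrow> (real \<times> real) set" where
  "graph_of f = {(x, f x) | x. True}"

text \<open>Only meaningful for nonempty sets lying within bounded distance of each other; this holds
  for the graphs of the two monotone bounds of a degree-one lift.\<close>

definition hausdorff_distance :: "'a::metric_space set \<Rightarrow> 'a set \<Rightarrow> real" where
  "hausdorff_distance A B = max (SUP x\<in>A. infdist x B) (SUP y\<in>B. infdist y A)"

definition C3 :: "(real \<Rightarrow> real) \<Rightarrow> bool" where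
  "C3 f \<longleftrightarrow> (\<forall>n<3. \<forall>x. ((deriv ^^ n) f) differentiable (at x)) \<and>
            continuous_on UNIV ((deriv ^^ 3) f)"

definition piecewise_strictly_monotone :: "(real \<Rightarrow> real) \<Rightarrow> bool" where
  "piecewise_strictly_monotone f \<longleftrightarrow>
     (\<exists>S. finite S \<and>
        (\<forall>u v. 0 \<le> u \<and> u < v \<and> v \<le> 1 \<and> {u<..<v} \<inter> S = {} \<longrightarrow>
               strict_mono_on {u..v} f \<or> strict_antimono_on {u..v} f))"

definition critical_points :: "(real \<Rightarrow> real) \<Rightarrow> real set" where
  "critical_points f = {c \<in> {0..<1}. deriv f c = 0}"

definition turning_max :: "(real \<Rightarrow> real) \<Rightarrow> real \<Rightarrow> bool" where
  "turning_max f c \<longleftrightarrow>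
     (\<exists>e>0. strict_mono_on {c - e..c} f \<and> strict_antimono_on {c..c + e} f)"

definition turning_min :: "(real \<Rightarrow> real) \<Rightarrow> real \<Rightarrow> bool" where
  "turning_min f c \<longleftrightarrow>
     (\<exists>e>0. strict_antimono_on {c - e..c} f \<and> strict_mono_on {c..c + e} f)"

definition schwarzian :: "(real \<Rightarrow> real) \<Rightarrow> real \<Rightarrow> real" where
  "schwarzian f x =
     (deriv ^^ 3) f x / deriv f x - 3 / 2 * ((deriv ^^ 2) f x / deriv f x)\<^sup>2"

definition class_B :: "(real \<Rightarrow> real) \<Rightarrow> bool" where
  "class_B f \<longleftrightarrow>
     degree_one_lift f \<and> C3 f \<and> piecewise_strictly_monotone f \<and>
     finite (critical_points f) \<and> card (critical_points f) \<le> 2 \<and>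
     (card (critical_points f) = 2 \<longrightarrow>
        (\<forall>c\<in>critical_points f. turning_max f c \<or> turning_min f c) \<and>
        (\<forall>x. deriv f x \<noteq> 0 \<longrightarrow> schwarzian f x < 0))"

text \<open>A family is a function \<open>F\<close> with \<open>F a b x\<close> the value of the lift with parameters \<open>a\<close>, \<open>b\<close>
  at \<open>x\<close>. Changing \<open>a\<close> only translates the graphs vertically, so quantities that do not depend on
  \<open>a\<close> (the distance between the monotone bounds, the positions of the turning points) are read
  off at \<open>a = 0\<close>.\<close>

definition Delta :: "(real \<Rightarrow> real \<Rightarrow> real \<Rightarrow> real) \<Rightarrow> real \<Rightarrow> real" where
  "Delta F b = hausdorff_distance (graph_of (upper_bound_map (F 0 b)))
                                  (graph_of (lower_bound_map (F 0 b)))"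

text \<open>Joint continuity in \<open>(a, b, x)\<close> amounts, for degree-one lifts and their (1-periodic)
  derivatives, to continuity in \<open>(a, b)\<close> with respect to uniform convergence in \<open>x\<close>.\<close>

definition class_N :: "(real \<Rightarrow> real \<Rightarrow> real \<Rightarrow> real) \<Rightarrow> bool" where
  "class_N F \<longleftrightarrow>
     (\<forall>a b. class_B (F a b)) \<and>
     continuous_on UNIV (\<lambda>(a, b, x). F a b x) \<and>
     continuous_on UNIV (\<lambda>(a, b, x). deriv (F a b) x) \<and>
     (\<forall>a b x. F a b x = F 0 b x + a) \<and>
     mono (Delta F) \<and> (\<exists>b. Delta F b = 0) \<and> (\<exists>b. Delta F b > 1)"

definition critical_line :: "(real \<Rightarrow> real \<Rightarrow> real \<Rightarrow> real) \<Rightarrow> real" where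
  "critical_line F = (GREATEST b. Delta F b = 0)"

definition crit_pt :: "(real \<Rightarrow> real \<Rightarrow> real \<Rightarrow> real) \<Rightarrow> real \<Rightarrow> real" where
  "crit_pt F b = (THE c. c \<in> critical_points (F 0 b))"

definition C_pt :: "(real \<Rightarrow> real \<Rightarrow> real \<Rightarrow> real) \<Rightarrow> real \<Rightarrow> real" where
  "C_pt F b = (if b = critical_line F then crit_pt F b
               else (THE c. c \<in> {0..<1} \<and> turning_max (F 0 b) c))"

definition K_pt :: "(real \<Rightarrow> real \<Rightarrow> real \<Rightarrow> real) \<Rightarrow> real \<Rightarrow> real" where
  "K_pt F b = (if b = critical_line F then crit_pt F b
               else (THE c. c \<in> {0..<1} \<and> turning_min (F 0 b) c))"

definition K_minus :: "(real \<Rightarrow> real \<Rightarrow> real \<Rightarrow> real) \<Rightarrow> real \<Rightarrow> real" where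
  "K_minus F b = (if b = critical_line F then crit_pt F b
                  else (GREATEST x. x < K_pt F b \<and> F 0 b x = F 0 b (K_pt F b)))"

definition C_plus :: "(real \<Rightarrow> real \<Rightarrow> real \<Rightarrow> real) \<Rightarrow> real \<Rightarrow> real" where
  "C_plus F b = (if b = critical_line F then crit_pt F b
                 else (LEAST x. x > C_pt F b \<and> F 0 b x = F 0 b (C_pt F b)))"

definition plus_Ints :: "real set \<Rightarrow> real set" where
  "plus_Ints S = {x + of_int n | x n. x \<in> S}"

text \<open>In both loci \<open>p\<close> and \<open>q\<close> are the numerator and the denominator of a fraction in lowest
  terms.\<close>

definition locus_R ::
  "(real \<Rightarrow> real \<Rightarrow> real \<Rightarrow> real) \<Rightarrow> nat \<Rightarrow> nat \<Rightarrow> (real \<times> real) set" where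
  "locus_R F p q = {(a, b). critical_line F \<le> b \<and>
     (F a b ^^ q) (K_minus F b) = C_plus F b + real p \<and>
     (b \<noteq> critical_line F \<longrightarrow>
        (\<forall>i. 0 < i \<and> i \<le> q \<longrightarrow>
             (F a b ^^ i) (K_minus F b) \<notin> plus_Ints {K_minus F b<..K_pt F b}) \<and>
        (\<forall>i. 0 < i \<and> i < q \<longrightarrow>
             (F a b ^^ i) (K_minus F b) \<noteq> C_plus F b + real p))}"

definition locus_L ::
  "(real \<Rightarrow> real \<Rightarrow> real \<Rightarrow> real) \<Rightarrow> nat \<Rightarrow> nat \<Rightarrow> (real \<times> real) set" where
  "locus_L F p q = {(a, b). critical_line F \<le> b \<and>
     (F a b ^^ q) (C_plus F b) = K_minus F b + real p \<and>
     (b \<noteq> critical_line F \<longrightarrow>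
        (\<forall>i. 0 < i \<and> i \<le> q \<longrightarrow>
             (F a b ^^ i) (C_plus F b) \<notin> plus_Ints {C_pt F b..<C_plus F b}) \<and>
        (\<forall>i. 0 < i \<and> i < q \<longrightarrow>
             (F a b ^^ i) (C_plus F b) \<noteq> K_minus F b + real p))}"

text \<open>The rotation set is a compact interval, so its endpoints are its infimum and supremum. The
  two sets of parameters \<open>a\<close> below are compact intervals as well; \<open>Psi1\<close> is the left endpoint of
  the first one and \<open>Psi2\<close> the right endpoint of the second one.\<close>

definition Psi1 :: "(real \<Rightarrow> real \<Rightarrow> real \<Rightarrow> real) \<Rightarrow> nat \<Rightarrow> nat \<Rightarrow> real \<Rightarrow> real" where
  "Psi1 F p q b = Inf {a. Inf (rotation_set (F a b)) = real p / real q}"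

definition Psi2 :: "(real \<Rightarrow> real \<Rightarrow> real \<Rightarrow> real) \<Rightarrow> nat \<Rightarrow> nat \<Rightarrow> real \<Rightarrow> real" where
  "Psi2 F p q b = Sup {a. Sup (rotation_set (F a b)) = real p / real q}"

definition lowest_terms01 :: "nat \<Rightarrow> nat \<Rightarrow> bool" where
  "lowest_terms01 p q \<longleftrightarrow> 0 < q \<and> p \<le> q \<and> coprime p q"

definition farey_neighbors :: "nat \<Rightarrow> nat \<Rightarrow> nat \<Rightarrow> nat \<Rightarrow> bool" where
  "farey_neighbors p1 q1 p2 q2 \<longleftrightarrow> \<bar>int p1 * int q2 - int p2 * int q1\<bar> = 1"

definition farey_parents :: "nat \<Rightarrow> nat \<Rightarrow> nat \<Rightarrow> nat \<Rightarrow> nat \<Rightarrow> nat \<Rightarrow> bool" where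
  "farey_parents p q p1 q1 p2 q2 \<longleftrightarrow>
     lowest_terms01 p q \<and>
     lowest_terms01 p1 q1 \<and> lowest_terms01 p2 q2 \<and>
     farey_neighbors p1 q1 p2 q2 \<and> real p1 / real q1 < real p2 / real q2 \<and>
     p = p1 + p2 \<and> q = q1 + q2"

end

theory Submission
  imports Defs
begin

text \<open>Write \<open>G\<^sub>a\<close> and \<open>H\<^sub>a\<close> for the lower and upper monotone bounds of \<open>F\<^sub>a = f + a\<close>. Along an orbit
  that avoids the plateau, \<open>F\<^sub>a\<close> can be replaced by \<open>G\<^sub>a\<close>, which is strictly increasing in \<open>a\<close>; hence
  \<open>R\<^sub>j\<close> is determined by \<open>G\<^sub>a\<^bsup>jq+q1\<^esup>(K\<^sup>-) = C\<^sup>+ + jp + p1\<close>, and \<open>\<Psi>\<^sub>1\<close> is the parameter at which the graph of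
  \<open>G\<^sub>a\<^bsup>q\<^esup>\<close> touches that of \<open>x + p\<close> from below. The reflection \<open>x \<mapsto> - x\<close> exchanges \<open>G\<close> with \<open>H\<close>,
  \<open>R\<^sub>j\<close> with \<open>L\<^sub>j\<close> and \<open>\<Psi>\<^sub>1\<close> with \<open>\<Psi>\<^sub>2\<close>.

  Negative Schwarzian derivative enters only through the minimum principle for the derivative of
  \<open>F\<^sub>a\<^bsup>q\<^esup>\<close> on a branch from a periodic point \<open>y \<le> K\<^sup>-\<close> to a preimage of \<open>C\<close>: if at \<open>a = \<Psi>\<^sub>1\<close> a periodic
  point of \<open>G\<^sub>a\<close> lies in \<open>(K\<^sup>-, C\<^sup>+]\<close>, then \<open>y = K\<^sup>-\<close> and \<open>F\<^sub>a\<^bsup>q\<^esup>\<close> lies above \<open>x + p\<close> on the whole branch. The rest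
  is combinatorics of Farey neighbours: comparing rotation numbers forces the orbits of \<open>K\<^sup>-\<close> and
  \<open>C\<^sup>+\<close> to avoid \<open>(K\<^sup>-, C\<^sup>+)\<close>, so that \<open>F\<close>, \<open>G\<close> and \<open>H\<close> agree along them. On the critical line
  all three maps coincide and \<open>\<Psi>\<^sub>1 < \<Psi>\<^sub>2\<close> because \<open>F\<^sub>a\<^bsup>q\<^esup>\<close> has a critical point.\<close>

section \<open>Monotone lifts of degree one\<close>

text \<open>The translation parameter stays a separate argument because the comparisons below vary
  \<open>a\<close> while the map is fixed.\<close>

definition iter :: "(real \<Rightarrow> real) \<Rightarrow> real \<Rightarrow> nat \<Rightarrow> real \<Rightarrow> real" where
  "iter g a n = (\<lambda>x. g x + a) ^^ n"

lemma iter_0 [simp]: "iter g a 0 x = x"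
  by (simp add: iter_def)

lemma iter_Suc: "iter g a (Suc n) x = g (iter g a n x) + a"
  by (simp add: iter_def)

lemma iter_add: "iter g a (m + n) x = iter g a m (iter g a n x)"
  by (simp add: iter_def funpow_add)

lemma iter_Suc_right: "iter g a (Suc n) x = iter g a n (g x + a)"
  using iter_add[of g a n 1 x] by (simp add: iter_Suc)

text \<open>Conjugation by x -> -x. It is an involution that preserves monotone lifts and, by
  \<open>iter_refl_map\<close>, turns the parameter \<open>a\<close> into \<open>- a\<close>, so
  that facts about lower bounds become facts about upper bounds.\<close>

definition refl_map :: "(real \<Rightarrow> real) \<Rightarrow> real \<Rightarrow> real" where
  "refl_map g x = - g (- x)"

lemma refl_map_refl_map [simp]: "refl_map (refl_map g) = g"
  by (simp add: refl_map_def fun_eq_iff)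

lemma iter_refl_map: "iter (refl_map g) (- a) n x = - iter g a n (- x)"
  by (induction n) (simp_all add: iter_Suc refl_map_def)

lemma int_periodic:
  fixes g :: "real \<Rightarrow> real"
  assumes "\<And>x. g (x + 1) = g x + 1"
  shows "g (x + of_int m) = g x + of_int m"
proof (induction m arbitrary: x rule: int_induct[where k = 0])
  case base
  then show ?case by simp
next
  case (step1 i)
  have "g (x + of_int (i + 1)) = g ((x + of_int i) + 1)" by (simp add: algebra_simps)
  then show ?case using step1 assms by simp
next
  case (step2 i)
  have "g (x + of_int i) = g ((x + of_int (i - 1)) + 1)" by (simp add: algebra_simps)
  then show ?case using step2 assms[of "x + of_int (i - 1)"] by simp
qed

lemma iter_shift:
  assumes "\<And>x. g (x + 1) = g x + 1"
  shows "iter g a n (x + of_int m) = iter g a n x + of_int m"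
proof -
  have "g (y + of_int m) = g y + of_int m" for y
    by (rule int_periodic) (rule assms)
  then show ?thesis by (induction n) (simp_all add: iter_Suc)
qed

locale mono_lift =
  fixes g :: "real \<Rightarrow> real"
  assumes g_mono: "mono g"
    and g_cont: "continuous_on UNIV g"
    and g_per: "g (x + 1) = g x + 1"
begin

lemma g_shift: "g (x + of_int m) = g x + of_int m"
  by (rule int_periodic) (rule g_per)

lemma it_shift: "iter g a n (x + of_int m) = iter g a n x + of_int m"
  by (rule iter_shift) (rule g_per)

lemma it_shift': "iter g a n (x - of_int m) = iter g a n x - of_int m"
  using it_shift[of a n x "- m"] by simp

lemma it_mono: "x \<le> y \<Longrightarrow> iter g a n x \<le> iter g a n y"
  by (induction n) (auto simp: iter_Suc intro: monoD[OF g_mono])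

lemma it_mono_param: "a \<le> b \<Longrightarrow> iter g a n x \<le> iter g b n x"
  by (induction n) (auto simp: iter_Suc intro!: add_mono monoD[OF g_mono])

text \<open>The outermost application contributes the full increment \<open>d\<close> and the inner
  ones do no harm. Hence iterates are strictly increasing in the parameter although \<open>g\<close>
  is only weakly increasing.\<close>

lemma it_param_add: "0 < n \<Longrightarrow> 0 \<le> d \<Longrightarrow> iter g a n x + d \<le> iter g (a + d) n x"
proof (induction n)
  case (Suc n)
  have "iter g a n x \<le> iter g (a + d) n x" using Suc.prems by (intro it_mono_param) simp
  then have "g (iter g a n x) \<le> g (iter g (a + d) n x)" by (rule monoD[OF g_mono])
  then show ?case by (simp add: iter_Suc)
qed simp

lemma it_strict_param: "0 < n \<Longrightarrow> a < b \<Longrightarrow> iter g a n x < iter g b n x"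
  using it_param_add[of n "b - a" a x] by simp

lemma it_less_param_iff: "0 < n \<Longrightarrow> iter g a n x < iter g b n x \<longleftrightarrow> a < b"
  by (metis it_strict_param linorder_neqE_linordered_idom less_asym less_irrefl)

lemma it_cont2: "continuous_on UNIV (\<lambda>(a, x). iter g a n x)"
proof (induction n)
  case 0
  then show ?case by (simp add: split_beta continuous_on_snd)
next
  case (Suc n)
  have "continuous_on UNIV (\<lambda>z. g ((\<lambda>(a, x). iter g a n x) z) + fst z)"
    by (intro continuous_on_add continuous_on_compose2[OF g_cont Suc] continuous_intros) auto
  then show ?case by (simp add: iter_Suc split_beta)
qed

lemma it_cont: "continuous_on S (iter g a n)"
proof -
  have "continuous_on S (\<lambda>x. (\<lambda>(a, x). iter g a n x) (a, x))"
    by (intro continuous_on_compose2[OF it_cont2] continuous_intros) auto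
  then show ?thesis by simp
qed

lemma it_cont_param: "continuous_on S (\<lambda>a. iter g a n x)"
proof -
  have "continuous_on S (\<lambda>a. (\<lambda>(a, x). iter g a n x) (a, x))"
    by (intro continuous_on_compose2[OF it_cont2] continuous_intros) auto
  then show ?thesis by simp
qed

lemma it_pow_ge:
  assumes "x + of_int m \<le> iter g a n x"
  shows "x + of_int (int N * m) \<le> iter g a (N * n) x"
proof (induction N)
  case (Suc N)
  have "x + of_int (int (Suc N) * m) = (x + of_int (int N * m)) + of_int m"
    by (simp add: algebra_simps)
  also have "\<dots> \<le> iter g a n x + of_int (int N * m)" using assms by simp
  also have "\<dots> = iter g a n (x + of_int (int N * m))" by (simp only: it_shift)
  also have "\<dots> \<le> iter g a n (iter g a (N * n) x)" by (rule it_mono[OF Suc])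
  finally show ?case by (simp add: iter_add)
qed simp

lemma it_pow_le:
  assumes "iter g a n x \<le> x + of_int m"
  shows "iter g a (N * n) x \<le> x + of_int (int N * m)"
proof (induction N)
  case (Suc N)
  have "iter g a n (iter g a (N * n) x) \<le> iter g a n (x + of_int (int N * m))"
    by (rule it_mono[OF Suc])
  also have "\<dots> = iter g a n x + of_int (int N * m)" by (simp only: it_shift)
  also have "\<dots> \<le> x + of_int (int (Suc N) * m)" using assms by (simp add: algebra_simps)
  finally show ?case by (simp add: iter_add)
qed simp

text \<open>Weak monotonicity does not propagate strictness, so strictness is gained in a single one
  of the \<open>N\<close> blocks, after the others have been estimated weakly.\<close>

lemma it_pow_less:
  assumes "iter g a n x < x + of_int m" "0 < N"
  shows "iter g a (N * n) x < x + of_int (int N * m)"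
proof -
  obtain M where M: "N = Suc M" using assms by (cases N) auto
  have "iter g a n (iter g a (M * n) x) \<le> iter g a n (x + of_int (int M * m))"
    by (rule it_mono[OF it_pow_le]) (use assms in simp)
  also have "\<dots> = iter g a n x + of_int (int M * m)" by (simp only: it_shift)
  also have "\<dots> < x + of_int (int N * m)" using assms M by (simp add: algebra_simps)
  finally show ?thesis by (simp add: M iter_add)
qed

text \<open>The orbit of \<open>u\<close> gives rotation number at least p/q, that of
  \<open>w\<close> at most m/n. Cross multiplication turns the comparison into one of integers,
  without limits.\<close>

lemma rot_compare:
  assumes "u + of_int p \<le> iter g a q u" "iter g a n w \<le> w + of_int m"
  shows "p * int n \<le> m * int q"
proof (rule ccontr)
  assume "\<not> ?thesis"
  then have pos: "p * int n - m * int q \<ge> 1" by simp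
  \<comment> \<open>Passing between \<open>u\<close> and \<open>w\<close> costs at most
    \<open>D\<close> each way. If the claim failed, \<open>N * n * q\<close> iterations would
    separate the two estimates by at least \<open>N\<close>, which exceeds the total cost
    \<open>2 * D\<close>.\<close>
  define D :: int where "D = \<lceil>\<bar>u - w\<bar>\<rceil>"
  define N :: nat where "N = nat (2 * D + 1)"
  have D: "u \<le> w + of_int D" "w \<le> u + of_int D" "0 \<le> D" unfolding D_def by linarith+
  have "u + of_int (int (N * n) * p) \<le> iter g a (N * n * q) u"
    by (rule it_pow_ge[OF assms(1)])
  also have "\<dots> \<le> iter g a (N * n * q) (w + of_int D)" by (rule it_mono[OF D(1)])
  also have "\<dots> = iter g a (N * q * n) w + of_int D" by (simp only: it_shift) (simp add: ac_simps)
  also have "\<dots> \<le> w + of_int (int (N * q) * m) + of_int D"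
    using it_pow_le[OF assms(2), of "N * q"] by simp
  also have "\<dots> \<le> u + of_int (int (N * q) * m) + 2 * of_int D" using D by simp
  finally have "of_int (int (N * n) * p - int (N * q) * m) \<le> (of_int (2 * D) :: real)" by simp
  then have "int (N * n) * p - int (N * q) * m \<le> 2 * D" by (simp only: of_int_le_iff)
  moreover have "int (N * n) * p - int (N * q) * m = int N * (p * int n - m * int q)"
    by (simp add: algebra_simps)
  moreover have "int N * (p * int n - m * int q) \<ge> int N * 1"
    using pos by (intro mult_left_mono) auto
  ultimately have "int N \<le> 2 * D" by linarith
  then show False using D(3) unfolding N_def by simp
qed

lemma fix_iter:
  assumes "iter g a q x = x + of_int p"
  shows "iter g a q (iter g a n x + of_int m) = iter g a n x + of_int m + of_int p"
  by (metis (no_types) assms it_shift iter_add add.commute add.left_commute)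

text \<open>Strictness at the periodic point itself excludes equal rotation numbers: after
  \<open>q * n\<close> steps \<open>x\<close> would move by an integer and also by less than that
  integer.\<close>

lemma fix_strict:
  assumes "iter g a q x = x + of_int p" "iter g a n x < x + of_int m" "0 < q"
  shows "p * int n < m * int q"
proof (rule ccontr)
  assume c: "\<not> ?thesis"
  have "p * int n \<le> m * int q" using rot_compare[of x p a q n x m] assms by simp
  with c have e: "p * int n = m * int q" by simp
  have "iter g a (q * n) x < x + of_int (int q * m)" by (rule it_pow_less[OF assms(2,3)])
  moreover have "x + of_int (int n * p) \<le> iter g a (n * q) x" by (rule it_pow_ge) (simp add: assms)
  ultimately show False using e by (simp add: ac_simps)
qed

lemma fix_closed: "closed {x. iter g a q x = x + of_int p}"
  by (intro closed_Collect_eq continuous_intros it_cont)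

text \<open>The solutions form a closed set invariant under integer translations, so the supremum of
  those up to \<open>z\<close> is attained, within distance one of \<open>z\<close>.\<close>

lemma fix_largest_le:
  assumes "iter g a q x = x + of_int p"
  obtains y where "iter g a q y = y + of_int p" "z - 1 < y" "y \<le> z"
    "\<And>w. iter g a q w = w + of_int p \<Longrightarrow> w \<le> z \<Longrightarrow> w \<le> y"
proof -
  let ?S = "{x. iter g a q x = x + of_int p} \<inter> {..z}"
  define x' where "x' = x + of_int \<lfloor>z - x\<rfloor>"
  have x': "iter g a q x' = x' + of_int p" unfolding x'_def using assms it_shift by simp
  have x'z: "x' \<le> z" "z - 1 < x'" unfolding x'_def by linarith+
  have cl: "closed ?S" by (intro closed_Int fix_closed closed_atMost)
  have bd: "bdd_above ?S" by (rule bdd_aboveI[of _ z]) auto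
  have "Sup ?S \<in> ?S" by (rule closed_contains_Sup[OF _ bd cl]) (use x' x'z in auto)
  moreover have "w \<le> Sup ?S" if "w \<in> ?S" for w by (rule cSup_upper[OF that bd])
  ultimately show ?thesis using that[of "Sup ?S"] x' x'z by (simp add: less_le_trans)
qed

lemma fix_smallest_ge:
  assumes "iter g a q x = x + of_int p"
  obtains y where "iter g a q y = y + of_int p" "z \<le> y"
    "\<And>w. iter g a q w = w + of_int p \<Longrightarrow> z \<le> w \<Longrightarrow> y \<le> w"
proof -
  let ?S = "{x. iter g a q x = x + of_int p} \<inter> {z..}"
  define x' where "x' = x + of_int \<lceil>z - x\<rceil>"
  have x': "iter g a q x' = x' + of_int p" unfolding x'_def using assms it_shift by simp
  have x'z: "z \<le> x'" unfolding x'_def by linarith+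
  have cl: "closed ?S" by (intro closed_Int fix_closed closed_atLeast)
  have bd: "bdd_below ?S" by (rule bdd_belowI[of _ z]) auto
  have "Inf ?S \<in> ?S" by (rule closed_contains_Inf[OF _ bd cl]) (use x' x'z in auto)
  moreover have "Inf ?S \<le> w" if "w \<in> ?S" for w by (rule cInf_lower[OF that bd])
  ultimately show ?thesis using that[of "Inf ?S"] by auto
qed

end

text \<open>Monotonicity of the smaller map suffices, so \<open>h\<close> may be the bimodal map
  itself.\<close>

lemma iter_le_iter:
  assumes "mono_lift g" "\<And>x. g x \<le> h x" "a \<le> b"
  shows "iter g a n x \<le> iter h b n x"
proof (induction n)
  case (Suc n)
  have "g (iter g a n x) \<le> g (iter h b n x)"
    by (rule monoD[OF mono_lift.g_mono[OF assms(1)] Suc])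
  also have "\<dots> \<le> h (iter h b n x)" by (rule assms(2))
  finally show ?case using assms(3) by (simp add: iter_Suc)
qed simp

lemma mono_lift_refl_map:
  assumes "mono_lift g"
  shows "mono_lift (refl_map g)"
proof
  interpret mono_lift g by fact
  show "mono (refl_map g)" by (auto simp: refl_map_def intro!: monoI monoD[OF g_mono])
  show "continuous_on UNIV (refl_map g)"
    unfolding refl_map_def by (intro continuous_intros continuous_on_compose2[OF g_cont]) auto
  show "refl_map g (x + 1) = refl_map g x + 1" for x
    using g_per[of "- x - 1"] by (simp add: refl_map_def)
qed

section \<open>Parameters of tangency\<close>

text \<open>The name says where the line x + p lies relative to the graph. This kind of tangency
  marks the left end of the parameters with rotation number p/q, and \<open>touch_below\<close>
  marks the right end.\<close>

definition touch_above :: "(real \<Rightarrow> real) \<Rightarrow> nat \<Rightarrow> int \<Rightarrow> real \<Rightarrow> bool" where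
  "touch_above g q p a \<longleftrightarrow>
     (\<forall>x. iter g a q x \<le> x + of_int p) \<and> (\<exists>x. iter g a q x = x + of_int p)"

definition touch_below :: "(real \<Rightarrow> real) \<Rightarrow> nat \<Rightarrow> int \<Rightarrow> real \<Rightarrow> bool" where
  "touch_below g q p a \<longleftrightarrow>
     (\<forall>x. x + of_int p \<le> iter g a q x) \<and> (\<exists>x. iter g a q x = x + of_int p)"

lemma touch_refl_map: "touch_below (refl_map g) q (- p) (- a) \<longleftrightarrow> touch_above g q p a"
proof
  assume "touch_below (refl_map g) q (- p) (- a)"
  then have 1: "\<And>x. x - of_int p \<le> - iter g a q (- x)"
    and 2: "\<exists>x. - iter g a q (- x) = x - of_int p"
    by (auto simp: touch_below_def iter_refl_map)
  have "iter g a q x \<le> x + of_int p" for x using 1[of "- x"] by simp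
  moreover have "\<exists>x. iter g a q x = x + of_int p" using 2
    by (metis add.inverse_inverse minus_diff_eq uminus_add_conv_diff add.commute)
  ultimately show "touch_above g q p a" by (auto simp: touch_above_def)
next
  assume "touch_above g q p a"
  then have 1: "\<And>x. iter g a q x \<le> x + of_int p" and 2: "\<exists>x. iter g a q x = x + of_int p"
    by (auto simp: touch_above_def)
  have "x - of_int p \<le> - iter g a q (- x)" for x using 1[of "- x"] by simp
  moreover have "\<exists>x. - iter g a q (- x) = x - of_int p" using 2
    by (metis add.inverse_inverse minus_diff_eq uminus_add_conv_diff add.commute)
  ultimately show "touch_below (refl_map g) q (- p) (- a)"
    by (auto simp: touch_below_def iter_refl_map)
qed

lemma touch_refl_map': "touch_above (refl_map g) q (- p) (- a) \<longleftrightarrow> touch_below g q p a"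
  using touch_refl_map[of "refl_map g" q "- p" "- a"] by simp

context mono_lift begin

lemma touch_above_less:
  assumes "touch_above g q p a" "b < a" "0 < q"
  shows "iter g b q x < x + of_int p"
  using assms it_strict_param[OF assms(3,2), of x] unfolding touch_above_def
  by (meson less_le_trans)

lemma touch_above_ge:
  assumes "touch_above g q p a" "x + of_int p \<le> iter g b q x" "0 < q"
  shows "a \<le> b"
  using touch_above_less[OF assms(1) _ assms(3), of b x] assms(2) by linarith

lemma touch_below_greater:
  assumes "touch_below g q p a" "a < b" "0 < q"
  shows "x + of_int p < iter g b q x"
  using assms it_strict_param[OF assms(3,2), of x] unfolding touch_below_def
  by (meson le_less_trans)

text \<open>The candidate is the least parameter for which the graph reaches x + p. It is attained
  by compactness modulo one, and there the graph cannot cross the line, since by continuity a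
  smaller parameter would already reach it.\<close>

lemma touch_above_exists:
  assumes q: "0 < q"
  shows "\<exists>a. touch_above g q p a"
proof -
  let ?Z = "{(a, x). x + of_int p \<le> iter g a q x}"
  let ?A = "{a. \<exists>x. x + of_int p \<le> iter g a q x}"
  define u where "u = iter g 0 q 0"
  have cl: "closed ?Z"
    unfolding split_beta
    by (intro closed_Collect_le continuous_intros)
      (use it_cont2[of q] in \<open>simp_all add: split_beta\<close>)
  have red: "\<exists>x\<in>{0..1}. x + of_int p \<le> iter g a q x" if "a \<in> ?A" for a
  proof -
    from that obtain x where x: "x + of_int p \<le> iter g a q x" by blast
    have "iter g a q (x - of_int \<lfloor>x\<rfloor>) = iter g a q x - of_int \<lfloor>x\<rfloor>" by (rule it_shift')
    moreover have "x - of_int \<lfloor>x\<rfloor> \<in> {0..1}" by (auto; linarith)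
    ultimately show ?thesis using x by (intro bexI[of _ "x - of_int \<lfloor>x\<rfloor>"]) auto
  qed
  have ne: "?A \<noteq> {}"
  proof -
    define d where "d = \<bar>of_int p - u\<bar>"
    have "u + d \<le> iter g d q 0" unfolding u_def using it_param_add[OF q, of d 0 0] by (simp add: d_def)
    then have "0 + of_int p \<le> iter g d q 0" unfolding d_def by linarith
    then show ?thesis by blast
  qed
  have bd: "bdd_below ?A"
  proof (rule bdd_belowI)
    fix a assume "a \<in> ?A"
    then obtain x where x: "x \<in> {0..1}" "x + of_int p \<le> iter g a q x" using red by blast
    show "min 0 (of_int p - u - 1) \<le> a"
    proof (cases "a < 0")
      \<comment> \<open>For \<open>x\<close> in [0, 1] the value at \<open>x\<close> is at most the
        value at 0 plus one, and lowering the parameter from 0 to \<open>a\<close> lowers the value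
        at 0 by at least \<open>- a\<close>.\<close>
      case True
      have "iter g a q x \<le> iter g a q (0 + of_int 1)" using x by (intro it_mono) simp
      then have "iter g a q x \<le> iter g a q 0 + 1" by (simp only: it_shift)
      moreover have "iter g a q 0 + (- a) \<le> u" unfolding u_def
        using it_param_add[OF q, of "- a" a 0] True by simp
      ultimately have "x + of_int p \<le> u + a + 1" using x by linarith
      then show ?thesis using x by auto
    qed simp
  qed
  define a where "a = Inf ?A"
  have below: "iter g b q x < x + of_int p" if "b < a" for b x
  proof (rule ccontr)
    assume "\<not> ?thesis"
    then have "x + of_int p \<le> iter g b q x" by simp
    then have "b \<in> ?A" by blast
    then have "a \<le> b" unfolding a_def by (rule cInf_lower[OF _ bd])
    then show False using that by simp
  qed
  have "a \<in> ?A"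
  proof -
    have "\<exists>y. (\<forall>n. y n \<in> ?A \<and> y n < a + 1 / Suc n)"
    proof -
      have "\<exists>z\<in>?A. z < a + 1 / Suc n" for n
        using cInf_less_iff[OF ne bd, of "a + 1 / Suc n"] unfolding a_def by simp
      then show ?thesis by metis
    qed
    then obtain y where y: "\<And>n. y n \<in> ?A" "\<And>n. y n < a + 1 / Suc n" by blast
    have "a \<le> y n" for n unfolding a_def by (rule cInf_lower[OF y(1) bd])
    have lim: "y \<longlonglongrightarrow> a"
    proof (rule tendsto_sandwich[of "\<lambda>_. a"])
      show "(\<lambda>n. a + 1 / Suc n) \<longlonglongrightarrow> a"
        using LIMSEQ_inverse_real_of_nat_add[of a] by (simp add: inverse_eq_divide)
    qed (use \<open>\<And>n. a \<le> y n\<close> y(2) in \<open>auto intro!: always_eventually less_imp_le\<close>)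
    have "\<forall>n. \<exists>x\<in>{0..1}. x + of_int p \<le> iter g (y n) q x" using red y(1) by blast
    then obtain x where x: "\<And>n. x n \<in> {0..1}" "\<And>n. x n + of_int p \<le> iter g (y n) q (x n)" by metis
    obtain l r where r: "l \<in> {0..1}" "strict_mono r" "(x \<circ> r) \<longlonglongrightarrow> l"
      using compact_Icc[of "0::real" 1] x(1) unfolding compact_def by metis
    have "(\<lambda>n. ((y \<circ> r) n, (x \<circ> r) n)) \<longlonglongrightarrow> (a, l)"
      by (intro tendsto_Pair r LIMSEQ_subseq_LIMSEQ lim)
    moreover have "\<And>n. ((y \<circ> r) n, (x \<circ> r) n) \<in> ?Z" using x(2) by auto
    ultimately have "(a, l) \<in> ?Z"
      using closed_sequentially[OF cl, of "\<lambda>n. ((y \<circ> r) n, (x \<circ> r) n)" "(a, l)"] by blast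
    then show ?thesis by blast
  qed
  then obtain x0 where x0: "x0 + of_int p \<le> iter g a q x0" by blast
  have le: "iter g a q x \<le> x + of_int p" for x
  proof (rule ccontr)
    assume "\<not> ?thesis"
    then have *: "x + of_int p < iter g a q x" by simp
    have "isCont (\<lambda>b. iter g b q x) a"
      using it_cont_param[of UNIV q x] by (simp add: continuous_on_eq_continuous_at)
    then have "\<forall>\<^sub>F b in at_left a. x + of_int p < iter g b q x"
      using * by (metis order_tendstoD(1) continuous_within filterlim_at_split)
    then have "\<forall>\<^sub>F b in at_left a. x + of_int p < iter g b q x \<and> b < a"
      by (intro eventually_conj) (auto simp: eventually_at_filter)
    then obtain b where "x + of_int p < iter g b q x" "b < a"
      using eventually_happens[of _ "at_left a"] trivial_limit_at_left_real by blast
    then show False using below[of b x] by simp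
  qed
  then show ?thesis unfolding touch_above_def using x0 by (intro exI[of _ a]) (auto intro!: exI[of _ x0] antisym)
qed

lemma touch_below_exists: "0 < q \<Longrightarrow> \<exists>a. touch_below g q p a"
  using mono_lift.touch_above_exists[OF mono_lift_refl_map[OF mono_lift_axioms], of q "- p"]
    touch_refl_map'[of g q p "- a" for a] by (metis minus_minus)

end

section \<open>Negative Schwarzian derivative\<close>

text \<open>Here \<open>A\<close> is the nonlinearity \<open>\<phi>'' / \<phi>'\<close> of a map with derivative \<open>\<phi>1\<close>; in terms of it the
  Schwarzian derivative is \<open>A' - A\<^sup>2 / 2\<close>.\<close>

lemma minimum_principle:
  fixes \<phi>1 A B :: "real \<Rightarrow> real"
  assumes d1: "\<And>t. u \<le> t \<Longrightarrow> t \<le> v \<Longrightarrow> (\<phi>1 has_real_derivative A t * \<phi>1 t) (at t)"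
    and dA: "\<And>t. u \<le> t \<Longrightarrow> t \<le> v \<Longrightarrow> (A has_real_derivative B t) (at t)"
    and pos: "\<And>t. u \<le> t \<Longrightarrow> t \<le> v \<Longrightarrow> 0 < \<phi>1 t"
    and neg: "\<And>t. u \<le> t \<Longrightarrow> t \<le> v \<Longrightarrow> B t < (A t)\<^sup>2 / 2"
    and t: "u < t" "t < v"
  shows "min (\<phi>1 u) (\<phi>1 v) < \<phi>1 t"
proof -
  have c1: "continuous_on {u..v} \<phi>1"
    by (rule DERIV_continuous_on[of _ _ "\<lambda>t. A t * \<phi>1 t"])
      (use d1 in \<open>auto intro: has_field_derivative_at_within\<close>)
  obtain s where s: "s \<in> {u..v}" "\<And>r. r \<in> {u..v} \<Longrightarrow> \<phi>1 s \<le> \<phi>1 r"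
    using continuous_attains_inf[OF compact_Icc _ c1] t by force
  \<comment> \<open>At an interior minimum \<open>A\<close> vanishes, so \<open>B\<close> is
    negative there and \<open>A\<close> becomes negative just to the right, where
    \<open>\<phi>1\<close> would then drop below its minimum.\<close>
  have no_interior: False if s': "u < s'" "s' < v" and m: "\<And>r. r \<in> {u..v} \<Longrightarrow> \<phi>1 s' \<le> \<phi>1 r" for s'
  proof -
    have "A s' * \<phi>1 s' = 0"
    proof (rule DERIV_local_min[OF d1])
      show "0 < min (s' - u) (v - s')" using s' by simp
      show "\<forall>y. \<bar>s' - y\<bar> < min (s' - u) (v - s') \<longrightarrow> \<phi>1 s' \<le> \<phi>1 y"
        by (intro allI impI m) (auto simp: abs_if split: if_splits)
    qed (use s' in auto)
    then have A0: "A s' = 0" using pos[of s'] s' by simp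
    have "B s' < 0" using neg[of s'] A0 s' by simp
    then obtain d where d: "0 < d" "\<And>e. 0 < e \<Longrightarrow> e < d \<Longrightarrow> A (s' + e) < 0"
      using DERIV_neg_dec_right[OF dA[of s']] A0 s' by auto
    define e where "e = min d (v - s') / 2"
    have e: "0 < e" "e < d" "s' + e < v" unfolding e_def using d s' by (auto simp: min_def field_simps)
    have "\<phi>1 (s' + e) < \<phi>1 s'"
    proof (rule DERIV_neg_imp_decreasing_open[where f = \<phi>1 and a = s'])
      show "s' < s' + e" using e by simp
      fix x assume that: "s' < x" "x < s' + e"
      show "\<exists>y. (\<phi>1 has_real_derivative y) (at x) \<and> y < 0"
      proof -
        have "A x < 0" using d(2)[of "x - s'"] that e by simp
        then show ?thesis using d1[of x] pos[of x] that e s'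
          by (intro exI[of _ "A x * \<phi>1 x"]) (auto simp: mult_neg_pos)
      qed
    next
      show "continuous_on {s'..s' + e} \<phi>1" by (rule continuous_on_subset[OF c1]) (use e s' in auto)
    qed
    then show False using m[of "s' + e"] e s' by auto
  qed
  have "s = u \<or> s = v" using no_interior[of s] s by force
  moreover have "\<phi>1 s < \<phi>1 t"
    using no_interior[of t] s t by (metis atLeastAtMost_iff less_eq_real_def order_trans)
  ultimately show ?thesis by auto
qed

text \<open>If the graph of such a map meets a line of slope one with slope at least one and is above the
  line at the end, it stays above: otherwise the slope would have a positive interior minimum.\<close>

lemma above_diagonal:
  fixes \<phi> \<phi>1 A B :: "real \<Rightarrow> real"
  assumes d0: "\<And>t. u \<le> t \<Longrightarrow> t < v \<Longrightarrow> (\<phi> has_real_derivative \<phi>1 t) (at t)"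
    and d1: "\<And>t. u \<le> t \<Longrightarrow> t < v \<Longrightarrow> (\<phi>1 has_real_derivative A t * \<phi>1 t) (at t)"
    and dA: "\<And>t. u \<le> t \<Longrightarrow> t < v \<Longrightarrow> (A has_real_derivative B t) (at t)"
    and pos: "\<And>t. u \<le> t \<Longrightarrow> t < v \<Longrightarrow> 0 < \<phi>1 t"
    and neg: "\<And>t. u \<le> t \<Longrightarrow> t < v \<Longrightarrow> B t < (A t)\<^sup>2 / 2"
    and cont: "continuous_on {u..v} \<phi>"
    and start: "\<phi> u = u + s" "1 \<le> \<phi>1 u" and final: "v + s < \<phi> v"
    and w: "u < w" "w < v"
  shows "w + s < \<phi> w"
proof (rule ccontr)
  assume "\<not> ?thesis"
  then have le: "\<phi> w \<le> w + s" by simp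
  \<comment> \<open>A slope above one occurs at an interior point \<open>z\<close>; the end
    \<open>v\<close>, where the slope may vanish, is avoided. The minimum principle on [u, z] then
    keeps the slope above one up to \<open>w\<close>.\<close>
  have "\<exists>l z. w < z \<and> z < v \<and> (\<phi> has_real_derivative l) (at z) \<and> \<phi> v - \<phi> w = (v - w) * l"
    by (rule MVT)
      (use w in \<open>auto intro!: continuous_on_subset[OF cont] exI d0 simp: real_differentiable_def\<close>)
  then obtain l z where z: "w < z" "z < v" "(\<phi> has_real_derivative l) (at z)"
    "\<phi> v - \<phi> w = (v - w) * l" by blast
  have l: "l = \<phi>1 z" using DERIV_unique[OF z(3) d0[of z]] z w by simp
  have "(v - w) * 1 < (v - w) * l" using z(4) le final by simp
  then have z1: "1 < \<phi>1 z" using w l by (simp add: mult_less_cancel_left_pos)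
  have big: "1 < \<phi>1 t" if "u < t" "t < z" for t
  proof -
    have "min (\<phi>1 u) (\<phi>1 z) < \<phi>1 t"
      by (rule minimum_principle[where A = A and B = B]) (use that z d1 dA pos neg in auto)
    then show ?thesis using z1 start by simp
  qed
  have "\<exists>l y. u < y \<and> y < w \<and> (\<phi> has_real_derivative l) (at y) \<and> \<phi> w - \<phi> u = (w - u) * l"
    by (rule MVT)
      (use w in \<open>auto intro!: continuous_on_subset[OF cont] exI d0 simp: real_differentiable_def\<close>)
  then obtain l' y where y: "u < y" "y < w" "(\<phi> has_real_derivative l') (at y)"
    "\<phi> w - \<phi> u = (w - u) * l'" by blast
  have "l' = \<phi>1 y" using DERIV_unique[OF y(3) d0[of y]] y w by simp
  then have "1 < l'" using big[of y] y z by simp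
  then have "(w - u) * 1 < (w - u) * l'" using w by (intro mult_strict_left_mono) auto
  then show False using y(4) le start by simp
qed

definition iter_d :: "(real \<Rightarrow> real) \<Rightarrow> (real \<Rightarrow> real) \<Rightarrow> real \<Rightarrow> nat \<Rightarrow> real \<Rightarrow> real" where
  "iter_d f f1 a n x = (\<Prod>i<n. f1 (iter f a i x))"

lemma DERIV_iter:
  assumes "\<And>x. (f has_real_derivative f1 x) (at x)"
  shows "(iter f a n has_real_derivative iter_d f f1 a n x) (at x)"
proof (induction n)
  case 0
  have "iter f a 0 = (\<lambda>x. x)" by (simp add: fun_eq_iff)
  then show ?case by (simp add: iter_d_def)
next
  case (Suc n)
  have "((\<lambda>x. f (iter f a n x) + a) has_real_derivative f1 (iter f a n x) * iter_d f f1 a n x) (at x)"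
    using DERIV_add[OF DERIV_chain2[OF assms Suc] DERIV_const[of a]] by simp
  moreover have "iter f a (Suc n) = (\<lambda>x. f (iter f a n x) + a)" by (simp add: fun_eq_iff iter_Suc)
  ultimately show ?case by (simp add: iter_d_def mult.commute)
qed

text \<open>The chain rule for nonlinearities is \<open>N(f \<circ> g) = (N f \<circ> g) g' + N g\<close>; it gives
  \<open>S(f \<circ> g) = (S f \<circ> g) g'\<^sup>2 + S g\<close>.\<close>

lemma iter_nonlinearity:
  fixes f f1 f2 f3 :: "real \<Rightarrow> real"
  assumes df: "\<And>x. (f has_real_derivative f1 x) (at x)"
    and df1: "\<And>x. (f1 has_real_derivative f2 x) (at x)"
    and df2: "\<And>x. (f2 has_real_derivative f3 x) (at x)"
    and S: "\<And>x. f1 x \<noteq> 0 \<Longrightarrow> f3 x / f1 x - 3 / 2 * (f2 x / f1 x)\<^sup>2 < 0"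
    and n: "0 < n"
  shows "\<exists>A B. \<forall>x. (\<forall>i<n. f1 (iter f a i x) \<noteq> 0) \<longrightarrow>
     (iter_d f f1 a n has_real_derivative A x * iter_d f f1 a n x) (at x) \<and>
     (A has_real_derivative B x) (at x) \<and> B x < (A x)\<^sup>2 / 2"
proof -
  \<comment> \<open>The induction starts from the identity map, whose Schwarzian derivative is zero,
    so the weak inequality is carried along and the strict one is recorded for positive
    \<open>n\<close>.\<close>
  have "\<exists>A B. \<forall>x. (\<forall>i<n. f1 (iter f a i x) \<noteq> 0) \<longrightarrow>
     (iter_d f f1 a n has_real_derivative A x * iter_d f f1 a n x) (at x) \<and>
     (A has_real_derivative B x) (at x) \<and>
     (B x \<le> (A x)\<^sup>2 / 2) \<and> (0 < n \<longrightarrow> B x < (A x)\<^sup>2 / 2)"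
  proof (induction n)
    case 0
    have "iter_d f f1 a 0 = (\<lambda>x. 1)" by (simp add: fun_eq_iff iter_d_def)
    then show ?case by (intro exI[of _ "\<lambda>x. 0"]) simp
  next
    case (Suc n)
    then obtain A B where AB: "\<And>x. (\<forall>i<n. f1 (iter f a i x) \<noteq> 0) \<Longrightarrow>
     (iter_d f f1 a n has_real_derivative A x * iter_d f f1 a n x) (at x) \<and>
     (A has_real_derivative B x) (at x) \<and> (B x \<le> (A x)\<^sup>2 / 2)" by blast
    let ?y = "iter f a n" and ?d = "iter_d f f1 a n"
    define N where "N = (\<lambda>x. f2 x / f1 x)"
    define N' where "N' = (\<lambda>x. (f3 x * f1 x - f2 x * f2 x) / (f1 x * f1 x))"
    have dN: "(N has_real_derivative N' x) (at x)" if "f1 x \<noteq> 0" for x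
      unfolding N_def N'_def by (rule DERIV_divide[OF df2 df1 that])
    have SN: "N' x < (N x)\<^sup>2 / 2" if "f1 x \<noteq> 0" for x
    proof -
      have "N' x = f3 x / f1 x - (f2 x / f1 x)\<^sup>2"
        using that unfolding N'_def by (simp add: field_simps power2_eq_square)
      then show ?thesis using S[OF that] unfolding N_def by simp
    qed
    have Suc_d: "iter_d f f1 a (Suc n) = (\<lambda>x. f1 (?y x) * ?d x)"
      by (simp add: fun_eq_iff iter_d_def)
    show ?case
    proof (rule exI[of _ "\<lambda>x. N (?y x) * ?d x + A x"],
        rule exI[of _ "\<lambda>x. (N' (?y x) * ?d x * ?d x + N (?y x) * (A x * ?d x)) + B x"],
        intro allI impI)
      fix x assume nz: "\<forall>i<Suc n. f1 (iter f a i x) \<noteq> 0"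
      then have y: "f1 (?y x) \<noteq> 0" and d: "?d x \<noteq> 0" by (auto simp: iter_d_def)
      note ABx = AB[of x]
      have dd: "(?d has_real_derivative A x * ?d x) (at x)"
        and dA: "(A has_real_derivative B x) (at x)" and Bx: "B x \<le> (A x)\<^sup>2 / 2"
        using ABx nz by auto
      note dy = DERIV_iter[of f f1 a n x, OF df]
      have 1: "((\<lambda>x. f1 (?y x) * ?d x) has_real_derivative
          (N (?y x) * ?d x + A x) * (f1 (?y x) * ?d x)) (at x)"
        by (rule DERIV_cong[OF DERIV_mult[OF DERIV_chain2[OF df1 dy] dd]])
          (use y in \<open>simp add: N_def field_simps\<close>)
      have 2: "((\<lambda>x. N (?y x) * ?d x + A x) has_real_derivative
          (N' (?y x) * ?d x * ?d x + N (?y x) * (A x * ?d x)) + B x) (at x)"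
        by (rule DERIV_cong[OF DERIV_add[OF DERIV_mult[OF DERIV_chain2[OF dN[OF y] dy] dd] dA]])
          (simp add: algebra_simps)
      \<comment> \<open>The mixed term of the square equals the one in the derivative; what remains
        is this inequality together with the induction hypothesis.\<close>
      have "N' (?y x) * (?d x)\<^sup>2 < (N (?y x))\<^sup>2 / 2 * (?d x)\<^sup>2"
        by (rule mult_strict_right_mono[OF SN[OF y]]) (use d in simp)
      then have 3: "(N' (?y x) * ?d x * ?d x + N (?y x) * (A x * ?d x)) + B x
          < (N (?y x) * ?d x + A x)\<^sup>2 / 2"
        using Bx by (simp add: power2_eq_square algebra_simps)
      show "(iter_d f f1 a (Suc n) has_real_derivative
            (N (?y x) * ?d x + A x) * iter_d f f1 a (Suc n) x) (at x) \<and>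
          ((\<lambda>x. N (?y x) * ?d x + A x) has_real_derivative
            (N' (?y x) * ?d x * ?d x + N (?y x) * (A x * ?d x)) + B x) (at x) \<and>
          (N' (?y x) * ?d x * ?d x + N (?y x) * (A x * ?d x)) + B x
            \<le> (N (?y x) * ?d x + A x)\<^sup>2 / 2 \<and>
          (0 < Suc n \<longrightarrow> (N' (?y x) * ?d x * ?d x + N (?y x) * (A x * ?d x)) + B x
            < (N (?y x) * ?d x + A x)\<^sup>2 / 2)"
        using 1 2 3 unfolding Suc_d by simp
    qed
  qed
  then show ?thesis using n by blast
qed

section \<open>Bimodal lifts and their monotone bounds\<close>

text \<open>The reals \<open>k\<close>, \<open>C\<close>, \<open>K\<close>, \<open>c\<close> stand
  for K^-, C, K, C^+, and \<open>g\<close>, \<open>h\<close> for the lower and upper monotone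
  bounds, described by their plateaus and by their agreement with \<open>f\<close> on increasing
  branches. This description is symmetric under reflection.\<close>

locale bimodal =
  fixes f g h f1 f2 f3 :: "real \<Rightarrow> real" and k C K c :: real
  assumes lift_g: "mono_lift g" and lift_h: "mono_lift h"
    and f_per: "f (x + 1) = f x + 1"
    and ord: "k < C" "C < K" "K < c" "K - 1 < k" "c < C + 1" "c \<le> k + 1"
    and f_inc: "K - 1 \<le> x \<Longrightarrow> x < y \<Longrightarrow> y \<le> C \<Longrightarrow> f x < f y"
    and g_le: "g x \<le> f x" and h_ge: "f x \<le> h x"
    and g_eq: "K - 1 \<le> x \<Longrightarrow> x \<le> k \<Longrightarrow> g x = f x"
    and g_flat: "k \<le> x \<Longrightarrow> x \<le> K \<Longrightarrow> g x = g k"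
    and h_eq: "c - 1 \<le> x \<Longrightarrow> x \<le> C \<Longrightarrow> h x = f x"
    and h_flat: "C \<le> x \<Longrightarrow> x \<le> c \<Longrightarrow> h x = h c"
    and df: "(f has_real_derivative f1 x) (at x)"
    and df1: "(f1 has_real_derivative f2 x) (at x)"
    and df2: "(f2 has_real_derivative f3 x) (at x)"
    and f1_pos: "K - 1 < x \<Longrightarrow> x < C \<Longrightarrow> 0 < f1 x"
    and schw: "f1 x \<noteq> 0 \<Longrightarrow> f3 x / f1 x - 3 / 2 * (f2 x / f1 x)\<^sup>2 < 0"
begin

sublocale g: mono_lift g by (rule lift_g)
sublocale h: mono_lift h by (rule lift_h)

abbreviation "F \<equiv> iter f"
abbreviation "G \<equiv> iter g"
abbreviation "H \<equiv> iter h"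

lemma f_shift: "f (x + of_int m) = f x + of_int m"
  by (rule int_periodic) (rule f_per)

lemma f1_shift: "f1 (x + of_int m) = f1 x"
proof -
  have "((\<lambda>x. f (x + of_int m)) has_real_derivative f1 (x + of_int m)) (at x)"
    using df[of "x + of_int m"] by (simp add: DERIV_shift)
  moreover have "((\<lambda>x. f x + of_int m) has_real_derivative f1 x) (at x)"
    using DERIV_add[OF df[of x] DERIV_const[of "of_int m"]] by simp
  ultimately show ?thesis using DERIV_unique f_shift by simp
qed

lemma F_cont: "continuous_on S (F a n)"
proof -
  have "isCont (F a n) x" for x
    by (rule DERIV_isCont[OF DERIV_iter]) (rule df)
  then show ?thesis by (simp add: continuous_at_imp_continuous_on)
qed

lemma GF_le: "G a n x \<le> F a n x"
  by (rule iter_le_iter[OF lift_g g_le]) simp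

text \<open>Here the larger map is the monotone one, so first \<open>f\<close> is replaced by
  \<open>h\<close> at the same point and then the point is moved.\<close>

lemma FH_le: "F a n x \<le> H a n x"
proof (induction n)
  case (Suc n)
  have "f (F a n x) \<le> h (F a n x)" by (rule h_ge)
  also have "\<dots> \<le> h (H a n x)" by (rule monoD[OF h.g_mono Suc])
  finally show ?case by (simp add: iter_Suc)
qed simp

lemma GH_le: "a \<le> b \<Longrightarrow> G a n x \<le> H b n x"
  by (rule order_trans[OF g.it_mono_param order_trans[OF GF_le FH_le]])

lemma gf_shift_eq:
  assumes "K + of_int m - 1 \<le> x" "x \<le> k + of_int m"
  shows "g x = f x"
  using g_eq[of "x - of_int m"] g.g_shift[of "x - of_int m" m] f_shift[of "x - of_int m" m] assms
  by simp

lemma hf_shift_eq: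
  assumes "c + of_int m - 1 \<le> x" "x \<le> C + of_int m"
  shows "h x = f x"
  using h_eq[of "x - of_int m"] h.g_shift[of "x - of_int m" m] f_shift[of "x - of_int m" m] assms
  by simp

text \<open>The gap (k, c) contains the interiors of both plateaus, so off its translates neither
  bound differs from \<open>f\<close>.\<close>

lemma gh_eq:
  assumes "\<And>m. \<not> (k + of_int m < x \<and> x < c + of_int m)"
  shows "g x = f x" "h x = f x"
proof -
  define m where "m = \<lceil>x - K\<rceil>"
  have m: "K + of_int m - 1 < x" "x \<le> K + of_int m" unfolding m_def by linarith+
  show "g x = f x" by (rule gf_shift_eq[of m]) (use m assms[of m] ord in auto)
  define n where "n = \<lfloor>x - c\<rfloor> + 1"
  have n: "c + of_int n - 1 \<le> x" "x < c + of_int n" unfolding n_def by linarith+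
  show "h x = f x" by (rule hf_shift_eq[of n]) (use n assms[of n] ord in auto)
qed

lemma G_flat: "0 < n \<Longrightarrow> k + of_int m \<le> x \<Longrightarrow> x \<le> K + of_int m \<Longrightarrow> G a n x = G a n k + of_int m"
proof (induction n)
  case (Suc n)
  have "g x = g k + of_int m"
    using g_flat[of "x - of_int m"] g.g_shift[of "x - of_int m" m] Suc.prems by simp
  then have "g x + a = (g k + a) + of_int m" by simp
  then show ?case by (simp only: iter_Suc_right g.it_shift)
qed simp

lemma H_flat: "0 < n \<Longrightarrow> C \<le> x \<Longrightarrow> x \<le> c \<Longrightarrow> H a n x = H a n c"
  using h_flat[of x] by (cases n) (simp_all add: iter_Suc_right)

lemma f_C: "f C = h c"
  using h_eq[of C] h_flat[of C] ord by simp

text \<open>\<open>C\<close> and \<open>c\<close> are the ends of the plateau of \<open>h\<close>,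
  whence f C = h c dominates g c. This bounds the orbit of the turning point from below by an orbit
  of the lower bound.\<close>

lemma F_C: "0 < n \<Longrightarrow> G a n c \<le> F a n C"
proof (cases n)
  case (Suc i)
  have "g c \<le> f c" by (rule g_le)
  also have "\<dots> \<le> f C" using f_C h_ge by simp
  finally have "G a i (g c + a) \<le> G a i (f C + a)" by (intro g.it_mono) simp
  then show ?thesis using GF_le[of a i "f C + a"] by (simp add: Suc iter_Suc_right)
qed simp

end

section \<open>Farey arithmetic of a fraction and its parents\<close>

locale farey =
  fixes p p1 p2 :: int and q q1 q2 :: nat
  assumes q_pos: "0 < q1" "0 < q2"
    and sums: "p = p1 + p2" "q = q1 + q2"
    and det: "p2 * int q1 - p1 * int q2 = 1"
begin

lemma det1: "p * int q1 - p1 * int q = 1"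
  using det by (simp add: sums algebra_simps)

lemma det2: "p2 * int q - p * int q2 = 1"
  using det by (simp add: sums algebra_simps)

lemma q0: "0 < q" using q_pos sums by simp

text \<open>\<open>det1\<close> is a Bezout relation for \<open>p\<close> and \<open>q\<close>, so
  \<open>q\<close> would divide \<open>i\<close>.\<close>

lemma not_multiple:
  assumes "0 < i" "i < q"
  shows "p * int i \<noteq> m * int q"
proof
  assume e: "p * int i = m * int q"
  have "int i = (p * int q1 - p1 * int q) * int i" by (simp add: det1)
  also have "\<dots> = p * int i * int q1 - p1 * int q * int i" by (simp add: algebra_simps)
  also have "\<dots> = int q * (m * int q1 - p1 * int i)" by (simp add: e algebra_simps)
  finally have "int q dvd int i" by (metis dvd_triv_left)
  then show False using assms by (simp add: nat_dvd_not_less)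
qed

end

section \<open>Orbits near the two plateaus\<close>

locale bimodal_farey = bimodal f g h f1 f2 f3 k C K c + farey p p1 p2 q q1 q2
  for f g h f1 f2 f3 :: "real \<Rightarrow> real" and k C K c :: real and p p1 p2 :: int and q q1 q2 :: nat
begin

text \<open>The hypotheses confine the rotation number of \<open>H\<close> to [p/q, p2/q2]. A visit
  to a translate of (k, c) at time \<open>i\<close> gives a further comparison with m/i, and the
  determinant one of Farey neighbours leaves no such \<open>i\<close> below
  \<open>q\<close>.\<close>

lemma H_orbit_avoids:
  assumes H2: "H a q2 c \<le> k + of_int p2" and Hq: "u + of_int p \<le> H a q u"
    and i: "0 < i" "i < q"
  shows "\<not> (k + of_int m < H a i c \<and> H a i c < c + of_int m)"
proof
  assume "k + of_int m < H a i c \<and> H a i c < c + of_int m"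
  then have lo: "k + of_int m < H a i c" and hi: "H a i c < c + of_int m" by auto
  have "p * int i \<le> m * int q" using h.rot_compare[OF Hq, of i c m] hi by simp
  with not_multiple[OF i, of m] have mi: "p * int i < m * int q" by simp
  consider "i < q2" | "i = q2" | "q2 < i" by linarith
  then show False
  proof cases
    case 1
    have "H a (q2 - i) k + of_int m \<le> H a (q2 - i) (H a i c)"
      using h.it_mono[of "k + of_int m" "H a i c" a "q2 - i"] lo by (simp add: h.it_shift)
    also have "\<dots> = H a q2 c" using 1 by (simp flip: iter_add)
    finally have "H a (q2 - i) k \<le> k + of_int (p2 - m)" using H2 by simp
    then have "p * int (q2 - i) \<le> (p2 - m) * int q" using h.rot_compare[OF Hq] by blast
    moreover have "p * int (q2 - i) \<noteq> (p2 - m) * int q"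
      by (rule not_multiple) (use 1 i sums q_pos in auto)
    ultimately have "p * int (q2 - i) < (p2 - m) * int q" by simp
    \<comment> \<open>Together with \<open>mi\<close> this would make p2 q - p q2 at least two,
      against \<open>det2\<close>.\<close>
    then have "p * int q2 - p * int i < p2 * int q - m * int q"
      using 1 by (simp add: of_nat_diff algebra_simps)
    then show False using mi det2 by linarith
  next
    case 2
    then have "k + of_int m < k + of_int p2" using lo H2 by simp
    then have "m + 1 \<le> p2" by simp
    then have "(m + 1) * int q \<le> p2 * int q" by (intro mult_right_mono) auto
    then have "m * int q + int q \<le> p2 * int q" by (simp add: algebra_simps)
    moreover have "2 \<le> int q" using q_pos sums by simp
    ultimately show False using mi[unfolded 2] det2 by linarith
  next
    case 3
    define i' where "i' = i - q2"
    define m' where "m' = m - p2"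
    have ii: "i = i' + q2" "0 < i'" "i' < q1" using 3 i sums unfolding i'_def by auto
    have mm: "m = m' + p2" unfolding m'_def by simp
    have "H a i c = H a i' (H a q2 c)" by (simp add: ii iter_add)
    also have "\<dots> \<le> H a i' (k + of_int p2)" by (rule h.it_mono[OF H2])
    also have "\<dots> = H a i' k + of_int p2" by (rule h.it_shift)
    finally have "k + of_int m' \<le> H a i' k" using lo mm by simp
    moreover have "H a q2 c \<le> c + of_int p2" using H2 ord by simp
    ultimately have 1: "m' * int q2 \<le> p2 * int i'" by (rule h.rot_compare)
    have 2: "0 \<le> m' * int q - p * int i'"
      using mi det2 by (simp add: ii mm algebra_simps)
    \<comment> \<open>The pair (i', m') is written as d (q1, p1) + e (q2, p2), which is possible in
      integers because the determinant is one. Since \<open>i' < q1\<close>, the coefficient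
      \<open>d\<close> vanishes, so the orbit has merely run through blocks of length
      \<open>q2\<close>.\<close>
    define d where "d = p2 * int i' - m' * int q2"
    define e where "e = m' * int q1 - p1 * int i'"
    have d0: "0 \<le> d" using 1 unfolding d_def by simp
    have "e - d = m' * int q - p * int i'" unfolding d_def e_def by (simp add: sums algebra_simps)
    with 2 d0 have e0: "0 \<le> e" by simp
    have "int q1 * d + int q2 * e = int i' * (p2 * int q1 - p1 * int q2)"
      unfolding d_def e_def by (simp add: algebra_simps)
    then have ie: "int i' = int q1 * d + int q2 * e" by (simp add: det)
    have "p1 * d + p2 * e = m' * (p2 * int q1 - p1 * int q2)"
      unfolding d_def e_def by (simp add: algebra_simps)
    then have me: "m' = p1 * d + p2 * e" by (simp add: det)
    have "d = 0"
    proof (rule ccontr)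
      assume "d \<noteq> 0"
      then have "int q1 * 1 \<le> int q1 * d" using d0 by (intro mult_left_mono) auto
      then have "int q1 \<le> int q1 * d" by (simp only: mult_1_right)
      moreover have "0 \<le> int q2 * e" using e0 by simp
      ultimately show False using ie ii(3) by linarith
    qed
    then have i3: "i' = nat e * q2" and m3: "m' = int (nat e) * p2"
      using ie me e0 by (simp_all add: nat_eq_iff2 mult.commute flip: of_nat_eq_iff[where 'a = int])
    have "H a i c = H a q2 (H a (nat e * q2) c)" by (simp add: ii i3 flip: iter_add) (simp add: add.commute)
    also have "\<dots> \<le> H a q2 (c + of_int (int (nat e) * p2))"
      by (intro h.it_mono h.it_pow_le) fact
    also have "\<dots> = H a q2 c + of_int m'" unfolding m3 by (rule h.it_shift)
    also have "\<dots> \<le> k + of_int m" using H2 mm by simp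
    finally show False using lo by simp
  qed
qed

lemma orbit_c_eq:
  assumes H2: "H a q2 c \<le> k + of_int p2" and Hq: "u + of_int p \<le> H a q u"
    and i: "i \<le> q"
  shows "G a i c = H a i c"
  using i
proof (induction i)
  case (Suc i)
  have "\<not> (k + of_int m < H a i c \<and> H a i c < c + of_int m)" for m
  proof (cases "i = 0")
    \<comment> \<open>At time zero the point is the end \<open>c\<close> of the gap, and
      \<open>c \<le> k + 1\<close> keeps it out of the other translates.\<close>
    case True
    show ?thesis
    proof
      assume "k + of_int m < H a i c \<and> H a i c < c + of_int m"
      then have "k + of_int m < c" "0 < m" using True by simp_all
      then have "(1::real) \<le> of_int m" by simp
      then show False using \<open>k + of_int m < c\<close> ord by simp
    qed
  qed (use H_orbit_avoids[OF H2 Hq] Suc.prems in auto)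
  then have "g (H a i c) = h (H a i c)" using gh_eq by metis
  then show ?case using Suc by (simp add: iter_Suc)
qed simp

text \<open>The iterate is constant on [k, K], so a periodic point there to the right of
  \<open>k\<close> would lift the value at \<open>k\<close> above k + p.\<close>

lemma fix_not_flat:
  assumes le: "\<And>x. G a q x \<le> x + of_int p" and y: "G a q y = y + of_int p"
  shows "\<not> (k + of_int m < y \<and> y \<le> K + of_int m)"
  using G_flat[OF q0, of m y a] le[of k] y by auto

text \<open>F^q is followed from \<open>y\<close> to the first point \<open>x\<close> whose orbit
  meets a turning point. Tangency gives slope at least one at \<open>y\<close>, the periodic point
  \<open>x0\<close> lifts the end of the branch above the line, and \<open>above_diagonal\<close>
  fills in between. The condition \<open>star\<close> keeps the orbits of \<open>y\<close> and
  \<open>k\<close> on the same increasing branches.\<close>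

lemma branch:
  assumes le: "\<And>x. G a q x \<le> x + of_int p" and y: "G a q y = y + of_int p"
    and yk: "k - 1 < y" "y \<le> k"
    and star: "\<And>j m. 0 < j \<Longrightarrow> j < q \<Longrightarrow> G a j y \<le> k + of_int m \<Longrightarrow> G a j k < k + of_int m"
    and x0: "G a q x0 = x0 + of_int p" "k < x0" "x0 \<le> c"
  shows "y = k" "\<And>w. k < w \<Longrightarrow> w < x0 \<Longrightarrow> w + of_int p < H a q w"
proof -
  \<comment> \<open>\<open>N j\<close> numbers the translate of (K - 1, k] that contains the
    periodic point \<open>G a j y\<close>; \<open>fix_not_flat\<close> keeps that point off the
    plateau.\<close>
  define N where "N = (\<lambda>j. \<lceil>G a j y - K\<rceil>)"
  have fixy: "G a q (G a j y) = G a j y + of_int p" for j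
    using g.fix_iter[OF y, of j 0] by simp
  have N: "K + of_int (N j) - 1 < G a j y" "G a j y \<le> k + of_int (N j)" for j
  proof -
    show "K + of_int (N j) - 1 < G a j y" unfolding N_def by linarith
    have "G a j y \<le> K + of_int (N j)" unfolding N_def by linarith
    then show "G a j y \<le> k + of_int (N j)" using fix_not_flat[OF le fixy[of j], of "N j"] by auto
  qed
  have yK: "K - 1 < y" using fix_not_flat[OF le y, of "-1"] yk by auto
  have N0: "N 0 = 0" unfolding N_def using yK yk ord by (auto simp: ceiling_eq_iff)
  have kN: "G a j k \<le> k + of_int (N j)" if "j < q" for j
    using star[of j "N j"] that N[of j] N0 by (cases "j = 0") auto
  have GF: "F a j w = G a j w" if "y \<le> w" "w \<le> k" "j \<le> q" for w j
    using that(3)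
  proof (induction j)
    case (Suc j)
    have "g (G a j w) = f (G a j w)"
    proof (rule gf_shift_eq)
      show "K + of_int (N j) - 1 \<le> G a j w"
        using N[of j] g.it_mono[OF that(1), of a j] by simp
      show "G a j w \<le> k + of_int (N j)"
        using kN[of j] g.it_mono[OF that(2), of a j] Suc.prems by simp
    qed
    then show ?case using Suc by (simp add: iter_Suc)
  qed simp
  \<comment> \<open>The infimum of \<open>?Z\<close> is the first point at which some iterate before
    time \<open>q\<close> reaches a turning point; the choice \<open>j = 0\<close> shows that it is
    at most \<open>C\<close>.\<close>
  let ?Z = "{w \<in> {y..C}. \<exists>j\<in>{..<q}. C + of_int (N j) \<le> F a j w}"
  define x where "x = Inf ?Z"
  have ZU: "?Z = (\<Union>j\<in>{..<q}. {y..C} \<inter> {w. C + of_int (N j) \<le> F a j w})" by auto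
  have clZ: "closed ?Z" unfolding ZU
    by (intro closed_UN finite_lessThan ballI closed_Int closed_atLeastAtMost closed_Collect_le
        F_cont continuous_on_const)
  have CZ: "C \<in> ?Z" using q0 N0 yk ord by (auto intro!: bexI[of _ 0])
  have bdZ: "bdd_below ?Z" by (rule bdd_belowI[of _ y]) auto
  have xZ: "x \<in> ?Z" unfolding x_def by (rule closed_contains_Inf[OF _ bdZ clZ]) (use CZ in blast)
  have below: "F a j w < C + of_int (N j)" if "y \<le> w" "w < x" "j < q" for w j
  proof (rule ccontr)
    assume "\<not> ?thesis"
    then have "\<exists>j\<in>{..<q}. C + of_int (N j) \<le> F a j w"
      using that by (intro bexI[of _ j]) auto
    then have "w \<in> ?Z" using that xZ by auto
    then have "x \<le> w" unfolding x_def by (rule cInf_lower[OF _ bdZ])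
    then show False using that by simp
  qed
  have kx: "k < x"
  proof (rule ccontr)
    assume "\<not> ?thesis"
    then have "x \<le> k" "y \<le> x" using xZ by auto
    from xZ obtain j where j: "j < q" "C + of_int (N j) \<le> F a j x" by auto
    have "F a j x = G a j x" using GF[of x j] \<open>x \<le> k\<close> \<open>y \<le> x\<close> j by simp
    also have "\<dots> \<le> G a j k" by (rule g.it_mono) fact
    also have "\<dots> \<le> k + of_int (N j)" by (rule kN) fact
    finally show False using j ord by simp
  qed
  have xC: "x \<le> C" using xZ by auto
  from xZ obtain j where j: "j < q" "C + of_int (N j) \<le> F a j x" by auto
  \<comment> \<open>The turning point is met exactly, since by continuity an overshoot would occur
    already further left.\<close>
  have "F a j x \<le> C + of_int (N j)"
  proof (rule ccontr)
    assume "\<not> ?thesis"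
    then have *: "C + of_int (N j) < F a j x" by simp
    have "isCont (F a j) x" by (rule DERIV_isCont[OF DERIV_iter]) (rule df)
    then have "\<forall>\<^sub>F w in at_left x. C + of_int (N j) < F a j w"
      using * by (metis order_tendstoD(1) continuous_within filterlim_at_split)
    moreover have "\<forall>\<^sub>F w in at_left x. y < w \<and> w < x"
      using eventually_at_left_real[of y x] kx yk by (auto elim: eventually_mono)
    ultimately have "\<forall>\<^sub>F w in at_left x. C + of_int (N j) < F a j w \<and> y < w \<and> w < x"
      by (rule eventually_conj)
    then obtain w where "C + of_int (N j) < F a j w" "y < w" "w < x"
      using eventually_happens[of _ "at_left x"] trivial_limit_at_left_real by blast
    then show False using below[of w j] j by simp
  qed
  with j have Fj: "F a j x = C + of_int (N j)" by simp
  \<comment> \<open>The orbit of \<open>w\<close> stays on the increasing branches: below their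
    upper ends by the choice of \<open>x\<close>, above their lower ends because it dominates the
    orbit of \<open>y\<close>.\<close>
  have above: "K + of_int (N j) - 1 < F a j w" if "y \<le> w" "w < x" "j < q" for w j
  proof -
    have "j < q \<longrightarrow> G a j y \<le> F a j w"
    proof (induction j)
      case (Suc j)
      show ?case
      proof
        assume j: "Suc j < q"
        with Suc have IH: "G a j y \<le> F a j w" by simp
        let ?m = "of_int (N j) :: real"
        have "f (G a j y - ?m) \<le> f (F a j w - ?m)"
        proof (cases "G a j y = F a j w")
          case False
          then show ?thesis
            using f_inc[of "G a j y - ?m" "F a j w - ?m"] IH N[of j] below[of w j] that j by simp
        qed simp
        then have "f (G a j y) \<le> f (F a j w)"
          using f_shift[of "G a j y - ?m" "N j"] f_shift[of "F a j w - ?m" "N j"] by simp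
        then show "G a (Suc j) y \<le> F a (Suc j) w"
          using g_le[of "G a j y"] by (simp add: iter_Suc)
      qed
    qed (use that in simp)
    then show ?thesis using N[of j] that by force
  qed
  have f1F: "0 < f1 (F a j w)" if "y \<le> w" "w < x" "j < q" for w j
    using f1_pos[of "F a j w - of_int (N j)"] f1_shift[of "F a j w - of_int (N j)" "N j"]
      above[OF that] below[OF that] by simp
  have x0K: "C < x0" using fix_not_flat[OF le x0(1), of 0] x0 ord by auto
  \<comment> \<open>From the turning point on, \<open>F_C\<close> compares the orbit with the
    \<open>G\<close>-orbit of \<open>c\<close>, which dominates that of \<open>x0\<close>. If the
    latter fell behind, the rotation number seen at \<open>x0\<close> would contradict the bound
    that the orbit of \<open>k\<close> provides.\<close>
  have Fx: "x0 + of_int p \<le> F a q x"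
  proof -
    have "G a (q - j) x0 \<le> G a (q - j) c" by (rule g.it_mono) fact
    also have "\<dots> \<le> F a (q - j) C" by (rule F_C) (use j in simp)
    finally have 1: "G a (q - j) x0 + of_int (N j) \<le> F a (q - j) C + of_int (N j)" by simp
    have 2: "F a q x = F a (q - j) C + of_int (N j)"
    proof -
      have "F a q x = F a (q - j) (F a j x)" using j by (simp flip: iter_add)
      then show ?thesis by (simp add: Fj iter_shift[of f, OF f_per])
    qed
    have "x0 + of_int (p - N j) \<le> G a (q - j) x0"
    proof (cases "j = 0")
      case True
      then show ?thesis using x0 N0 by simp
    next
      case False
      have "G a j k \<le> k + of_int (N j)" by (rule kN) fact
      show ?thesis
      proof (rule ccontr)
        assume "\<not> ?thesis"
        then have "p * int (q - j) < (p - N j) * int q"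
          by (intro g.fix_strict[OF x0(1) _ q0]) simp
        then have "N j * int q < p * int j" using j by (simp add: of_nat_diff algebra_simps)
        moreover have "p * int j \<le> N j * int q"
          using g.rot_compare[of y p a q j k "N j"] y \<open>G a j k \<le> k + of_int (N j)\<close> by simp
        ultimately show False by simp
      qed
    qed
    then show ?thesis using 1 2 by simp
  qed
  \<comment> \<open>To the left of the contact point \<open>y\<close> the graph lies below the line,
    so its slope at \<open>y\<close> cannot be less than one. There \<open>F\<close> agrees with
    \<open>G\<close> because the orbit of \<open>y\<close> lies strictly above the lower ends of its
    branches.\<close>
  have slope: "1 \<le> iter_d f f1 a q y"
  proof (rule ccontr)
    assume "\<not> ?thesis"
    then have "iter_d f f1 a q y - 1 < 0" by simp
    moreover have "((\<lambda>w. F a q w - w) has_real_derivative iter_d f f1 a q y - 1) (at y)"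
      by (intro DERIV_diff DERIV_iter DERIV_ident) (rule df)
    ultimately obtain d where d: "0 < d" "\<And>e. 0 < e \<Longrightarrow> e < d \<Longrightarrow> F a q y - y < F a q (y - e) - (y - e)"
      using DERIV_neg_dec_left by blast
    have near: "i \<le> q \<Longrightarrow> \<forall>\<^sub>F w in at_left y. F a i w = G a i w" for i
    proof (induction i)
      case (Suc i)
      have "isCont (G a i) y"
        using g.it_cont[of UNIV a i] by (simp add: continuous_on_eq_continuous_at)
      then have "\<forall>\<^sub>F w in at_left y. K + of_int (N i) - 1 < G a i w"
        using N(1)[of i] by (metis order_tendstoD(1) continuous_within filterlim_at_split)
      moreover have "\<forall>\<^sub>F w in at_left y. w < y" by (auto simp: eventually_at_filter)
      moreover have "\<forall>\<^sub>F w in at_left y. F a i w = G a i w" using Suc by simp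
      ultimately show ?case
      proof eventually_elim
        case (elim w)
        have "G a i w \<le> k + of_int (N i)" using g.it_mono[of w y a i] elim N(2)[of i] by simp
        then have "g (G a i w) = f (G a i w)" using gf_shift_eq[of "N i"] elim by simp
        then show ?case using elim by (simp add: iter_Suc)
      qed
    qed (simp)
    have "\<forall>\<^sub>F w in at_left y. F a q w = G a q w \<and> y - d < w \<and> w < y"
      using near[of q] eventually_at_left_real[of "y - d" y] d(1)
      by (auto elim: eventually_elim2)
    then obtain w where w: "F a q w = G a q w" "y - d < w" "w < y"
      using eventually_happens[of _ "at_left y"] trivial_limit_at_left_real by blast
    have "F a q y - y < F a q w - w" using d(2)[of "y - w"] w by simp
    moreover have "F a q y = y + of_int p" using GF[of y q] yk y by simp
    ultimately show False using le[of w] w by simp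
  qed
  obtain A B where AB: "\<And>x. (\<forall>i<q. f1 (F a i x) \<noteq> 0) \<Longrightarrow>
     (iter_d f f1 a q has_real_derivative A x * iter_d f f1 a q x) (at x) \<and>
     (A has_real_derivative B x) (at x) \<and> B x < (A x)\<^sup>2 / 2"
    using iter_nonlinearity[OF df df1 df2 schw q0, of a] by blast
  have key: "w + of_int p < F a q w" if w: "y < w" "w < x" for w
  proof (rule above_diagonal[where u = y and v = x and A = A and B = B])
    fix t assume t: "y \<le> t" "t < x"
    then have nz: "\<forall>i<q. f1 (F a i t) \<noteq> 0" using f1F by (metis less_irrefl)
    show "(F a q has_real_derivative iter_d f f1 a q t) (at t)" by (rule DERIV_iter) (rule df)
    show "(iter_d f f1 a q has_real_derivative A t * iter_d f f1 a q t) (at t)"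
      "(A has_real_derivative B t) (at t)" "B t < (A t)\<^sup>2 / 2" using AB[OF nz] by auto
    show "0 < iter_d f f1 a q t"
      unfolding iter_d_def by (intro prod_pos) (use f1F t in auto)
  next
    show "F a q y = y + of_int p" using GF[of y q] yk y by simp
    show "x + of_int p < F a q x" using Fx x0K xC by simp
  qed (use slope w F_cont in auto)
  show yk': "y = k"
  proof (rule ccontr)
    assume "y \<noteq> k"
    then have "k + of_int p < F a q k" using key[of k] yk kx by simp
    then show False using GF[of k q] yk le[of k] by simp
  qed
  fix w assume w: "k < w" "w < x0"
  show "w + of_int p < H a q w"
  proof (cases "w < x")
    case True
    then show ?thesis using key[of w] FH_le[of a q w] w yk' by simp
  next
    \<comment> \<open>Beyond \<open>x\<close> monotonicity of \<open>H\<close> carries the value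
      reached at \<open>x\<close> as far as \<open>x0\<close>.\<close>
    case False
    have "x0 + of_int p \<le> F a q x" by (rule Fx)
    also have "\<dots> \<le> H a q x" by (rule FH_le)
    also have "\<dots> \<le> H a q w" by (rule h.it_mono) (use False in simp)
    finally show ?thesis using w by simp
  qed
qed

end

section \<open>Reflection symmetry and orbits shared with the bounds\<close>

context bimodal begin

text \<open>On the increasing branch that contains \<open>y\<close> the bound is \<open>f\<close>,
  and \<open>x\<close> can be raised to the lower end of that branch. Only the right-hand point has
  to avoid the plateau, which is what \<open>R_avoid\<close> will supply.\<close>

lemma g_strict:
  assumes "x < y" "\<And>m. \<not> (k + of_int m < y \<and> y \<le> K + of_int m)"
  shows "g x < g y"
proof -
  define m where "m = \<lceil>y - K\<rceil>"
  have m: "K + of_int m - 1 < y" "y \<le> K + of_int m" unfolding m_def by linarith+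
  then have yk: "y \<le> k + of_int m" using assms(2)[of m] by simp
  define x' where "x' = max x (K + of_int m - 1)"
  have x': "x' < y" "K + of_int m - 1 \<le> x'" using m assms(1) by (auto simp: x'_def)
  have "g x \<le> g x'" by (rule monoD[OF g.g_mono]) (simp add: x'_def)
  also have "\<dots> = f x'" by (rule gf_shift_eq[of m]) (use x' yk in auto)
  also have "\<dots> < f y"
    using f_inc[of "x' - of_int m" "y - of_int m"] x' yk ord
      f_shift[of "x' - of_int m" m] f_shift[of "y - of_int m" m] by simp
  also have "\<dots> = g y" by (rule gf_shift_eq[OF _ yk, symmetric]) (use m in auto)
  finally show ?thesis .
qed

text \<open>The bounds trade places and the second derivative changes sign, which leaves the
  Schwarzian derivative negative. Reflected branches are moved by one period into the normal
  form.\<close>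

lemma bimodal_reflected: "bimodal (refl_map f) (refl_map h) (refl_map g)
  (\<lambda>x. f1 (- x)) (\<lambda>x. - f2 (- x)) (\<lambda>x. f3 (- x)) (- c) (- K) (- C) (- k)"
proof -
  interpret rh: mono_lift "refl_map h" by (rule mono_lift_refl_map) (rule lift_h)
  interpret rg: mono_lift "refl_map g" by (rule mono_lift_refl_map) (rule lift_g)
  show ?thesis
  proof
    show "refl_map f (x + 1) = refl_map f x + 1" for x
      using f_per[of "- x - 1"] by (simp add: refl_map_def)
    show "- c < - K" "- K < - C" "- C < - k" "- C - 1 < - c" "- k < - K + 1" "- k \<le> - c + 1"
      using ord by auto
    show "refl_map f x < refl_map f y" if "- C - 1 \<le> x" "x < y" "y \<le> - K" for x y
      using f_inc[of "- y - 1" "- x - 1"] f_per[of "- y - 1"] f_per[of "- x - 1"] that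
      by (simp add: refl_map_def)
    show "refl_map h x \<le> refl_map f x" "refl_map f x \<le> refl_map g x" for x
      using g_le h_ge by (simp_all add: refl_map_def)
    show "refl_map h x = refl_map f x" if "- C - 1 \<le> x" "x \<le> - c" for x
      using hf_shift_eq[of 1 "- x"] that by (simp add: refl_map_def)
    show "refl_map h x = refl_map h (- c)" if "- c \<le> x" "x \<le> - C" for x
      using h_flat[of "- x"] that by (simp add: refl_map_def)
    show "refl_map g x = refl_map f x" if "- k - 1 \<le> x" "x \<le> - K" for x
      using gf_shift_eq[of 1 "- x"] that by (simp add: refl_map_def)
    show "refl_map g x = refl_map g (- k)" if "- K \<le> x" "x \<le> - k" for x
      using g_flat[of "- x"] that by (simp add: refl_map_def)
    show "(refl_map f has_real_derivative f1 (- x)) (at x)" for x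
      unfolding refl_map_def
      by (auto intro!: derivative_eq_intros DERIV_chain2[OF df])
    show "((\<lambda>x. f1 (- x)) has_real_derivative - f2 (- x)) (at x)" for x
      by (rule DERIV_cong[OF DERIV_chain2[OF df1 DERIV_minus[OF DERIV_ident]]]) simp
    show "((\<lambda>x. - f2 (- x)) has_real_derivative f3 (- x)) (at x)" for x
      by (rule DERIV_cong[OF DERIV_minus[OF DERIV_chain2[OF df2 DERIV_minus[OF DERIV_ident]]]]) simp
    show "0 < f1 (- x)" if "- C - 1 < x" "x < - K" for x
      using f1_pos[of "- x - 1"] f1_shift[of "- x - 1" 1] that by simp
    show "f3 (- x) / f1 (- x) - 3 / 2 * (- f2 (- x) / f1 (- x))\<^sup>2 < 0" if "f1 (- x) \<noteq> 0" for x
      using schw[OF that] by simp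
  qed
qed

lemma F_eq_G:
  assumes "\<And>i m. i < n \<Longrightarrow> \<not> (k + of_int m < F a i x \<and> F a i x < K + of_int m)"
  shows "G a n x = F a n x"
  using assms
proof (induction n)
  case (Suc n)
  define m where "m = \<lceil>F a n x - K\<rceil>"
  have m: "K + of_int m - 1 < F a n x" "F a n x \<le> K + of_int m" unfolding m_def by linarith+
  have "g (F a n x) = f (F a n x)"
  proof (cases "F a n x = K + of_int m")
    \<comment> \<open>The right end of a plateau is the left end of the next increasing branch,
      hence the index \<open>m + 1\<close>.\<close>
    case True
    then show ?thesis using gf_shift_eq[of "m + 1" "F a n x"] ord by simp
  next
    case False
    then show ?thesis using gf_shift_eq[of m "F a n x"] m Suc.prems[of n m] by force
  qed
  then show ?case using Suc by (simp add: iter_Suc)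
qed simp

text \<open>A value taken inside a plateau is also taken at its left end, so preimages can be chosen
  off the open plateaus.\<close>

lemma g_surj_off_plateau: "\<exists>y. g y + a = z \<and> (\<forall>m. \<not> (k + of_int m < y \<and> y < K + of_int m))"
proof -
  define N where "N = \<lceil>\<bar>z - a - g 0\<bar>\<rceil>"
  have N: "\<bar>z - a - g 0\<bar> \<le> of_int N" unfolding N_def by simp
  have "\<exists>y\<ge>- of_int N. y \<le> of_int N \<and> g y = z - a"
    by (rule IVT')
      (use N g.g_shift[of 0 N] g.g_shift[of 0 "- N"] continuous_on_subset[OF g.g_cont] in auto)
  then obtain y where y: "g y = z - a" by blast
  show ?thesis
  proof (cases "\<exists>m. k + of_int m < y \<and> y < K + of_int m")
    case True
    then obtain m where m: "k + of_int m < y" "y < K + of_int m" by blast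
    have "g (k + of_int m) = g y"
      using g_flat[of "y - of_int m"] g.g_shift[of "y - of_int m" m] g.g_shift[of k m] m by simp
    moreover have "\<not> (k + of_int n < k + of_int m \<and> k + of_int m < K + of_int n)" for n
    proof
      assume "k + of_int n < k + of_int m \<and> k + of_int m < K + of_int n"
      then have "n < m" "of_int m < (of_int n + 1 :: real)" using ord by auto
      then show False by linarith
    qed
    ultimately show ?thesis using y by (intro exI[of _ "k + of_int m"]) auto
  next
    case False
    then show ?thesis using y by (intro exI[of _ y]) auto
  qed
qed

text \<open>Every point has backward \<open>G\<close>-orbits off the open plateaus, so the points whose first \<open>n\<close>
  iterates avoid the plateaus form a nested sequence of nonempty compact sets modulo one.\<close>

lemma common_orbit: "\<exists>x. \<forall>n. F a n x = G a n x"
proof -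
  define U where "U = (\<Union>m::int. {k + of_int m<..<K + of_int m})"
  define E where "E = (\<lambda>n. {0..1} \<inter> {x. \<forall>i\<in>{..<n}. G a i x \<in> - U})"
  have backward: "\<exists>x. G a n x = z \<and> (\<forall>i<n. G a i x \<notin> U)" for n z
  proof (induction n arbitrary: z)
    case (Suc n)
    obtain y where y: "g y + a = z" "y \<notin> U" using g_surj_off_plateau[of a z] by (auto simp: U_def)
    obtain x where x: "G a n x = y" "\<forall>i<n. G a i x \<notin> U" using Suc by blast
    then show ?case using y by (intro exI[of _ x]) (auto simp: iter_Suc less_Suc_eq)
  qed simp
  have "open U" unfolding U_def by (intro open_UN) auto
  then have "closed (- U)" by (simp add: closed_def)
  have cl: "closed {x. G a i x \<in> - U}" for i
    using continuous_closed_vimage[OF \<open>closed (- U)\<close>, of "G a i"] g.it_cont[of UNIV a i]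
    by (simp add: vimage_def continuous_on_eq_continuous_at)
  have "compact (E n)" for n
  proof -
    have "closed (\<Inter>i\<in>{..<n}. {x. G a i x \<in> - U})" using cl by blast
    moreover have "E n = {0..1} \<inter> (\<Inter>i\<in>{..<n}. {x. G a i x \<in> - U})" by (auto simp: E_def)
    ultimately show ?thesis by (simp add: compact_Int_closed)
  qed
  moreover have "E n \<noteq> {}" for n
  proof -
    obtain x where x: "\<forall>i<n. G a i x \<notin> U" using backward by blast
    have "G a i (x - of_int \<lfloor>x\<rfloor>) \<notin> U" if i: "i < n" for i
    proof
      assume "G a i (x - of_int \<lfloor>x\<rfloor>) \<in> U"
      then obtain m where "k + of_int m < G a i x - of_int \<lfloor>x\<rfloor>" "G a i x - of_int \<lfloor>x\<rfloor> < K + of_int m"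
        by (auto simp: g.it_shift' U_def)
      then have "G a i x \<in> {k + of_int (m + \<lfloor>x\<rfloor>)<..<K + of_int (m + \<lfloor>x\<rfloor>)}" by simp
      then have "G a i x \<in> U" unfolding U_def by blast
      then show False using x i by blast
    qed
    moreover have "x - of_int \<lfloor>x\<rfloor> \<in> {0..1}" by (auto; linarith)
    ultimately show ?thesis unfolding E_def by blast
  qed
  moreover have "m \<le> n \<Longrightarrow> E n \<subseteq> E m" for m n by (auto simp: E_def)
  ultimately have "\<Inter> (range E) \<noteq> {}" using compact_nest[of E] by blast
  then obtain x where x: "\<And>n. x \<in> E n" by blast
  have off: "G a i x \<notin> U" for i using x[of "Suc i"] by (auto simp: E_def)
  have "F a n x = G a n x" for n
  proof (induction n)
    case (Suc n)
    have "g (F a n x) = f (F a n x)"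
      using F_eq_G[of 1 0 "F a n x"] off[of n] Suc by (force simp: iter_Suc U_def)
    then show ?case using Suc by (simp add: iter_Suc)
  qed simp
  then show ?thesis by blast
qed

end

section \<open>Periodic points of the lower bound at tangency\<close>

context bimodal_farey begin

text \<open>\<open>branch\<close> is applied to the largest periodic point \<open>y\<close> up to
  \<open>k\<close>. Maximality yields \<open>star\<close>: if the orbit of \<open>k\<close> reached
  k + m while that of \<open>y\<close> did not pass it, m/j would be both at most and at least p/q,
  and equality is barred by \<open>not_multiple\<close>.\<close>

lemma fix_in_kc:
  assumes le: "\<And>x. G a q x \<le> x + of_int p"
    and x0: "G a q x0 = x0 + of_int p" "k < x0" "x0 \<le> c"
  shows "G a q k = k + of_int p" "\<And>w. k < w \<Longrightarrow> w < x0 \<Longrightarrow> w + of_int p < H a q w"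
proof -
  obtain y where y: "G a q y = y + of_int p" "k - 1 < y" "y \<le> k"
    and ymax: "\<And>w. G a q w = w + of_int p \<Longrightarrow> w \<le> k \<Longrightarrow> w \<le> y"
    by (rule g.fix_largest_le[OF x0(1), of k]) blast
  have star: "G a j k < k + of_int m" if j: "0 < j" "j < q" "G a j y \<le> k + of_int m" for j m
  proof (rule ccontr)
    assume "\<not> ?thesis"
    then have "k + of_int m \<le> G a j k" by simp
    then have "m * int q \<le> p * int j" using g.rot_compare[of k m a j q y p] y by simp
    moreover have "G a q (G a j y - of_int m) = G a j y - of_int m + of_int p"
      using g.fix_iter[OF y(1), of j "- m"] by simp
    then have "G a j y - of_int m \<le> y" by (rule ymax) (use j in simp)
    then have "p * int j \<le> m * int q" using g.rot_compare[of y p a q j y m] y by simp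
    ultimately show False using not_multiple[OF j(1,2), of m] by simp
  qed
  note b = branch[OF le y star x0]
  show "G a q k = k + of_int p" using y(1) b(1) by simp
  show "\<And>w. k < w \<Longrightarrow> w < x0 \<Longrightarrow> w + of_int p < H a q w" by (rule b(2))
qed

text \<open>Since p1/q1 is less than p/q, \<open>q1\<close> steps carry a periodic point beyond its
  translate by \<open>p1\<close>.\<close>

lemma G_next_fix:
  assumes y: "G a q y = y + of_int p"
  shows "G a q (G a q1 y - of_int p1) = G a q1 y - of_int p1 + of_int p"
    "y < G a q1 y - of_int p1"
proof -
  show "G a q (G a q1 y - of_int p1) = G a q1 y - of_int p1 + of_int p"
    using g.fix_iter[OF y, of q1 "- p1"] by simp
  show "y < G a q1 y - of_int p1"
  proof (rule ccontr)
    assume "\<not> ?thesis"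
    then have "p * int q1 \<le> p1 * int q"
      using g.rot_compare[of y p a q q1 y p1] y by simp
    then show False using det1 by simp
  qed
qed

lemma G_fix_pow:
  assumes "G a q y = y + of_int p"
  shows "G a (j * q + n) y = G a n y + of_int (int j * p)"
proof -
  have "G a (j * q) y = y + of_int (int j * p)"
    using g.it_pow_ge[of y p a q j] g.it_pow_le[of a q y p j] assms by simp
  then have "G a (n + j * q) y = G a n y + of_int (int j * p)"
    unfolding iter_add by (simp only: g.it_shift)
  then show ?thesis by (simp add: add.commute)
qed

end

section \<open>Position of the loci relative to the tangency parameters\<close>

locale loci = bimodal_farey f g h f1 f2 f3 k C K c p p1 p2 q q1 q2
  for f g h f1 f2 f3 :: "real \<Rightarrow> real" and k C K c :: real and p p1 p2 :: int and q q1 q2 :: nat +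
  fixes \<psi>1 \<psi>2 :: real and R L :: "nat \<Rightarrow> real"
  assumes touch_\<psi>1: "touch_above g q p \<psi>1" and touch_\<psi>2: "touch_below h q p \<psi>2"
    and R_eq: "iter g (R j) (j * q + q1) k = c + of_int (int j * p + p1)"
    and R_avoid: "0 < i \<Longrightarrow> i \<le> j * q + q1 \<Longrightarrow>
      \<not> (k + of_int m < iter g (R j) i k \<and> iter g (R j) i k \<le> K + of_int m)"
    and L_eq: "iter h (L j) (j * q + q2) c = k + of_int (int j * p + p2)"
    and L_avoid: "0 < i \<Longrightarrow> i \<le> j * q + q2 \<Longrightarrow>
      \<not> (C + of_int m \<le> iter h (L j) i c \<and> iter h (L j) i c < c + of_int m)"
begin

text \<open>If \<open>k\<close> is periodic at \<open>\<psi>1\<close>, this is a point of its orbit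
  modulo one, and its position relative to \<open>c\<close> decides on which side of
  \<open>\<psi>1\<close> all \<open>R j\<close> lie.\<close>

definition "c' = G \<psi>1 q1 k - of_int p1"

lemma G_le: "G \<psi>1 q x \<le> x + of_int p"
  using touch_\<psi>1 by (simp add: touch_above_def)

lemma H_ge: "x + of_int p \<le> H \<psi>2 q x"
  using touch_\<psi>2 by (simp add: touch_below_def)

lemma R_less_iff: "R j < a \<longleftrightarrow> c + of_int (int j * p + p1) < G a (j * q + q1) k"
  using g.it_less_param_iff[of "j * q + q1" "R j" k a] R_eq[of j] q_pos by simp

lemma less_R_iff: "a < R j \<longleftrightarrow> G a (j * q + q1) k < c + of_int (int j * p + p1)"
  using g.it_less_param_iff[of "j * q + q1" a k "R j"] R_eq[of j] q_pos by simp

text \<open>If \<open>k\<close> is periodic, every \<open>R j\<close> is governed by the same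
  comparison of \<open>c'\<close> with \<open>c\<close>. Otherwise \<open>fix_in_kc\<close> leaves
  no periodic point in (k, c], so \<open>q1\<close> steps carry the largest periodic point below
  \<open>k\<close> past \<open>c\<close>, and the orbit of \<open>k\<close> dominates its
  orbit.\<close>

lemma R_cases:
  "(\<forall>j. R j < \<psi>1) \<or>
   (G \<psi>1 q k = k + of_int p \<and> c' \<le> c \<and> (c' = c \<longrightarrow> (\<forall>j. R j = \<psi>1)) \<and> (c' < c \<longrightarrow> (\<forall>j. \<psi>1 < R j)))"
proof (cases "G \<psi>1 q k = k + of_int p")
  case True
  have "G \<psi>1 (j * q + q1) k = c' + of_int (int j * p + p1)" for j
    using G_fix_pow[OF True, of j q1] by (simp add: c'_def)
  then have 1: "R j < \<psi>1 \<longleftrightarrow> c < c'" and 2: "\<psi>1 < R j \<longleftrightarrow> c' < c" for j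
    by (simp_all add: R_less_iff less_R_iff)
  show ?thesis
  proof (cases "c < c'")
    case False
    then have "R j = \<psi>1" if "c' = c" for j using 1[of j] 2[of j] that by simp
    then show ?thesis using False 2 True by auto
  qed (use 1 in auto)
next
  case False
  obtain y0 where y0: "G \<psi>1 q y0 = y0 + of_int p"
    using touch_\<psi>1 by (auto simp: touch_above_def)
  obtain y where y: "G \<psi>1 q y = y + of_int p" "k - 1 < y" "y \<le> k"
    and ymax: "\<And>w. G \<psi>1 q w = w + of_int p \<Longrightarrow> w \<le> k \<Longrightarrow> w \<le> y"
    by (rule g.fix_largest_le[OF y0, of k]) blast
  define v where "v = G \<psi>1 q1 y - of_int p1"
  have v: "G \<psi>1 q v = v + of_int p" "y < v" unfolding v_def by (rule G_next_fix[OF y(1)])+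
  have "k < v" using ymax[OF v(1)] v(2) by force
  then have "c < v" using fix_in_kc(1)[OF G_le v(1)] False by force
  have "R j < \<psi>1" for j
  proof -
    have "c + of_int (int j * p + p1) < v + of_int (int j * p + p1)" using \<open>c < v\<close> by simp
    also have "\<dots> = G \<psi>1 (j * q + q1) y" using G_fix_pow[OF y(1), of j q1] by (simp add: v_def)
    also have "\<dots> \<le> G \<psi>1 (j * q + q1) k" by (rule g.it_mono) (rule y)
    finally show ?thesis by (simp only: R_less_iff)
  qed
  then show ?thesis by blast
qed

text \<open>Below \<open>\<psi>1\<close> the graph of G^q lies strictly under the line, so an orbit
  that meets \<open>c\<close> at stage \<open>j\<close> falls short of it \<open>q\<close> steps
  later.\<close>

lemma R_increasing:
  assumes "\<And>j. R j < \<psi>1"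
  shows "R j < R (Suc j)"
proof -
  have "G (R j) (Suc j * q + q1) k = G (R j) q (G (R j) (j * q + q1) k)"
    by (simp add: add.assoc flip: iter_add)
  also have "\<dots> = G (R j) q c + of_int (int j * p + p1)" unfolding R_eq by (rule g.it_shift)
  also have "\<dots> < c + of_int p + of_int (int j * p + p1)"
    using g.touch_above_less[OF touch_\<psi>1 assms q0] by simp
  also have "\<dots> = c + of_int (int (Suc j) * p + p1)" by (simp add: algebra_simps)
  finally show ?thesis by (simp only: less_R_iff)
qed

text \<open>Above \<open>\<psi>1\<close> the point \<open>v\<close> lies to the right of
  \<open>k\<close>, and \<open>g_strict\<close> keeps the two orbits strictly ordered. That of
  \<open>v\<close> is the orbit of \<open>k\<close> advanced by \<open>q\<close>, hence it meets
  \<open>c\<close> when that of \<open>k\<close> is still short of it.\<close>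

lemma R_decreasing:
  assumes "\<psi>1 < R (Suc j)" "G \<psi>1 q k = k + of_int p"
  shows "R (Suc j) < R j"
proof -
  let ?a = "R (Suc j)" and ?n = "j * q + q1"
  define v where "v = G ?a q k - of_int p"
  have "k + of_int p < G ?a q k" using g.it_strict_param[OF q0 assms(1), of k] assms(2) by simp
  then have kv: "k < v" by (simp add: v_def)
  have "i \<le> ?n \<Longrightarrow> G ?a i k < G ?a i v" for i
  proof (induction i)
    case (Suc i)
    have e: "G ?a i v = G ?a (q + i) k - of_int p"
      unfolding v_def by (simp only: g.it_shift' iter_add add.commute[of q i])
    have "g (G ?a i k) < g (G ?a i v)"
    proof (rule g_strict)
      show "G ?a i k < G ?a i v" using Suc by simp
      show "\<not> (k + of_int m < G ?a i v \<and> G ?a i v \<le> K + of_int m)" for m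
      proof
        assume "k + of_int m < G ?a i v \<and> G ?a i v \<le> K + of_int m"
        then have "k + of_int (m + p) < G ?a (q + i) k \<and> G ?a (q + i) k \<le> K + of_int (m + p)"
          by (simp add: e)
        then show False using R_avoid[of "q + i" "Suc j" "m + p"] Suc.prems q0 by simp
      qed
    qed
    then show ?case by (simp add: iter_Suc)
  qed (use kv in simp)
  then have "G ?a ?n k < G ?a ?n v" by simp
  also have "\<dots> = G ?a (Suc j * q + q1) k - of_int p"
    unfolding v_def by (simp only: g.it_shift' flip: iter_add) (simp add: ac_simps)
  also have "\<dots> = c + of_int (int j * p + p1)" unfolding R_eq by (simp add: algebra_simps)
  finally show ?thesis by (simp only: less_R_iff)
qed

text \<open>Otherwise \<open>orbit_c_eq\<close> makes G and H agree along the orbit of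
  \<open>c\<close> at \<open>\<psi>2\<close>; then G^q reaches the line there, which requires
  \<open>\<psi>1 \<le> \<psi>2\<close>.\<close>

lemma L0_less:
  assumes "\<psi>2 < \<psi>1"
  shows "L 0 < \<psi>2"
proof (rule ccontr)
  assume "\<not> ?thesis"
  then have "H \<psi>2 q2 c \<le> H (L 0) q2 c" by (intro h.it_mono_param) simp
  also have "\<dots> = k + of_int p2" using L_eq[of 0] by simp
  finally have "G \<psi>2 q c = H \<psi>2 q c" by (rule orbit_c_eq[OF _ H_ge order_refl])
  then have "c + of_int p \<le> G \<psi>2 q c" using H_ge by simp
  then have "\<psi>1 \<le> \<psi>2" by (rule g.touch_above_ge[OF touch_\<psi>1 _ q0])
  then show False using assms by simp
qed

text \<open>By \<open>fix_in_kc\<close> H has no periodic point in (k, c'). The first one from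
  \<open>c'\<close> on is carried by \<open>q2\<close> steps to its left, hence to \<open>k\<close>
  or below, yet comparison with G puts it at \<open>k\<close> or above. This forces equal
  parameters, and then \<open>c\<close> returns to itself through \<open>k\<close> and
  \<open>c'\<close>.\<close>

lemma \<psi>2_le:
  assumes kfix: "G \<psi>1 q k = k + of_int p" and "c' \<le> c" and "\<psi>1 \<le> \<psi>2"
  shows "\<psi>1 = \<psi>2" "c' = c"
proof -
  have c'fix: "G \<psi>1 q c' = c' + of_int p" "k < c'" unfolding c'_def by (rule G_next_fix[OF kfix])+
  note Hgt = fix_in_kc(2)[OF G_le c'fix \<open>c' \<le> c\<close>]
  have "\<not> c' \<le> K" using fix_not_flat[OF G_le c'fix(1), of 0] c'fix(2) by simp
  have Gc': "G \<psi>1 q2 c' = k + of_int p2"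
  proof -
    have "G \<psi>1 q2 c' = G \<psi>1 q k - of_int p1"
      unfolding c'_def sums by (simp only: g.it_shift' flip: iter_add) (simp add: add.commute)
    then show ?thesis using kfix by (simp add: sums)
  qed
  obtain u0 where u0: "H \<psi>2 q u0 = u0 + of_int p"
    using touch_\<psi>2 by (auto simp: touch_below_def)
  obtain u where u: "H \<psi>2 q u = u + of_int p" "c' \<le> u"
    and umin: "\<And>w. H \<psi>2 q w = w + of_int p \<Longrightarrow> c' \<le> w \<Longrightarrow> u \<le> w"
    by (rule h.fix_smallest_ge[OF u0, of c']) blast
  define t where "t = H \<psi>2 q2 u - of_int p2"
  have t: "H \<psi>2 q t = t + of_int p"
    using h.fix_iter[OF u(1), of q2 "- p2"] by (simp add: t_def)
  have "t < u"
  proof (rule ccontr)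
    assume "\<not> ?thesis"
    then have "p2 * int q \<le> p * int q2"
      using h.rot_compare[of u p2 \<psi>2 q2 q u p] u by (simp add: t_def)
    then show False using det2 by simp
  qed
  then have "t < c'" using umin[OF t] by force
  have "\<not> k < t"
  proof
    assume "k < t"
    then have "t + of_int p < H \<psi>1 q t" using Hgt \<open>t < c'\<close> by simp
    also have "\<dots> \<le> H \<psi>2 q t" by (rule h.it_mono_param) fact
    finally show False using t by simp
  qed
  have le1: "G \<psi>2 q2 c' \<le> H \<psi>2 q2 u"
    by (rule order_trans[OF GH_le h.it_mono[OF u(2)]]) simp
  show eq: "\<psi>1 = \<psi>2"
  proof (rule ccontr)
    assume "\<psi>1 \<noteq> \<psi>2"
    then have "G \<psi>1 q2 c' < G \<psi>2 q2 c'" using assms q_pos by (intro g.it_strict_param) auto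
    then show False using le1 Gc' \<open>\<not> k < t\<close> by (simp add: t_def)
  qed
  have Hu: "H \<psi>2 q2 u = k + of_int p2" using le1 Gc' eq \<open>\<not> k < t\<close> by (simp add: t_def)
  \<comment> \<open>As \<open>c' > K\<close>, a point \<open>u\<close> below \<open>c\<close> would
    lie on the plateau of \<open>H\<close> and share the value at \<open>c\<close>, which is at
    least c + p.\<close>
  have "c \<le> u"
  proof (rule ccontr)
    assume "\<not> ?thesis"
    then have "H \<psi>2 q u = H \<psi>2 q c"
      using \<open>\<not> c' \<le> K\<close> u(2) ord by (intro H_flat q0) auto
    then show False using u(1) H_ge[of c] \<open>\<not> c \<le> u\<close> by simp
  qed
  then have H2: "H \<psi>2 q2 c \<le> k + of_int p2" using h.it_mono[of c u] Hu by metis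
  have "G \<psi>2 q c = H \<psi>2 q c" by (rule orbit_c_eq[OF H2 H_ge]) simp
  then have Gc: "G \<psi>2 q c = c + of_int p" using H_ge[of c] G_le[of c] eq by simp
  have "G \<psi>2 q2 c = H \<psi>2 q2 c" by (rule orbit_c_eq[OF H2 H_ge]) (simp add: sums)
  moreover have "G \<psi>2 q2 c' \<le> G \<psi>2 q2 c" by (rule g.it_mono) fact
  ultimately have "G \<psi>2 q2 c = k + of_int p2" using H2 Gc' eq by simp
  moreover have "G \<psi>2 q c = G \<psi>2 q1 (G \<psi>2 q2 c)" by (simp add: sums flip: iter_add)
  ultimately have "G \<psi>2 q c = c' + of_int p" using eq by (simp add: g.it_shift c'_def[unfolded eq] sums)
  then show "c' = c" using Gc by simp
qed

text \<open>Otherwise \<open>c\<close>, \<open>k\<close> and \<open>k'\<close> are all periodic at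
  the common parameter. \<open>branch\<close> started at \<open>k'\<close> forces
  \<open>k' = k\<close>, so \<open>q1\<close> steps lead from \<open>k\<close> exactly to
  \<open>c\<close>, against \<open>R 0 < \<psi>1\<close>.\<close>

lemma L0_less_of_R0_less:
  assumes eq: "\<psi>1 = \<psi>2" and R0: "R 0 < \<psi>1"
  shows "L 0 < \<psi>1"
proof (rule ccontr)
  assume "\<not> ?thesis"
  then have "H \<psi>1 q2 c \<le> H (L 0) q2 c" by (intro h.it_mono_param) simp
  also have "\<dots> = k + of_int p2" using L_eq[of 0] by simp
  finally have H2: "H \<psi>1 q2 c \<le> k + of_int p2" .
  note H_ge = H_ge[folded eq]
  note GHc = orbit_c_eq[OF H2 H_ge]
  have cfix: "G \<psi>1 q c = c + of_int p" using GHc[of q] H_ge[of c] G_le[of c] by simp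
  have kfix: "G \<psi>1 q k = k + of_int p" by (rule fix_in_kc(1)[OF G_le cfix]) (use ord in auto)
  define k' where "k' = G \<psi>1 q2 c - of_int p2"
  have k'le: "k' \<le> k" using H2 GHc[of q2] by (simp add: k'_def sums)
  have k'fix: "G \<psi>1 q k' = k' + of_int p"
    using g.fix_iter[OF cfix, of q2 "- p2"] by (simp add: k'_def)
  have "k' \<noteq> k"
  proof
    assume "k' = k"
    then have "G \<psi>1 q2 c = k + of_int p2" by (simp add: k'_def)
    moreover have "G \<psi>1 q c = G \<psi>1 q1 (G \<psi>1 q2 c)" by (simp add: sums flip: iter_add)
    ultimately have "G \<psi>1 q1 k = c + of_int p1" using cfix by (simp add: g.it_shift sums)
    then show False using R0 R_less_iff[of 0 \<psi>1] by simp
  qed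
  moreover have "k' = k"
  proof (rule branch(1)[OF G_le k'fix _ k'le _ cfix])
    show "k - 1 < k'"
    proof (rule ccontr)
      assume "\<not> ?thesis"
      moreover have "G \<psi>1 q2 k \<le> G \<psi>1 q2 c" by (rule g.it_mono) (use ord in simp)
      ultimately have "G \<psi>1 q2 k \<le> k + of_int (p2 - 1)" by (simp add: k'_def)
      then have "p * int q2 \<le> (p2 - 1) * int q"
        using g.rot_compare[of k p \<psi>1 q q2 k "p2 - 1"] kfix by simp
      then have "p * int q2 + int q \<le> p2 * int q" by (simp add: algebra_simps)
      moreover have "2 \<le> int q" using q_pos sums by simp
      ultimately show False using det2 by linarith
    qed
    \<comment> \<open>The orbit of \<open>k'\<close> is that of \<open>c\<close> advanced by
      \<open>q2\<close>. A violation of \<open>star\<close> gives two strict integer inequalities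
      that together make p2 q - p q2 at least two, against \<open>det2\<close>.\<close>
    fix j m assume j: "0 < j" "j < q" and le: "G \<psi>1 j k' \<le> k + of_int m"
    show "G \<psi>1 j k < k + of_int m"
    proof (rule ccontr)
      assume "\<not> ?thesis"
      then have "m * int q \<le> p * int j" using g.rot_compare[of k m \<psi>1 j q k p] kfix by simp
      then have 1: "m * int q < p * int j" using not_multiple[OF j, of m] by simp
      have "G \<psi>1 (j + q2) c = G \<psi>1 j k' + of_int p2"
        unfolding iter_add k'_def by (simp only: g.it_shift')
      then have "G \<psi>1 (j + q2) c < c + of_int (m + p2)" using le ord by simp
      then have "p * int (j + q2) < (m + p2) * int q" by (rule g.fix_strict[OF cfix _ q0])
      then have "p * int j + p * int q2 < m * int q + p2 * int q" by (simp add: algebra_simps)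
      then show False using 1 det2 by linarith
    qed
  qed (use ord in auto)
  ultimately show False by simp
qed

text \<open>Negation reverses the order of the Farey parents, so left and right parents trade roles
  together with \<open>R\<close> and \<open>L\<close>.\<close>

lemma reflected: "loci (refl_map f) (refl_map h) (refl_map g) (\<lambda>x. f1 (- x)) (\<lambda>x. - f2 (- x)) (\<lambda>x. f3 (- x))
    (- c) (- K) (- C) (- k) (- p) (- p2) (- p1) q q2 q1 (- \<psi>2) (- \<psi>1) (\<lambda>j. - L j) (\<lambda>j. - R j)"
proof -
  interpret rb: bimodal "refl_map f" "refl_map h" "refl_map g" "\<lambda>x. f1 (- x)" "\<lambda>x. - f2 (- x)"
    "\<lambda>x. f3 (- x)" "- c" "- K" "- C" "- k"
    by (rule bimodal_reflected)
  show ?thesis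
  proof
    show "0 < q2" "0 < q1" "- p = - p2 + - p1" "q = q2 + q1" "- p1 * int q2 - - p2 * int q1 = 1"
      using q_pos sums det by auto
    show "touch_above (refl_map h) q (- p) (- \<psi>2)" "touch_below (refl_map g) q (- p) (- \<psi>1)"
      using touch_\<psi>1 touch_\<psi>2 by (simp_all add: touch_refl_map touch_refl_map')
    show "iter (refl_map h) (- L j) (j * q + q2) (- c) = - k + of_int (int j * - p + - p2)" for j
      using L_eq[of j] by (simp add: iter_refl_map)
    show "iter (refl_map g) (- R j) (j * q + q1) (- k) = - c + of_int (int j * - p + - p1)" for j
      using R_eq[of j] by (simp add: iter_refl_map)
    show "\<not> (- c + of_int m < iter (refl_map h) (- L j) i (- c) \<and>
            iter (refl_map h) (- L j) i (- c) \<le> - C + of_int m)"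
      if "0 < i" "i \<le> j * q + q2" for i j m
      using L_avoid[OF that, of "- m"] by (auto simp: iter_refl_map)
    show "\<not> (- K + of_int m \<le> iter (refl_map g) (- R j) i (- k) \<and>
            iter (refl_map g) (- R j) i (- k) < - k + of_int m)"
      if "0 < i" "i \<le> j * q + q1" for i j m
      using R_avoid[OF that, of "- m"] by (auto simp: iter_refl_map)
  qed
qed

text \<open>\<open>R_cases\<close> and its reflection leave two alternatives on each side. If
  \<open>\<psi>1 < \<psi>2\<close>, \<open>\<psi>2_le\<close> removes the second; if
  \<open>\<psi>2 < \<psi>1\<close>, \<open>L0_less\<close> removes the first. At equality a strict
  inequality on one side would, by \<open>L0_less_of_R0_less\<close>, contradict both alternatives
  on the other.\<close>

theorem trichotomy:
  "(\<psi>1 < \<psi>2 \<and> (\<forall>j. R j < R (Suc j) \<and> R j < \<psi>1) \<and> (\<forall>j. L (Suc j) < L j \<and> \<psi>2 < L j)) \<or>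
   (\<psi>2 < \<psi>1 \<and> (\<forall>j. R (Suc j) < R j \<and> \<psi>1 < R j) \<and> (\<forall>j. L j < L (Suc j) \<and> L j < \<psi>2)) \<or>
   (\<psi>1 = \<psi>2 \<and> (\<forall>j. R j = \<psi>1) \<and> (\<forall>j. L j = \<psi>1))"
proof -
  interpret d: loci "refl_map f" "refl_map h" "refl_map g" "\<lambda>x. f1 (- x)" "\<lambda>x. - f2 (- x)"
    "\<lambda>x. f3 (- x)" "- c" "- K" "- C" "- k" "- p" "- p2" "- p1" q q2 q1 "- \<psi>2" "- \<psi>1"
    "\<lambda>j. - L j" "\<lambda>j. - R j"
    by (rule reflected)
  consider "\<psi>1 < \<psi>2" | "\<psi>2 < \<psi>1" | "\<psi>1 = \<psi>2" by linarith
  then show ?thesis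
  proof cases
    case 1
    have r: "R j < \<psi>1" for j using R_cases \<psi>2_le(1) 1 by auto
    have l: "\<psi>2 < L j" for j using d.R_cases d.\<psi>2_le(1) 1 by auto
    show ?thesis using 1 r l R_increasing[OF r] d.R_increasing l by auto
  next
    case 2
    then have "L 0 < \<psi>2" "\<psi>1 < R 0" using L0_less d.L0_less by auto
    then have "\<not> (\<forall>j. R j \<le> \<psi>1)" "\<not> (\<forall>j. - L j \<le> - \<psi>2)" by (auto simp: not_le)
    then have r: "\<psi>1 < R j" "G \<psi>1 q k = k + of_int p"
      and l: "- \<psi>2 < - L j" "d.G (- \<psi>2) q (- c) = - c + of_int (- p)" for j
      using R_cases d.R_cases by (metis less_le order_refl)+
    show ?thesis using 2 r l R_decreasing[OF r(1,2)] d.R_decreasing[OF _ l(2)] by auto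
  next
    case 3
    have R: "(\<forall>j. R j < \<psi>1) \<or> (\<forall>j. R j = \<psi>1)"
      using R_cases \<psi>2_le(2) 3 by (metis order_refl)
    have L: "(\<forall>j. - L j < - \<psi>2) \<or> (\<forall>j. - L j = - \<psi>2)"
      using d.R_cases d.\<psi>2_le(2) 3 by (metis order_refl)
    have "\<not> R 0 < \<psi>1" using L0_less_of_R0_less[OF 3] L 3 by (metis less_asym less_irrefl neg_less_iff_less)
    moreover have "\<not> - L 0 < - \<psi>2"
      using d.L0_less_of_R0_less R 3 by (metis less_asym less_irrefl neg_less_iff_less)
    ultimately have "R j = \<psi>1" "L j = \<psi>1" for j using R L 3 by auto
    then show ?thesis using 3 by blast
  qed
qed

end

section \<open>Rotation sets\<close>

context mono_lift begin

lemma it_displacement: "\<bar>iter g a n x - x - iter g a n 0\<bar> \<le> 1"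
proof -
  have "iter g a n (of_int \<lfloor>x\<rfloor>) = iter g a n 0 + of_int \<lfloor>x\<rfloor>"
    using it_shift[of a n 0 "\<lfloor>x\<rfloor>"] by simp
  moreover have "iter g a n (of_int \<lfloor>x\<rfloor> + of_int 1) = iter g a n (of_int \<lfloor>x\<rfloor>) + 1"
    by (simp only: it_shift)
  moreover have "iter g a n (of_int \<lfloor>x\<rfloor>) \<le> iter g a n x" by (rule it_mono) simp
  moreover have "iter g a n x \<le> iter g a n (of_int \<lfloor>x\<rfloor> + of_int 1)" by (rule it_mono) linarith
  ultimately show ?thesis by linarith
qed

text \<open>Displacements of 0 are additive up to an error of one, so the mean displacement over m n
  steps is within 1/n of that over n steps. Comparing n and m through m n gives a Cauchy
  sequence.\<close>

lemma rotation_number_exists: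
  "\<exists>\<rho>. \<forall>x. (\<lambda>n. (iter g a n x - x) / real n) \<longlonglongrightarrow> \<rho>"
proof -
  let ?b = "\<lambda>n. iter g a n 0"
  have mult: "\<bar>?b (m * n) - real m * ?b n\<bar> \<le> real m" for m n
  proof (induction m)
    case (Suc m)
    have "\<bar>?b (m * n + n) - ?b n - ?b (m * n)\<bar> \<le> 1"
      using it_displacement[of a "m * n" "?b n"] by (simp add: iter_add)
    then show ?case using Suc by (simp add: algebra_simps abs_if split: if_splits)
  qed simp
  have dist: "\<bar>?b m / real m - ?b n / real n\<bar> \<le> 1 / real m + 1 / real n" if "0 < m" "0 < n" for m n
  proof -
    have "\<bar>real m * ?b n - real n * ?b m\<bar> \<le> real m + real n"
      using mult[of m n] mult[of n m] by (simp add: mult.commute)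
    moreover have "?b m / real m - ?b n / real n = (real n * ?b m - real m * ?b n) / (real m * real n)"
      "1 / real m + 1 / real n = (real m + real n) / (real m * real n)"
      using that by (simp_all add: field_simps)
    ultimately show ?thesis using that by (simp add: abs_divide divide_right_mono abs_minus_commute)
  qed
  have "Cauchy (\<lambda>n. ?b n / real n)"
  proof (rule metric_CauchyI)
    fix e :: real assume "0 < e"
    obtain M where M: "2 / e < real M" using reals_Archimedean2 by blast
    then have "0 < M" using \<open>0 < e\<close> by (metis divide_pos_pos less_trans of_nat_0_less_iff zero_less_numeral)
    have "dist (?b m / real m) (?b n / real n) < e" if "M \<le> m" "M \<le> n" for m n
    proof -
      have "1 / real i < e / 2" if "M \<le> i" for i
      proof -
        have "2 / e < real i" using M that by linarith
        then show ?thesis using \<open>0 < e\<close> \<open>0 < M\<close> that by (simp add: field_simps)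
      qed
      then have "1 / real m + 1 / real n < e" using that by (smt (verit) field_sum_of_halves)
      then show ?thesis using dist[of m n] that \<open>0 < M\<close> by (simp add: dist_real_def)
    qed
    then show "\<exists>M. \<forall>m\<ge>M. \<forall>n\<ge>M. dist (?b m / real m) (?b n / real n) < e" by blast
  qed
  then obtain \<rho> where \<rho>: "(\<lambda>n. ?b n / real n) \<longlonglongrightarrow> \<rho>"
    using real_Cauchy_convergent convergent_def by blast
  have "(\<lambda>n. (iter g a n x - x) / real n) \<longlonglongrightarrow> \<rho>" for x
  proof -
    have "(\<lambda>n. (iter g a n x - x) / real n - ?b n / real n) \<longlonglongrightarrow> 0"
    proof (rule Lim_null_comparison)
      show "\<forall>\<^sub>F n in sequentially. norm ((iter g a n x - x) / real n - ?b n / real n) \<le> 1 / real n"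
        using it_displacement[of a _ x]
        by (intro always_eventually allI) (simp add: divide_right_mono flip: diff_divide_distrib)
    qed (rule lim_1_over_n)
    from tendsto_add[OF this \<rho>] show ?thesis by simp
  qed
  then show ?thesis by blast
qed

lemma it_pow_le_all:
  assumes "\<And>x. iter g a q x \<le> x + s"
  shows "iter g a (N * q) x \<le> x + real N * s"
proof (induction N)
  case (Suc N)
  have "iter g a (Suc N * q) x \<le> iter g a (N * q) x + s"
    using assms[of "iter g a (N * q) x"] by (simp add: iter_add)
  then show ?case using Suc by (simp add: algebra_simps)
qed simp

lemma rotation_number_le:
  assumes lim: "(\<lambda>n. (iter g a n x - x) / real n) \<longlonglongrightarrow> \<rho>" and q: "0 < q"
    and le: "\<And>N. iter g a (N * q) x \<le> x + real N * s"
  shows "\<rho> \<le> s / real q"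
proof (rule LIMSEQ_le_const2)
  \<comment> \<open>The limit is read off along the multiples of \<open>q\<close>;
    \<open>Suc N\<close> keeps the denominators positive.\<close>
  have "strict_mono (\<lambda>N. Suc N * q)" using q by (intro strict_monoI_Suc) simp
  from LIMSEQ_subseq_LIMSEQ[OF lim this]
  show "(\<lambda>N. (iter g a (Suc N * q) x - x) / real (Suc N * q)) \<longlonglongrightarrow> \<rho>"
    by (simp add: comp_def)
  have "(iter g a (Suc N * q) x - x) / real (Suc N * q) \<le> s / real q" for N
  proof -
    have "(iter g a (Suc N * q) x - x) / real (Suc N * q) \<le> (real (Suc N) * s) / real (Suc N * q)"
      using le[of "Suc N"] by (intro divide_right_mono) linarith+
    also have "\<dots> = s / real q" unfolding of_nat_mult by (rule mult_divide_mult_cancel_left) simp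
    finally show ?thesis .
  qed
  then show "\<exists>N. \<forall>n\<ge>N. (iter g a (Suc n * q) x - x) / real (Suc n * q) \<le> s / real q" by blast
qed

lemma rotation_number_ge:
  assumes lim: "(\<lambda>n. (iter g a n x - x) / real n) \<longlonglongrightarrow> \<rho>" and q: "0 < q"
    and ge: "\<And>N. x + real N * s \<le> iter g a (N * q) x"
  shows "s / real q \<le> \<rho>"
proof (rule LIMSEQ_le_const)
  have "strict_mono (\<lambda>N. Suc N * q)" using q by (intro strict_monoI_Suc) simp
  from LIMSEQ_subseq_LIMSEQ[OF lim this]
  show "(\<lambda>N. (iter g a (Suc N * q) x - x) / real (Suc N * q)) \<longlonglongrightarrow> \<rho>"
    by (simp add: comp_def)
  have "s / real q \<le> (iter g a (Suc N * q) x - x) / real (Suc N * q)" for N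
  proof -
    have "s / real q = (real (Suc N) * s) / real (Suc N * q)"
      unfolding of_nat_mult by (rule mult_divide_mult_cancel_left[symmetric]) simp
    also have "\<dots> \<le> (iter g a (Suc N * q) x - x) / real (Suc N * q)"
      using ge[of "Suc N"] by (intro divide_right_mono) linarith+
    finally show ?thesis .
  qed
  then show "\<exists>N. \<forall>n\<ge>N. s / real q \<le> (iter g a (Suc n * q) x - x) / real (Suc n * q)" by blast
qed

text \<open>Orbits of \<open>g\<close> lie below those of \<open>f\<close>, which bounds the
  rotation set from below; the shared orbit attains the bound.\<close>

lemma Inf_rotation_set:
  assumes le: "\<And>x. g x \<le> f x" and orb: "\<exists>x. \<forall>n. iter f a n x = iter g a n x"
  shows "(\<lambda>n. (iter g a n x - x) / real n) \<longlonglongrightarrow> Inf (rotation_set (\<lambda>x. f x + a))"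
proof -
  obtain \<rho> where \<rho>: "\<And>x. (\<lambda>n. (iter g a n x - x) / real n) \<longlonglongrightarrow> \<rho>"
    using rotation_number_exists by blast
  have set: "rotation_set (\<lambda>x. f x + a) = {\<sigma>. \<exists>x. (\<lambda>n. (iter f a n x - x) / real n) \<longlonglongrightarrow> \<sigma>}"
    by (simp add: rotation_set_def iter_def)
  have "Inf (rotation_set (\<lambda>x. f x + a)) = \<rho>"
  proof (rule cInf_eq_minimum)
    obtain x where "\<And>n. iter f a n x = iter g a n x" using orb by blast
    then show "\<rho> \<in> rotation_set (\<lambda>x. f x + a)"
      using \<rho>[of x] unfolding set by (intro CollectI exI[of _ x]) simp
    fix \<sigma> assume "\<sigma> \<in> rotation_set (\<lambda>x. f x + a)"
    then obtain x where x: "(\<lambda>n. (iter f a n x - x) / real n) \<longlonglongrightarrow> \<sigma>" unfolding set by blast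
    have "(iter g a n x - x) / real n \<le> (iter f a n x - x) / real n" for n
      using iter_le_iter[OF mono_lift_axioms le order_refl] by (intro divide_right_mono) auto
    then show "\<rho> \<le> \<sigma>" by (intro LIMSEQ_le[OF \<rho> x]) blast
  qed
  then show ?thesis using \<rho> by simp
qed

text \<open>This identifies \<open>Psi1\<close> with the tangency parameter. For a smaller
  \<open>a\<close> the graph stays below the line by the uniform gap \<open>\<psi> - a\<close>,
  which makes the rotation number strictly smaller.\<close>

lemma Inf_touch_above:
  assumes le: "\<And>x. g x \<le> f x" and orb: "\<And>a. \<exists>x. \<forall>n. iter f a n x = iter g a n x"
    and t: "touch_above g q p \<psi>" and q: "0 < q"
  shows "Inf {a. Inf (rotation_set (\<lambda>x. f x + a)) = of_int p / real q} = \<psi>"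
proof (rule cInf_eq_minimum)
  note lim = Inf_rotation_set[of f, OF le orb]
  obtain x where x: "iter g \<psi> q x = x + of_int p" using t by (auto simp: touch_above_def)
  have pow: "iter g \<psi> (N * q) x = x + real N * of_int p" for N
    using it_pow_le[of \<psi> q x p N] it_pow_ge[of x p \<psi> q N] x by simp
  have "Inf (rotation_set (\<lambda>x. f x + \<psi>)) \<le> of_int p / real q"
    by (rule rotation_number_le[where x = x, OF lim q]) (simp add: pow)
  moreover have "of_int p / real q \<le> Inf (rotation_set (\<lambda>x. f x + \<psi>))"
    by (rule rotation_number_ge[where x = x, OF lim q]) (simp add: pow)
  ultimately show "\<psi> \<in> {a. Inf (rotation_set (\<lambda>x. f x + a)) = of_int p / real q}" by simp
  fix a assume "a \<in> {a. Inf (rotation_set (\<lambda>x. f x + a)) = of_int p / real q}"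
  then have a: "Inf (rotation_set (\<lambda>x. f x + a)) = of_int p / real q" by simp
  show "\<psi> \<le> a"
  proof (rule ccontr)
    assume "\<not> ?thesis"
    then have d: "0 < \<psi> - a" by simp
    have "iter g a q x \<le> x + (of_int p - (\<psi> - a))" for x
    proof -
      have "iter g a q x + (\<psi> - a) \<le> iter g \<psi> q x"
        using it_param_add[OF q, of "\<psi> - a" a x] d by simp
      also have "\<dots> \<le> x + of_int p" using t by (simp add: touch_above_def)
      finally show ?thesis by simp
    qed
    then have "iter g a (N * q) 0 \<le> 0 + real N * (of_int p - (\<psi> - a))" for N
      by (rule it_pow_le_all)
    then have "Inf (rotation_set (\<lambda>x. f x + a)) \<le> (of_int p - (\<psi> - a)) / real q"
      by (rule rotation_number_le[OF lim q])
    also have "\<dots> < of_int p / real q" using d q by (simp add: divide_strict_right_mono)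
    finally show False using a by simp
  qed
qed

end

lemma rotation_set_refl_map:
  "rotation_set (\<lambda>x. refl_map f x + (- a)) = uminus ` rotation_set (\<lambda>x. f x + a)"
proof -
  have set: "rotation_set (\<lambda>x. f x + a) = {\<sigma>. \<exists>x. (\<lambda>n. (iter f a n x - x) / real n) \<longlonglongrightarrow> \<sigma>}" for f a
    by (simp add: rotation_set_def iter_def)
  have eq: "(iter (refl_map f) (- a) n x - x) / real n = - ((iter f a n (- x) - (- x)) / real n)" for n x
    by (cases "n = 0") (simp_all add: iter_refl_map field_simps)
  show ?thesis
  proof (intro equalityI subsetI)
    fix \<sigma> assume "\<sigma> \<in> rotation_set (\<lambda>x. refl_map f x + (- a))"
    then obtain x where "(\<lambda>n. - ((iter f a n (- x) - (- x)) / real n)) \<longlonglongrightarrow> \<sigma>"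
      unfolding set eq by blast
    then have "(\<lambda>n. (iter f a n (- x) - (- x)) / real n) \<longlonglongrightarrow> - \<sigma>"
      using tendsto_minus by fastforce
    then have "- \<sigma> \<in> rotation_set (\<lambda>x. f x + a)" unfolding set by blast
    then show "\<sigma> \<in> uminus ` rotation_set (\<lambda>x. f x + a)" by (metis image_eqI minus_minus)
  next
    fix \<sigma> assume "\<sigma> \<in> uminus ` rotation_set (\<lambda>x. f x + a)"
    then obtain x where "(\<lambda>n. (iter f a n x - x) / real n) \<longlonglongrightarrow> - \<sigma>" unfolding set by force
    from tendsto_minus[OF this]
    have "(\<lambda>n. - ((iter f a n (- (- x)) - (- (- x))) / real n)) \<longlonglongrightarrow> \<sigma>" by simp
    then show "\<sigma> \<in> rotation_set (\<lambda>x. refl_map f x + (- a))" unfolding set eq by blast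
  qed
qed

lemma (in mono_lift) Sup_touch_below:
  assumes le: "\<And>x. f x \<le> g x" and orb: "\<And>a. \<exists>x. \<forall>n. iter f a n x = iter g a n x"
    and t: "touch_below g q p \<psi>" and q: "0 < q"
  shows "Sup {a. Sup (rotation_set (\<lambda>x. f x + a)) = of_int p / real q} = \<psi>"
proof -
  interpret r: mono_lift "refl_map g" by (rule mono_lift_refl_map) (rule mono_lift_axioms)
  let ?A = "{a. Sup (rotation_set (\<lambda>x. f x + a)) = of_int p / real q}"
  have orb': "\<exists>x. \<forall>n. iter (refl_map f) a n x = iter (refl_map g) a n x" for a
  proof -
    obtain x where "\<forall>n. iter f (- a) n x = iter g (- a) n x" using orb by blast
    then show ?thesis using iter_refl_map[of _ "- a"] by (intro exI[of _ "- x"]) simp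
  qed
  have "Inf {a. Inf (rotation_set (\<lambda>x. refl_map f x + a)) = of_int (- p) / real q} = - \<psi>"
    by (rule r.Inf_touch_above[OF _ orb' _ q])
      (use le t in \<open>simp_all add: refl_map_def[of f] refl_map_def[of g] touch_refl_map'\<close>)
  \<comment> \<open>On the reals \<open>Inf\<close> is defined through \<open>Sup\<close> of the
    negated set, so this identity carries no boundedness conditions.\<close>
  moreover have "Inf (rotation_set (\<lambda>x. refl_map f x + a)) = - Sup (rotation_set (\<lambda>x. f x + (- a)))" for a
    using rotation_set_refl_map[of f "- a"] by (simp add: Inf_real_def image_image)
  ultimately have "Inf {a. Sup (rotation_set (\<lambda>x. f x + (- a))) = of_int p / real q} = - \<psi>" by simp
  moreover have "{a. Sup (rotation_set (\<lambda>x. f x + (- a))) = of_int p / real q} = uminus ` ?A"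
    by (auto intro!: image_eqI[of _ _ "- _"])
  ultimately show ?thesis by (simp add: Inf_real_def image_image)
qed

section \<open>The monotone bounds of a bimodal lift\<close>

lemma lift_displacement_bounded:
  fixes f :: "real \<Rightarrow> real"
  assumes c: "continuous_on UNIV f" and per: "\<And>x. f (x + 1) = f x + 1"
  obtains B where "\<And>x. \<bar>f x - x\<bar> \<le> B"
proof -
  have "compact ((\<lambda>x. f x - x) ` {0..1})"
    by (intro compact_continuous_image continuous_intros continuous_on_subset[OF c]) auto
  then obtain B where B: "\<And>x. x \<in> {0..1} \<Longrightarrow> \<bar>f x - x\<bar> \<le> B"
    using compact_imp_bounded bounded_real by (metis (no_types, lifting) imageI)
  have "\<bar>f x - x\<bar> \<le> B" for x
  proof -
    have "f (x - of_int \<lfloor>x\<rfloor> + of_int \<lfloor>x\<rfloor>) = f (x - of_int \<lfloor>x\<rfloor>) + of_int \<lfloor>x\<rfloor>"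
      by (rule int_periodic) (rule per)
    moreover have "x - of_int \<lfloor>x\<rfloor> \<in> {0..1}" by (auto; linarith)
    ultimately show ?thesis using B[of "x - of_int \<lfloor>x\<rfloor>"] by simp
  qed
  then show ?thesis by (rule that)
qed

text \<open>Only the shape of the graph is recorded. The properties of the lower bound are derived
  from it, and the upper bound is obtained as the reflected lower bound of the reflected
  map.\<close>

locale bimodal_shape =
  fixes f :: "real \<Rightarrow> real" and k C K c :: real
  assumes f_cont: "continuous_on UNIV f" and f_per: "f (x + 1) = f x + 1"
    and ord: "K - 1 < k" "k < C" "C < K" "K < c" "c < C + 1"
    and inc: "K - 1 \<le> x \<Longrightarrow> x < y \<Longrightarrow> y \<le> C \<Longrightarrow> f x < f y"
    and dec: "C \<le> x \<Longrightarrow> x < y \<Longrightarrow> y \<le> K \<Longrightarrow> f y < f x"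
    and f_k: "f k = f K" and f_c: "f c = f C"
begin

abbreviation "low \<equiv> lower_bound_map f"

lemma f_shift: "f (x + of_int m) = f x + of_int m"
  by (rule int_periodic) (rule f_per)

lemma bdd: "bdd_below (f ` {x..})"
proof -
  obtain B where "\<And>x. \<bar>f x - x\<bar> \<le> B" using lift_displacement_bounded[OF f_cont f_per] by blast
  then have "x - B \<le> f y" if "x \<le> y" for y using that by (metis abs_le_D2 diff_mono dual_order.trans minus_diff_eq add.commute diff_le_eq le_diff_eq)
  then show ?thesis by (intro bdd_belowI2[of _ "x - B"]) auto
qed

lemma low_le: "x \<le> y \<Longrightarrow> low x \<le> f y"
  unfolding lower_bound_map_def by (rule cINF_lower[OF bdd]) simp

lemma low_ge: "(\<And>y. x \<le> y \<Longrightarrow> z \<le> f y) \<Longrightarrow> z \<le> low x"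
  unfolding lower_bound_map_def by (rule cINF_greatest) auto

lemma low_mono: "mono low"
  by (intro monoI low_ge low_le) simp

lemma low_per: "low (x + 1) = low x + 1"
proof (rule antisym)
  have "low (x + 1) - 1 \<le> low x"
  proof (rule low_ge)
    fix y assume "x \<le> y"
    then show "low (x + 1) - 1 \<le> f y" using low_le[of "x + 1" "y + 1"] f_per[of y] by simp
  qed
  then show "low (x + 1) \<le> low x + 1" by simp
  show "low x + 1 \<le> low (x + 1)"
  proof (rule low_ge)
    fix y assume "x + 1 \<le> y"
    then show "low x + 1 \<le> f y" using low_le[of x "y - 1"] f_per[of "y - 1"] by simp
  qed
qed

lemma f_ge_K: assumes "C \<le> y" shows "f K \<le> f y"
proof -
  have one: "f K \<le> f y" if y: "C \<le> y" "y \<le> C + 1" for y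
  proof (cases "y \<le> K")
    case True
    then show ?thesis using dec[of y K] y by (cases "y = K") auto
  next
    case False
    then show ?thesis using inc[of "K - 1" "y - 1"] f_per[of "K - 1"] f_per[of "y - 1"] y by simp
  qed
  define n where "n = \<lfloor>y - C\<rfloor>"
  have n: "0 \<le> n" "C \<le> y - of_int n" "y - of_int n \<le> C + 1" unfolding n_def using assms by linarith+
  have "f K \<le> f (y - of_int n)" by (rule one) (use n in auto)
  then show ?thesis using f_shift[of "y - of_int n" n] n(1) by simp
qed

text \<open>Values past \<open>C\<close> are at least f K = f k, so for a point of the branch ending
  at \<open>k\<close> the infimum over its right-hand side is taken at the point itself.\<close>

lemma low_eq: assumes "K - 1 \<le> x" "x \<le> k" shows "low x = f x"
proof (rule antisym[OF low_le[OF order_refl] low_ge])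
  fix y assume "x \<le> y"
  show "f x \<le> f y"
  proof (cases "y \<le> C")
    case True
    then show ?thesis using inc[of x y] assms \<open>x \<le> y\<close> by (cases "x = y") auto
  next
    case False
    have "f x \<le> f k" using inc[of x k] assms ord by (cases "x = k") auto
    then show ?thesis using f_ge_K[of y] False f_k by simp
  qed
qed

lemma low_flat: assumes "k \<le> x" "x \<le> K" shows "low x = f k"
proof (rule antisym)
  show "low x \<le> f k" using low_le[of x K] assms f_k by simp
  have "f k = low k" using low_eq[of k] ord by simp
  also have "\<dots> \<le> low x" by (rule monoD[OF low_mono]) fact
  finally show "f k \<le> low x" .
qed

lemma low_cont: "continuous_on UNIV low"
proof -
  have "continuous_on {K - 1..k} low"
    by (rule continuous_on_eq[OF continuous_on_subset[OF f_cont]]) (auto simp: low_eq)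
  moreover have "continuous_on {k..K} low"
    by (rule continuous_on_eq[OF continuous_on_const[of _ "f k"]]) (auto simp: low_flat)
  ultimately have "continuous_on ({K - 1..k} \<union> {k..K}) low" by (intro continuous_on_closed_Un) auto
  moreover have "{K - 1..k} \<union> {k..K} = {K - 1..K}" using ord by auto
  ultimately have c: "continuous_on {K - 1..K} low" by simp
  have sh: "low (x + of_int m) = low x + of_int m" for x m
    by (rule int_periodic) (rule low_per)
  have cm: "continuous_on {K - 1 + of_int m..K + of_int m} low" for m :: int
  proof (rule continuous_on_eq)
    show "continuous_on {K - 1 + of_int m..K + of_int m} (\<lambda>x. low (x - of_int m) + of_int m)"
      by (intro continuous_intros continuous_on_compose2[OF c]) auto
    show "low (x - of_int m) + of_int m = low x" for x using sh[of "x - of_int m" m] by simp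
  qed
  have "isCont low x" for x
  proof -
    define m where "m = \<lceil>x - K\<rceil>"
    have m: "K - 1 + of_int m < x" "x \<le> K + of_int m" unfolding m_def by linarith+
    \<comment> \<open>Two adjacent periods are joined because \<open>x\<close> may be their common
      endpoint.\<close>
    have "continuous_on ({K - 1 + of_int m..K + of_int m} \<union> {K - 1 + of_int (m + 1)..K + of_int (m + 1)}) low"
      by (intro continuous_on_closed_Un cm) auto
    moreover have "{K - 1 + of_int m..K + of_int m} \<union> {K - 1 + of_int (m + 1)..K + of_int (m + 1)}
        = {K - 1 + of_int m..K + of_int m + 1}" by auto
    ultimately have "continuous_on {K - 1 + of_int m<..<K + of_int m + 1} low"
      by (metis continuous_on_subset greaterThanLessThan_subseteq_atLeastAtMost_iff order_refl)
    then show ?thesis using m by (auto simp: continuous_on_eq_continuous_at)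
  qed
  then show ?thesis by (simp add: continuous_at_imp_continuous_on)
qed

lemma mono_lift_low: "mono_lift low"
  by unfold_locales (rule low_mono low_cont low_per)+

lemma shape_reflected: "bimodal_shape (refl_map f) (- c) (- K) (- C) (- k)"
proof
  show "continuous_on UNIV (refl_map f)"
    unfolding refl_map_def by (intro continuous_intros continuous_on_compose2[OF f_cont]) auto
  show "refl_map f (x + 1) = refl_map f x + 1" for x
    using f_per[of "- x - 1"] by (simp add: refl_map_def)
  show "- C - 1 < - c" "- c < - K" "- K < - C" "- C < - k" "- k < - K + 1" using ord by auto
  show "refl_map f x < refl_map f y" if "- C - 1 \<le> x" "x < y" "y \<le> - K" for x y
    using inc[of "- y - 1" "- x - 1"] f_per[of "- y - 1"] f_per[of "- x - 1"] that
    by (simp add: refl_map_def)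
  show "refl_map f y < refl_map f x" if "- K \<le> x" "x < y" "y \<le> - C" for x y
    using dec[of "- y" "- x"] that by (simp add: refl_map_def)
  show "refl_map f (- c) = refl_map f (- C)" "refl_map f (- k) = refl_map f (- K)"
    using f_k f_c by (simp_all add: refl_map_def)
qed

lemma bimodal:
  assumes "c \<le> k + 1"
    and df: "\<And>x. (f has_real_derivative f1 x) (at x)"
    and df1: "\<And>x. (f1 has_real_derivative f2 x) (at x)"
    and df2: "\<And>x. (f2 has_real_derivative f3 x) (at x)"
    and f1_pos: "\<And>x. K - 1 < x \<Longrightarrow> x < C \<Longrightarrow> 0 < f1 x"
    and schw: "\<And>x. f1 x \<noteq> 0 \<Longrightarrow> f3 x / f1 x - 3 / 2 * (f2 x / f1 x)\<^sup>2 < 0"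
  shows "bimodal f low (refl_map (lower_bound_map (refl_map f))) f1 f2 f3 k C K c"
proof -
  interpret r: bimodal_shape "refl_map f" "- c" "- K" "- C" "- k" by (rule shape_reflected)
  interpret ml: mono_lift low by (rule mono_lift_low)
  interpret mh: mono_lift "refl_map r.low" by (rule mono_lift_refl_map) (rule r.mono_lift_low)
  show ?thesis
  proof
    show "f x \<le> refl_map r.low x" for x
      using r.low_le[of "- x" "- x"] by (simp add: refl_map_def)
    show "refl_map r.low x = f x" if "c - 1 \<le> x" "x \<le> C" for x
    proof -
      have "r.low (- x) = r.low (- x - 1) + 1" using r.low_per[of "- x - 1"] by simp
      also have "\<dots> = refl_map f (- x)"
      proof (cases "- x \<le> - c + 1")
        case True
        then show ?thesis using r.low_eq[of "- x - 1"] r.f_per[of "- x - 1"] that by simp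
      qed (use that in simp)
      finally show ?thesis by (simp add: refl_map_def)
    qed
    show "refl_map r.low x = refl_map r.low c" if "C \<le> x" "x \<le> c" for x
      using r.low_flat[of "- x"] r.low_flat[of "- c"] that ord by (simp add: refl_map_def)
    show "low x = low k" if "k \<le> x" "x \<le> K" for x
      using low_flat[of x] low_flat[of k] that ord by simp
  qed (use assms ord f_per inc low_le low_eq in auto)
qed

end

context bimodal begin

lemma F_eq_H:
  assumes "\<And>i m. i < n \<Longrightarrow> \<not> (C + of_int m < F a i x \<and> F a i x < c + of_int m)"
  shows "H a n x = F a n x"
  using assms
proof (induction n)
  case (Suc n)
  define m where "m = \<lfloor>F a n x - c\<rfloor> + 1"
  have m: "c + of_int m - 1 \<le> F a n x" "F a n x < c + of_int m" unfolding m_def by linarith+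
  have "h (F a n x) = f (F a n x)"
    using hf_shift_eq[of m "F a n x"] m Suc.prems[of n m] by force
  then show ?case using Suc by (simp add: iter_Suc)
qed simp

lemma common_orbit_upper: "\<exists>x. \<forall>n. F a n x = H a n x"
proof -
  interpret r: bimodal "refl_map f" "refl_map h" "refl_map g" "\<lambda>x. f1 (- x)" "\<lambda>x. - f2 (- x)"
    "\<lambda>x. f3 (- x)" "- c" "- K" "- C" "- k" by (rule bimodal_reflected)
  obtain x where "\<And>n. r.F (- a) n x = r.G (- a) n x" using r.common_orbit by blast
  then have "\<forall>n. F a n (- x) = H a n (- x)" by (simp add: iter_refl_map)
  then show ?thesis by blast
qed

end

section \<open>The critical line\<close>

locale mono_lift_farey = mono_lift g + farey p p1 p2 q q1 q2
  for g :: "real \<Rightarrow> real" and p p1 p2 :: int and q q1 q2 :: nat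
begin

text \<open>The plateaus have shrunk to the critical point \<open>k\<close>, so one map serves as
  both bounds. If \<open>\<psi>1 \<ge> \<psi>2\<close>, its q-th iterate would be translation by
  \<open>p\<close>, of slope one, whereas the slope at \<open>k\<close> is zero. The rest is
  comparison of rotation numbers.\<close>

lemma critical_case:
  fixes g1 :: "real \<Rightarrow> real"
  assumes dg: "\<And>x. (g has_real_derivative g1 x) (at x)" and k: "g1 k = 0"
    and t1: "touch_above g q p \<psi>1" and t2: "touch_below g q p \<psi>2"
    and R: "\<And>j. iter g (R j) (j * q + q1) k = k + of_int (int j * p + p1)"
    and L: "\<And>j. iter g (L j) (j * q + q2) k = k + of_int (int j * p + p2)"
  shows "\<psi>1 < \<psi>2" "R j < R (Suc j)" "R j < \<psi>1" "L (Suc j) < L j" "\<psi>2 < L j"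
proof -
  show "\<psi>1 < \<psi>2"
  proof (rule ccontr)
    assume "\<not> ?thesis"
    then have "iter g \<psi>2 q x \<le> iter g \<psi>1 q x" for x by (intro it_mono_param) simp
    then have "iter g \<psi>1 q x = x + of_int p" for x
      using t1 t2 unfolding touch_above_def touch_below_def by (meson order_antisym order_trans)
    then have "iter g \<psi>1 q = (\<lambda>x. x + of_int p)" by blast
    then have "((\<lambda>x. x + of_int p) has_real_derivative iter_d g g1 \<psi>1 q k) (at k)"
      using DERIV_iter[of g g1 \<psi>1 q k, OF dg] by simp
    moreover have "((\<lambda>x. x + of_int p) has_real_derivative 1) (at k)"
      by (auto intro!: derivative_eq_intros)
    ultimately have "iter_d g g1 \<psi>1 q k = 1" by (rule DERIV_unique)
    moreover have "iter_d g g1 \<psi>1 q k = 0"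
      unfolding iter_d_def using q0 k by (intro prod_zero) (auto intro!: bexI[of _ 0])
    ultimately show False by simp
  qed
  show R1: "R j < \<psi>1" for j
  proof -
    obtain x where x: "iter g \<psi>1 q x = x + of_int p" using t1 by (auto simp: touch_above_def)
    have "\<not> iter g \<psi>1 (j * q + q1) k \<le> k + of_int (int j * p + p1)"
    proof
      assume "iter g \<psi>1 (j * q + q1) k \<le> k + of_int (int j * p + p1)"
      then have "p * int (j * q + q1) \<le> (int j * p + p1) * int q"
        using x by (intro rot_compare[of x p \<psi>1 q _ k]) simp_all
      then show False using det1 by (simp add: algebra_simps)
    qed
    then show ?thesis using it_less_param_iff[of "j * q + q1" "R j" k \<psi>1] R q_pos by simp
  qed
  show L1: "\<psi>2 < L j" for j
  proof -
    obtain x where x: "iter g \<psi>2 q x = x + of_int p" using t2 by (auto simp: touch_below_def)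
    have "\<not> k + of_int (int j * p + p2) \<le> iter g \<psi>2 (j * q + q2) k"
    proof
      assume "k + of_int (int j * p + p2) \<le> iter g \<psi>2 (j * q + q2) k"
      then have "(int j * p + p2) * int q \<le> p * int (j * q + q2)"
        using x by (intro rot_compare[of k _ \<psi>2 _ q x]) simp_all
      then show False using det2 by (simp add: algebra_simps)
    qed
    then show ?thesis using it_less_param_iff[of "j * q + q2" \<psi>2 k "L j"] L q_pos by simp
  qed
  show "R j < R (Suc j)"
  proof -
    have "iter g (R j) (Suc j * q + q1) k = iter g (R j) q (iter g (R j) (j * q + q1) k)"
      by (simp add: add.assoc flip: iter_add)
    also have "\<dots> = iter g (R j) q k + of_int (int j * p + p1)" unfolding R by (rule it_shift)
    also have "\<dots> < k + of_int p + of_int (int j * p + p1)"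
      using touch_above_less[OF t1 R1 q0] by simp
    also have "\<dots> = iter g (R (Suc j)) (Suc j * q + q1) k" unfolding R by (simp add: algebra_simps)
    finally show ?thesis using it_less_param_iff[of "Suc j * q + q1"] q_pos by simp
  qed
  show "L (Suc j) < L j"
  proof -
    have "iter g (L (Suc j)) (Suc j * q + q2) k = k + of_int p + of_int (int j * p + p2)"
      unfolding L by (simp add: algebra_simps)
    also have "\<dots> < iter g (L j) q k + of_int (int j * p + p2)"
      using touch_below_greater[OF t2 L1 q0] by simp
    also have "\<dots> = iter g (L j) q (iter g (L j) (j * q + q2) k)" unfolding L by (rule it_shift[symmetric])
    also have "\<dots> = iter g (L j) (Suc j * q + q2) k" by (simp add: add.assoc flip: iter_add)
    finally show ?thesis using it_less_param_iff[of "Suc j * q + q2"] q_pos by simp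
  qed
qed

end

text \<open>If f y < f x for some x < y, the point of the upper graph over the midpoint keeps a
  positive distance from the lower graph: vertically from the part over (-infinity, y], horizontally
  from the rest.\<close>

lemma hausdorff_bounds_zero_iff:
  fixes f :: "real \<Rightarrow> real"
  assumes c: "continuous_on UNIV f" and per: "\<And>x. f (x + 1) = f x + 1"
  shows "hausdorff_distance (graph_of (upper_bound_map f)) (graph_of (lower_bound_map f)) = 0
    \<longleftrightarrow> mono f" (is "hausdorff_distance ?A ?B = 0 \<longleftrightarrow> _")
proof
  assume "mono f"
  then have "upper_bound_map f x = f x" "lower_bound_map f x = f x" for x
    unfolding upper_bound_map_def lower_bound_map_def
    by (intro cSup_eq_maximum cInf_eq_minimum; auto dest: monoD)+
  then have "?A = ?B" by (simp add: graph_of_def)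
  moreover have "(SUP x\<in>?B. infdist x ?B) = 0"
  proof -
    have "(\<lambda>x. infdist x ?B) ` ?B = {0}" by (auto simp: graph_of_def image_iff)
    then show ?thesis by simp
  qed
  ultimately show "hausdorff_distance ?A ?B = 0" by (simp add: hausdorff_distance_def)
next
  assume zero: "hausdorff_distance ?A ?B = 0"
  obtain M where M: "\<And>x. \<bar>f x - x\<bar> \<le> M" using lift_displacement_bounded[OF c per] by blast
  have up: "f y \<le> x + M" if "y \<le> x" for x y using M[of y] that by linarith
  have lo: "x - M \<le> f y" if "x \<le> y" for x y using M[of y] that by linarith
  have bu: "bdd_above (f ` {..x})" for x by (rule bdd_aboveI2[of _ _ "x + M"]) (auto intro: up)
  have bl: "bdd_below (f ` {x..})" for x by (rule bdd_belowI2[of _ "x - M"]) (auto intro: lo)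
  have u: "f y \<le> upper_bound_map f x" if "y \<le> x" for x y
    unfolding upper_bound_map_def by (rule cSUP_upper[OF _ bu]) (use that in simp)
  have l: "lower_bound_map f x \<le> f y" if "x \<le> y" for x y
    unfolding lower_bound_map_def by (rule cINF_lower[OF bl]) (use that in simp)
  have uM: "upper_bound_map f x \<le> x + M" for x
    unfolding upper_bound_map_def by (rule cSUP_least) (auto intro: up)
  have lM: "x - M \<le> lower_bound_map f x" for x
    unfolding lower_bound_map_def by (rule cINF_greatest) (auto intro: lo)
  \<comment> \<open>The supremum is meaningful only for a family bounded above, which the bounded
    displacement supplies.\<close>
  have bdd: "bdd_above ((\<lambda>x. infdist x ?B) ` ?A)"
  proof (rule bdd_aboveI2)
    fix z assume "z \<in> ?A"
    then obtain x where z: "z = (x, upper_bound_map f x)" by (auto simp: graph_of_def)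
    have "infdist z ?B \<le> dist z (x, lower_bound_map f x)"
      by (rule infdist_le) (auto simp: graph_of_def)
    also have "\<dots> = \<bar>upper_bound_map f x - lower_bound_map f x\<bar>"
      by (simp add: z dist_Pair_Pair dist_real_def)
    also have "\<dots> \<le> 2 * M" using uM[of x] lM[of x] u[of x x] l[of x x] by simp
    finally show "infdist z ?B \<le> 2 * M" .
  qed
  show "mono f"
  proof (rule ccontr)
    assume "\<not> mono f"
    then obtain x y where xy: "x \<le> y" "f y < f x" by (auto simp: mono_def not_le)
    then have "x < y" by (cases "x = y") auto
    define w where "w = (x + y) / 2"
    define e where "e = min ((y - x) / 2) (f x - f y)"
    have e: "0 < e" using \<open>x < y\<close> xy by (simp add: e_def)
    have "e \<le> infdist (w, upper_bound_map f w) ?B"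
    proof -
      have ne: "?B \<noteq> {}" by (auto simp: graph_of_def)
      have "e \<le> dist (w, upper_bound_map f w) b" if bB: "b \<in> ?B" for b
      proof -
        obtain v where b: "b = (v, lower_bound_map f v)"
          using bB unfolding graph_of_def by blast
        show ?thesis
        proof (cases "v \<le> y")
          case True
          have "e \<le> upper_bound_map f w - lower_bound_map f v"
            using u[of x w] l[of v y] True \<open>x < y\<close> by (simp add: e_def w_def)
          also have "\<dots> \<le> dist (snd (w, upper_bound_map f w)) (snd b)"
            by (simp add: b dist_real_def)
          also have "\<dots> \<le> dist (w, upper_bound_map f w) b" by (rule dist_snd_le)
          finally show ?thesis .
        next
          case False
          have "(y - x) / 2 = y - w" by (simp add: w_def field_simps)
          then have "e \<le> v - w" using False unfolding e_def by linarith
          also have "\<dots> \<le> dist (fst (w, upper_bound_map f w)) (fst b)"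
            by (simp add: b dist_real_def)
          also have "\<dots> \<le> dist (w, upper_bound_map f w) b" by (rule dist_fst_le)
          finally show ?thesis .
        qed
      qed
      then show ?thesis using ne by (simp add: infdist_def cINF_greatest)
    qed
    also have "\<dots> \<le> (SUP x\<in>?A. infdist x ?B)"
      by (rule cSUP_upper[OF _ bdd]) (auto simp: graph_of_def)
    also have "\<dots> \<le> 0" using zero by (simp add: hausdorff_distance_def)
    finally show False using e by simp
  qed
qed

section \<open>Families in Class N: the critical line and the turning points\<close>

lemma class_B_derivs:
  assumes "class_B f"
  shows "\<And>x. (f has_real_derivative deriv f x) (at x)"
    "\<And>x. (deriv f has_real_derivative deriv (deriv f) x) (at x)"
    "\<And>x. (deriv (deriv f) has_real_derivative deriv (deriv (deriv f)) x) (at x)"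
proof -
  have d: "((deriv ^^ n) f) differentiable (at x)" if "n < 3" for n x
    using assms that by (simp add: class_B_def C3_def)
  show "\<And>x. (f has_real_derivative deriv f x) (at x)"
    using d[of 0] by (simp add: DERIV_deriv_iff_real_differentiable)
  show "\<And>x. (deriv f has_real_derivative deriv (deriv f) x) (at x)"
    using d[of 1] by (simp add: DERIV_deriv_iff_real_differentiable)
  show "\<And>x. (deriv (deriv f) has_real_derivative deriv (deriv (deriv f)) x) (at x)"
    using d[of 2] by (simp add: DERIV_deriv_iff_real_differentiable eval_nat_numeral)
qed

lemma class_B_lift:
  assumes "class_B f"
  shows "continuous_on UNIV f" "\<And>x. f (x + 1) = f x + 1"
  using assms by (auto simp: class_B_def degree_one_lift_def)

lemma class_B_deriv_shift:
  assumes "class_B f"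
  shows "deriv f (x + of_int m) = deriv f x"
proof -
  have s: "f (y + of_int m) = f y + of_int m" for y
    by (rule int_periodic) (rule class_B_lift[OF assms])
  have "((\<lambda>x. f (x + of_int m)) has_real_derivative deriv f (x + of_int m)) (at x)"
    using class_B_derivs(1)[OF assms, of "x + of_int m"] by (simp add: DERIV_shift)
  moreover have "((\<lambda>x. f x + of_int m) has_real_derivative deriv f x) (at x)"
    using DERIV_add[OF class_B_derivs(1)[OF assms] DERIV_const[of "of_int m"]] by simp
  ultimately show ?thesis using DERIV_unique s by simp
qed

lemma not_mono_deriv_neg:
  assumes "class_B f" "\<not> mono f"
  obtains x where "x \<in> {0..1}" "deriv f x < 0"
proof -
  have "\<exists>x. deriv f x < 0"
  proof (rule ccontr)
    assume "\<not> ?thesis"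
    then have nn: "0 \<le> deriv f x" for x by (simp add: not_less)
    have "mono f"
    proof (rule monoI)
      fix x y :: real assume "x \<le> y"
      then show "f x \<le> f y"
        by (rule DERIV_nonneg_imp_nondecreasing) (use class_B_derivs(1)[OF assms(1)] nn in blast)
    qed
    then show False using assms by simp
  qed
  then obtain x where x: "deriv f x < 0" by blast
  have "deriv f (x - of_int \<lfloor>x\<rfloor>) < 0"
    using class_B_deriv_shift[OF assms(1), of "x - of_int \<lfloor>x\<rfloor>" "\<lfloor>x\<rfloor>"] x by simp
  moreover have "x - of_int \<lfloor>x\<rfloor> \<in> {0..1}" by (auto; linarith)
  ultimately show ?thesis by (rule that[rotated])
qed

context
  fixes F :: "real \<Rightarrow> real \<Rightarrow> real \<Rightarrow> real"
  assumes N: "class_N F"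
begin

lemma class_N_class_B: "class_B (F a b)"
  using N unfolding class_N_def by blast

lemma class_N_translation: "F a b = (\<lambda>x. F 0 b x + a)"
proof
  show "F a b x = F 0 b x + a" for x using N unfolding class_N_def by blast
qed

lemma Delta_zero_iff: "Delta F b = 0 \<longleftrightarrow> mono (F 0 b)"
  unfolding Delta_def by (rule hausdorff_bounds_zero_iff) (rule class_B_lift[OF class_N_class_B])+

text \<open>The parameters with a monotone map form a closed set, bounded above because
  \<open>Delta\<close> is nondecreasing and exceeds one somewhere. Hence \<open>GREATEST\<close>
  denotes its maximum.\<close>

lemma critical_line_props:
  "mono (F 0 (critical_line F))" "critical_line F < b \<Longrightarrow> \<not> mono (F 0 b)"
proof -
  let ?S = "{b. mono (F 0 b)}"
  have mD: "mono (Delta F)" and ex0: "\<exists>b. Delta F b = 0" and ex1: "\<exists>b. Delta F b > 1"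
    and cF: "continuous_on UNIV (\<lambda>(a, b, x). F a b x)"
    using N unfolding class_N_def by blast+
  have ne: "?S \<noteq> {}" using ex0 Delta_zero_iff by auto
  obtain b1 where b1: "1 < Delta F b1" using ex1 by blast
  have bd: "bdd_above ?S"
  proof (rule bdd_aboveI)
    fix b assume "b \<in> ?S"
    then have "Delta F b = 0" using Delta_zero_iff by simp
    then show "b \<le> b1" using monoD[OF mD, of b1 b] b1 by linarith
  qed
  have cb: "continuous_on UNIV (\<lambda>b. F 0 b x)" for x
  proof -
    have "continuous_on UNIV (\<lambda>b. (\<lambda>(a, b, x). F a b x) (0, b, x))"
      by (intro continuous_on_compose2[OF cF] continuous_intros) auto
    then show ?thesis by simp
  qed
  have "closed ?S"
  proof -
    have "?S = (\<Inter>x. \<Inter>y\<in>{x..}. {b. F 0 b x \<le> F 0 b y})" by (auto simp: mono_def)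
    also have "closed \<dots>" by (intro closed_INT ballI closed_Collect_le cb)
    finally show ?thesis .
  qed
  then have S: "Sup ?S \<in> ?S" by (rule closed_contains_Sup[OF ne bd])
  have "critical_line F = Sup ?S"
    unfolding critical_line_def
    by (rule Greatest_equality) (use S in \<open>auto simp: Delta_zero_iff intro: cSup_upper[OF _ bd]\<close>)
  then show "mono (F 0 (critical_line F))" "critical_line F < b \<Longrightarrow> \<not> mono (F 0 b)"
    using S cSup_upper[OF _ bd, of b] by auto
qed

text \<open>Points of negative slope for parameters just above the critical line accumulate at a
  zero of the derivative on it. A monotone map has no turning points, so Class B leaves one critical
  point and the description in \<open>crit_pt\<close> is meaningful.\<close>

lemma crit_pt_props: "deriv (F 0 (critical_line F)) (crit_pt F (critical_line F)) = 0"
proof -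
  let ?b = "critical_line F"
  let ?f = "F 0 ?b"
  have cD: "continuous_on UNIV (\<lambda>(a, b, x). deriv (F a b) x)"
    using N unfolding class_N_def by blast+
  define y where "y = (\<lambda>n. ?b + 1 / real (Suc n))"
  have "\<exists>x\<in>{0..1}. deriv (F 0 (y n)) x < 0" for n
  proof -
    have "\<not> mono (F 0 (y n))" by (rule critical_line_props) (simp add: y_def)
    then show ?thesis using not_mono_deriv_neg[OF class_N_class_B] by metis
  qed
  then obtain x where x: "\<And>n. x n \<in> {0..1}" "\<And>n. deriv (F 0 (y n)) (x n) < 0" by metis
  obtain l r where r: "l \<in> {0..1}" "strict_mono r" "(x \<circ> r) \<longlonglongrightarrow> l"
    using compact_Icc[of "0::real" 1] x(1) unfolding compact_def by metis
  have "y \<longlonglongrightarrow> ?b"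
    using LIMSEQ_inverse_real_of_nat_add[of ?b] by (simp add: inverse_eq_divide y_def)
  then have "(y \<circ> r) \<longlonglongrightarrow> ?b" by (rule LIMSEQ_subseq_LIMSEQ) (rule r)
  then have lim: "(\<lambda>n. (0, (y \<circ> r) n, (x \<circ> r) n)) \<longlonglongrightarrow> (0, ?b, l)"
    by (intro tendsto_Pair tendsto_const r)
  have "isCont (\<lambda>(a, b, x). deriv (F a b) x) (0, ?b, l)"
    using cD by (simp add: continuous_on_eq_continuous_at)
  from isCont_tendsto_compose[OF this lim]
  have "(\<lambda>n. deriv (F 0 ((y \<circ> r) n)) ((x \<circ> r) n)) \<longlonglongrightarrow> deriv ?f l" by simp
  then have le: "deriv ?f l \<le> 0"
    by (rule LIMSEQ_le_const2) (use x(2) less_imp_le in \<open>auto simp: comp_def\<close>)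
  have m: "mono ?f" by (rule critical_line_props)
  have "deriv ?f l = 0"
  proof (rule ccontr)
    assume "deriv ?f l \<noteq> 0"
    then obtain d where d: "0 < d" "\<And>e. 0 < e \<Longrightarrow> e < d \<Longrightarrow> ?f (l + e) < ?f l"
      using DERIV_neg_dec_right[OF class_B_derivs(1)[OF class_N_class_B, of 0 ?b l]] le by auto
    then have "?f (l + d / 2) < ?f l" by simp
    moreover have "?f l \<le> ?f (l + d / 2)" by (rule monoD[OF m]) (use d in simp)
    ultimately show False by simp
  qed
  define z where "z = l - of_int \<lfloor>l\<rfloor>"
  have "deriv ?f z = 0"
    using class_B_deriv_shift[OF class_N_class_B, of 0 ?b z "\<lfloor>l\<rfloor>"] \<open>deriv ?f l = 0\<close> by (simp add: z_def)
  then have z: "z \<in> critical_points ?f" unfolding critical_points_def z_def by (auto; linarith)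
  have fin: "finite (critical_points ?f)" and le2: "card (critical_points ?f) \<le> 2"
    and tp: "card (critical_points ?f) = 2 \<Longrightarrow>
      turning_max ?f z \<or> turning_min ?f z"
    using class_N_class_B[of 0 ?b] z by (auto simp: class_B_def)
  have "card (critical_points ?f) \<noteq> 2"
  proof
    assume "card (critical_points ?f) = 2"
    then consider e where "0 < e" "strict_antimono_on {z..z + e} ?f"
      | e where "0 < e" "strict_antimono_on {z - e..z} ?f"
      using tp unfolding turning_max_def turning_min_def by blast
    then show False
    proof cases
      case 1
      then have "?f (z + e) < ?f z" using monotone_onD[OF 1(2), of z "z + e"] by simp
      then show False using monoD[OF m, of z "z + e"] 1(1) by simp
    next
      case 2
      then have "?f z < ?f (z - e)" using monotone_onD[OF 2(2), of "z - e" z] by simp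
      then show False using monoD[OF m, of "z - e" z] 2(1) by simp
    qed
  qed
  moreover have "card (critical_points ?f) \<noteq> 0" using fin z by auto
  ultimately have "card (critical_points ?f) = 1" using le2 by linarith
  then obtain z' where "critical_points ?f = {z'}" using card_1_singletonE by blast
  then have "crit_pt F ?b = z" using z unfolding crit_pt_def by auto
  then show ?thesis using \<open>deriv ?f z = 0\<close> by simp
qed

end

text \<open>The mean slope over a period is one, so a negative slope somewhere yields both signs and
  two zeros of the derivative, distinct modulo one. Class B allows no more. The minimum is
  \<open>z1\<close>, the maximum \<open>z2\<close>.\<close>

lemma two_turning_points:
  assumes B: "class_B f" and nm: "\<not> mono f"
  obtains z1 z2 where "z1 < z2" "z2 < z1 + 1" "card (critical_points f) = 2"
    "\<And>x. z1 < x \<Longrightarrow> x < z2 \<Longrightarrow> 0 < deriv f x"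
    "\<And>x. z2 < x \<Longrightarrow> x < z1 + 1 \<Longrightarrow> deriv f x < 0"
    "\<And>x. deriv f x = 0 \<Longrightarrow> \<exists>n. x = z1 + of_int n \<or> x = z2 + of_int n"
proof -
  let ?d = "deriv f"
  note D = class_B_derivs[OF B] and sh = class_B_deriv_shift[OF B]
  have cd: "continuous_on S ?d" for S
    using D(2) by (meson DERIV_isCont continuous_at_imp_continuous_on)
  obtain x where x: "?d x < 0" using not_mono_deriv_neg[OF B nm] by blast
  have x1: "?d (x + 1) < 0" using sh[of x 1] x by simp
  obtain t where t: "x < t" "t < x + 1" "f (x + 1) - f x = (x + 1 - x) * ?d t"
    using MVT2[of x "x + 1" f ?d] D(1) by auto
  then have dt: "0 < ?d t" using class_B_lift(2)[OF B, of x] by simp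
  obtain z1 where z1: "x \<le> z1" "z1 \<le> t" "?d z1 = 0"
    using IVT'[of ?d x 0 t] x dt t cd by force
  obtain z2 where z2: "t \<le> z2" "z2 \<le> x + 1" "?d z2 = 0"
    using IVT2'[of ?d "x + 1" 0 t] x1 dt t cd by force
  have ne: "z1 \<noteq> x" "z1 \<noteq> t" "z2 \<noteq> t" "z2 \<noteq> x + 1" using z1 z2 x x1 dt by auto
  then have o: "x < z1" "z1 < t" "t < z2" "z2 < x + 1" using z1 z2 by auto
  have fr: "?d (z - of_int \<lfloor>z\<rfloor>) = 0" "z - of_int \<lfloor>z\<rfloor> \<in> {0..<1}" if "?d z = 0" for z
    using sh[of "z - of_int \<lfloor>z\<rfloor>" "\<lfloor>z\<rfloor>"] that by (auto; linarith)+
  let ?w1 = "z1 - of_int \<lfloor>z1\<rfloor>" and ?w2 = "z2 - of_int \<lfloor>z2\<rfloor>"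
  have sub: "{?w1, ?w2} \<subseteq> critical_points f"
    unfolding critical_points_def using fr[OF z1(3)] fr[OF z2(3)] by auto
  have "?w1 \<noteq> ?w2"
  proof
    assume "?w1 = ?w2"
    then have e: "z2 - z1 = of_int (\<lfloor>z2\<rfloor> - \<lfloor>z1\<rfloor>)" by simp
    have "0 < z2 - z1" "z2 - z1 < 1" using o by auto
    then have "0 < \<lfloor>z2\<rfloor> - \<lfloor>z1\<rfloor>" "\<lfloor>z2\<rfloor> - \<lfloor>z1\<rfloor> < 1" unfolding e by linarith+
    then show False by simp
  qed
  then have c2: "card {?w1, ?w2} = 2" by simp
  have fin: "finite (critical_points f)" "card (critical_points f) \<le> 2"
    using B by (auto simp: class_B_def)
  have eq: "critical_points f = {?w1, ?w2}" using card_seteq[OF fin(1) sub] fin c2 by simp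
  have zeros: "\<exists>n. y = z1 + of_int n \<or> y = z2 + of_int n" if "?d y = 0" for y
  proof -
    have "y - of_int \<lfloor>y\<rfloor> \<in> critical_points f" unfolding critical_points_def using fr[OF that] by simp
    then have "y = z1 + of_int (\<lfloor>y\<rfloor> - \<lfloor>z1\<rfloor>) \<or> y = z2 + of_int (\<lfloor>y\<rfloor> - \<lfloor>z2\<rfloor>)" unfolding eq by auto
    then show ?thesis by blast
  qed
  have nz: False if y: "?d y = 0" "z1 < y" "y < z1 + 1" "y \<noteq> z2" for y
  proof -
    have nint: "n = 0" if "- 1 < (of_int n :: real)" "(of_int n :: real) < 1" for n using that by linarith
    from zeros[OF y(1)] obtain n where "y = z1 + of_int n \<or> y = z2 + of_int n" by blast
    then show False
    proof
      assume e: "y = z1 + of_int n"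
      then have "n = 0" using y by (intro nint) auto
      then show False using e y by simp
    next
      assume e: "y = z2 + of_int n"
      then have "n = 0" using y o by (intro nint) auto
      then show False using e y by simp
    qed
  qed
  show ?thesis
  proof (rule that[of z1 z2])
    show "z1 < z2" "z2 < z1 + 1" "card (critical_points f) = 2" using o eq c2 by auto
    show "0 < ?d y" if "z1 < y" "y < z2" for y
    proof (rule ccontr)
      assume "\<not> ?thesis"
      then have "?d y \<le> 0" by simp
      have "\<exists>s. z1 < s \<and> s < z2 \<and> ?d s = 0"
      proof (cases "y \<le> t")
        case True
        then obtain s where "y \<le> s" "s \<le> t" "?d s = 0"
          using IVT'[of ?d y 0 t] \<open>?d y \<le> 0\<close> dt cd by force
        then show ?thesis using that o by (intro exI[of _ s]) auto
      next
        case False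
        then obtain s where "t \<le> s" "s \<le> y" "?d s = 0"
          using IVT2'[of ?d y 0 t] \<open>?d y \<le> 0\<close> dt cd by force
        then show ?thesis using that o by (intro exI[of _ s]) auto
      qed
      then obtain s where "z1 < s" "s < z2" "?d s = 0" by blast
      then show False using nz[of s] o by auto
    qed
    show "?d y < 0" if "z2 < y" "y < z1 + 1" for y
    proof (rule ccontr)
      assume "\<not> ?thesis"
      then have "0 \<le> ?d y" by simp
      have "\<exists>s. z2 < s \<and> s < z1 + 1 \<and> ?d s = 0"
      proof (cases "y \<le> x + 1")
        case True
        then obtain s where "y \<le> s" "s \<le> x + 1" "?d s = 0"
          using IVT2'[of ?d "x + 1" 0 y] \<open>0 \<le> ?d y\<close> x1 cd by force
        then show ?thesis using that o by (intro exI[of _ s]) auto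
      next
        case False
        then obtain s where "x + 1 \<le> s" "s \<le> y" "?d s = 0"
          using IVT'[of ?d "x + 1" 0 y] \<open>0 \<le> ?d y\<close> x1 cd by force
        then show ?thesis using that o by (intro exI[of _ s]) auto
      qed
      then obtain s where "z2 < s" "s < z1 + 1" "?d s = 0" by blast
      then show False using nz[of s] o by auto
    qed
  qed (rule zeros)
qed

lemma turning_max_deriv:
  assumes "turning_max f c" "(f has_real_derivative d) (at c)"
  shows "d = 0"
proof -
  obtain e where e: "0 < e" "strict_mono_on {c - e..c} f" "strict_antimono_on {c..c + e} f"
    using assms(1) unfolding turning_max_def by blast
  have "f y \<le> f c" if "\<bar>c - y\<bar> < e" for y
    using strict_mono_onD[OF e(2), of y c] monotone_onD[OF e(3), of c y] that
    by (cases y c rule: linorder_cases) auto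
  then show ?thesis using DERIV_local_max[OF assms(2) e(1)] by blast
qed

lemma turning_min_deriv:
  assumes "turning_min f c" "(f has_real_derivative d) (at c)"
  shows "d = 0"
proof -
  obtain e where e: "0 < e" "strict_antimono_on {c - e..c} f" "strict_mono_on {c..c + e} f"
    using assms(1) unfolding turning_min_def by blast
  have "f c \<le> f y" if "\<bar>c - y\<bar> < e" for y
    using strict_mono_onD[OF e(3), of c y] monotone_onD[OF e(2), of y c] that
    by (cases y c rule: linorder_cases) auto
  then show ?thesis using DERIV_local_min[OF assms(2) e(1)] by blast
qed

lemma unit_interval_unique:
  fixes x y :: real
  assumes "x \<in> {0..<1}" "y \<in> {0..<1}" "x = y + of_int n"
  shows "x = y"
proof -
  have "- 1 < (of_int n :: real)" "(of_int n :: real) < 1" using assms by auto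
  then have "n = 0" by linarith
  then show ?thesis using assms by simp
qed

lemma class_N_bimodal:
  assumes N: "class_N F" and b: "critical_line F < b" and CK: "C_pt F b < K_pt F b"
  shows "bimodal_shape (F 0 b) (K_minus F b) (C_pt F b) (K_pt F b) (C_plus F b)"
    "\<And>x. deriv (F 0 b) x \<noteq> 0 \<Longrightarrow> schwarzian (F 0 b) x < 0"
    "\<And>x. K_pt F b - 1 < x \<Longrightarrow> x < C_pt F b \<Longrightarrow> 0 < deriv (F 0 b) x"
proof -
  let ?f = "F 0 b"
  let ?C = "C_pt F b" and ?K = "K_pt F b"
  have cB: "class_B ?f" by (rule class_N_class_B[OF N])
  note D = class_B_derivs(1)[OF cB] and dsh = class_B_deriv_shift[OF cB]
  have cf: "continuous_on S ?f" for S using class_B_lift(1)[OF cB] continuous_on_subset by blast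
  note per = class_B_lift(2)[OF cB]
  have sh: "?f (x + of_int m) = ?f x + of_int m" for x m
    by (rule int_periodic) (rule per)
  have nm: "\<not> mono ?f" by (rule critical_line_props(2)[OF N b])
  obtain z1 z2 where z: "z1 < z2" "z2 < z1 + 1" and two: "card (critical_points ?f) = 2"
    and pos: "\<And>x. z1 < x \<Longrightarrow> x < z2 \<Longrightarrow> 0 < deriv ?f x"
    and neg: "\<And>x. z2 < x \<Longrightarrow> x < z1 + 1 \<Longrightarrow> deriv ?f x < 0"
    and zeros: "\<And>x. deriv ?f x = 0 \<Longrightarrow> \<exists>n. x = z1 + of_int n \<or> x = z2 + of_int n"
    by (rule two_turning_points[OF cB nm]) blast
  show "\<And>x. deriv ?f x \<noteq> 0 \<Longrightarrow> schwarzian ?f x < 0"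
    using cB two unfolding class_B_def by blast
  have inc0: "?f x < ?f y" if "z1 \<le> x" "x < y" "y \<le> z2" for x y
    by (rule DERIV_pos_imp_increasing_open[OF that(2) _ cf]) (use D pos that in force)
  have dec0: "?f y < ?f x" if "z2 \<le> x" "x < y" "y \<le> z1 + 1" for x y
    by (rule DERIV_neg_imp_decreasing_open[where f = ?f, OF that(2) _ cf]) (use D neg that in force)
  have inc1: "?f x < ?f y" if "z1 + of_int n \<le> x" "x < y" "y \<le> z2 + of_int n" for x y n
    using inc0[of "x - of_int n" "y - of_int n"] sh[of "x - of_int n" n] sh[of "y - of_int n" n] that
    by simp
  have dec1: "?f y < ?f x" if "z2 + of_int n \<le> x" "x < y" "y \<le> z1 + 1 + of_int n" for x y n
    using dec0[of "x - of_int n" "y - of_int n"] sh[of "x - of_int n" n] sh[of "y - of_int n" n] that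
    by simp
  define e where "e = min (z2 - z1) (z1 + 1 - z2)"
  have e: "0 < e" "e \<le> z2 - z1" "e \<le> z1 + 1 - z2" unfolding e_def using z by auto
  have tmax: "turning_max ?f (z2 + of_int n)" for n
    unfolding turning_max_def
    by (intro exI[of _ e] conjI e monotone_onI inc1[of n] dec1[of n]) (use e in auto)
  have tmin: "turning_min ?f (z1 + of_int n)" for n
    unfolding turning_min_def
    by (intro exI[of _ e] conjI e monotone_onI inc1[of n] dec1[of "n - 1"]) (use e in auto)
  have not_both: False if max: "turning_max ?f c" and min: "turning_min ?f c" for c
  proof -
    obtain d where d: "0 < d" "strict_antimono_on {c..c + d} ?f"
      using max unfolding turning_max_def by blast
    obtain d' where d': "0 < d'" "strict_mono_on {c..c + d'} ?f"
      using min unfolding turning_min_def by blast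
    have "?f (c + min d d') < ?f c" using monotone_onD[OF d(2), of c "c + min d d'"] d d' by simp
    moreover have "?f c < ?f (c + min d d')"
      using strict_mono_onD[OF d'(2), of c "c + min d d'"] d d' by simp
    ultimately show False by simp
  qed
  have max_iff: "turning_max ?f c \<longleftrightarrow> (\<exists>n. c = z2 + of_int n)" for c
    using tmax zeros[OF turning_max_deriv[OF _ D]] not_both tmin by metis
  have min_iff: "turning_min ?f c \<longleftrightarrow> (\<exists>n. c = z1 + of_int n)" for c
    using tmin zeros[OF turning_min_deriv[OF _ D]] not_both tmax by metis
  have neq: "b \<noteq> critical_line F" using b by simp
  have fr: "x - of_int \<lfloor>x\<rfloor> \<in> {0..<1}" for x :: real by (auto; linarith)
  have C: "?C = z2 - of_int \<lfloor>z2\<rfloor>"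
    unfolding C_pt_def if_not_P[OF neq]
  proof (rule the_equality)
    show "z2 - of_int \<lfloor>z2\<rfloor> \<in> {0..<1} \<and> turning_max ?f (z2 - of_int \<lfloor>z2\<rfloor>)"
      using fr tmax[of "- \<lfloor>z2\<rfloor>"] by simp
    fix c assume c: "c \<in> {0..<1} \<and> turning_max ?f c"
    then obtain n where "c = z2 + of_int n" using max_iff by blast
    then have "c = z2 - of_int \<lfloor>z2\<rfloor> + of_int (\<lfloor>z2\<rfloor> + n)" by simp
    then show "c = z2 - of_int \<lfloor>z2\<rfloor>" using unit_interval_unique fr c by blast
  qed
  have K: "?K = z1 - of_int \<lfloor>z1\<rfloor>"
    unfolding K_pt_def if_not_P[OF neq]
  proof (rule the_equality)
    show "z1 - of_int \<lfloor>z1\<rfloor> \<in> {0..<1} \<and> turning_min ?f (z1 - of_int \<lfloor>z1\<rfloor>)"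
      using fr tmin[of "- \<lfloor>z1\<rfloor>"] by simp
    fix c assume c: "c \<in> {0..<1} \<and> turning_min ?f c"
    then obtain n where "c = z1 + of_int n" using min_iff by blast
    then have "c = z1 - of_int \<lfloor>z1\<rfloor> + of_int (\<lfloor>z1\<rfloor> + n)" by simp
    then show "c = z1 - of_int \<lfloor>z1\<rfloor>" using unit_interval_unique fr c by blast
  qed
  \<comment> \<open>\<open>C < K\<close> within one fundamental domain makes \<open>K\<close> the
    first minimum after \<open>C\<close>, so \<open>z2\<close> and \<open>z1 + 1\<close> are
    translated by the same \<open>n\<close>.\<close>
  define n where "n = - \<lfloor>z2\<rfloor>"
  have C': "?C = z2 + of_int n" by (simp add: C n_def)
  have K': "?K = z1 + 1 + of_int n"
  proof -
    have "0 \<le> ?C" "?K < 1" unfolding C K by linarith+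
    then have "?C < ?K" "?K < ?C + 1" using CK by auto
    then have "0 < (of_int (\<lfloor>z2\<rfloor> - \<lfloor>z1\<rfloor>) :: real)" "(of_int (\<lfloor>z2\<rfloor> - \<lfloor>z1\<rfloor>) :: real) < 2"
      using z unfolding C K by auto
    then have "\<lfloor>z2\<rfloor> - \<lfloor>z1\<rfloor> = 1" by linarith
    then have "\<lfloor>z1\<rfloor> = \<lfloor>z2\<rfloor> - 1" by simp
    then show ?thesis by (simp add: K n_def)
  qed
  show "\<And>x. ?K - 1 < x \<Longrightarrow> x < ?C \<Longrightarrow> 0 < deriv ?f x"
    using pos[of "x - of_int n" for x] dsh[of "x - of_int n" n for x] unfolding C' K' by simp
  have inc: "?f x < ?f y" if "?K - 1 \<le> x" "x < y" "y \<le> ?C" for x y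
    using inc1[of n x y] that C' K' by simp
  have dec: "?f y < ?f x" if "?C \<le> x" "x < y" "y \<le> ?K" for x y
    using dec1[of n x y] that C' K' by simp
  have inc': "?f x < ?f y" if "?K \<le> x" "x < y" "y \<le> ?C + 1" for x y
    using inc[of "x - 1" "y - 1"] per[of "x - 1"] per[of "y - 1"] that by simp
  have KC: "?K - 1 < ?C" using C' K' z by simp
  have fK: "?f (?K - 1) = ?f ?K - 1" using per[of "?K - 1"] by simp
  have fCK: "?f ?K < ?f ?C" by (rule dec) (use CK in auto)
  \<comment> \<open>On the increasing branch from K - 1 to C the values run from f K - 1 to f C,
    which exceeds f K.\<close>
  obtain k where k: "?K - 1 \<le> k" "k \<le> ?C" "?f k = ?f ?K"
    using IVT'[of ?f "?K - 1" "?f ?K" ?C] fK fCK KC cf by force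
  have k': "?K - 1 < k" "k < ?C" using k fK fCK by (auto simp: less_le)
  have Km: "K_minus F b = k"
    unfolding K_minus_def if_not_P[OF neq]
  proof (rule Greatest_equality)
    show "k < ?K \<and> ?f k = ?f ?K" using k k' CK by simp
    fix x assume x: "x < ?K \<and> ?f x = ?f ?K"
    show "x \<le> k"
    proof (rule ccontr)
      assume "\<not> ?thesis"
      then show False using inc[of k x] dec[of x ?K] x k k' by (cases "x \<le> ?C") auto
    qed
  qed
  obtain c where c: "?K \<le> c" "c \<le> ?C + 1" "?f c = ?f ?C"
    using IVT'[of ?f ?K "?f ?C" "?C + 1"] per[of ?C] fCK KC cf by force
  have c': "?K < c" "c < ?C + 1" using c per[of ?C] fCK by (auto simp: less_le)
  have Cp: "C_plus F b = c"
    unfolding C_plus_def if_not_P[OF neq]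
  proof (rule Least_equality)
    show "?C < c \<and> ?f c = ?f ?C" using c c' CK by simp
    fix x assume x: "?C < x \<and> ?f x = ?f ?C"
    show "c \<le> x"
    proof (rule ccontr)
      assume "\<not> ?thesis"
      then show False using inc'[of x c] dec[of ?C x] x c c' by (cases "x \<le> ?K") auto
    qed
  qed
  show "bimodal_shape ?f (K_minus F b) ?C ?K (C_plus F b)"
    unfolding Km Cp
    by unfold_locales (use cf per k' c' k c CK inc dec in auto)
qed

section \<open>Transfer to the loci of the family\<close>

lemma farey_of_parents:
  assumes "farey_parents p q p1 q1 p2 q2"
  shows "farey (int p) (int p1) (int p2) q q1 q2"
proof
  have a: "0 < q1" "0 < q2" "p = p1 + p2" "q = q1 + q2"
    "real p1 / real q1 < real p2 / real q2" "\<bar>int p1 * int q2 - int p2 * int q1\<bar> = 1"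
    using assms by (auto simp: farey_parents_def lowest_terms01_def farey_neighbors_def)
  then show "0 < q1" "0 < q2" "int p = int p1 + int p2" "q = q1 + q2" by auto
  have "real p1 * real q2 < real p2 * real q1" using a by (simp add: field_simps)
  then have "int p1 * int q2 < int p2 * int q1"
    by (simp flip: of_nat_mult)
  then show "int p2 * int q1 - int p1 * int q2 = 1" using a(6) by linarith
qed

lemma not_in_plus_Ints:
  assumes "x \<notin> plus_Ints S"
  shows "x - of_int m \<notin> S"
  using assms unfolding plus_Ints_def by force

lemma trichotomy_above:
  assumes N: "class_N F" and b: "critical_line F < b" and CK: "C_pt F b < K_pt F b"
    and par: "farey_parents p q p1 q1 p2 q2"
    and L: "\<And>j. (L j, b) \<in> locus_L F (j * p + p2) (j * q + q2)"
    and R: "\<And>j. (R j, b) \<in> locus_R F (j * p + p1) (j * q + q1)"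
  defines "\<psi>1 \<equiv> Psi1 F p q b" and "\<psi>2 \<equiv> Psi2 F p q b"
  shows "(\<psi>1 < \<psi>2 \<and> (\<forall>j. R j < R (Suc j) \<and> R j < \<psi>1) \<and> (\<forall>j. L (Suc j) < L j \<and> \<psi>2 < L j)) \<or>
   (\<psi>2 < \<psi>1 \<and> (\<forall>j. R (Suc j) < R j \<and> \<psi>1 < R j) \<and> (\<forall>j. L j < L (Suc j) \<and> L j < \<psi>2)) \<or>
   (\<psi>1 = \<psi>2 \<and> (\<forall>j. R j = \<psi>1) \<and> (\<forall>j. L j = \<psi>1))"
proof -
  define f where "f = F 0 b"
  define k C K c where "k = K_minus F b" and "C = C_pt F b" and "K = K_pt F b" and "c = C_plus F b"
  note defs = f_def k_def C_def K_def c_def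
  have cB: "class_B f" unfolding f_def by (rule class_N_class_B[OF N])
  have Fab: "F a b = (\<lambda>x. f x + a)" for a unfolding f_def by (rule class_N_translation[OF N])
  have pow: "F a b ^^ n = iter f a n" for a n by (simp add: Fab iter_def)
  interpret s: bimodal_shape f k C K c unfolding defs by (rule class_N_bimodal[OF N b CK])
  have neq: "b \<noteq> critical_line F" using b by simp
  have R1: "iter f (R j) (j * q + q1) k = c + of_int (int j * int p + int p1)" for j
    using R[of j] neq by (simp add: locus_R_def pow flip: k_def c_def)
  have R2: "\<not> (k + of_int m < iter f (R j) i k \<and> iter f (R j) i k \<le> K + of_int m)"
    if "0 < i" "i \<le> j * q + q1" for i j m
  proof -
    have "iter f (R j) i k \<notin> plus_Ints {k<..K}"
      using R[of j] neq that by (simp add: locus_R_def pow flip: k_def c_def K_def)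
    from not_in_plus_Ints[OF this, of m] show ?thesis by auto
  qed
  have L1: "iter f (L j) (j * q + q2) c = k + of_int (int j * int p + int p2)" for j
    using L[of j] neq by (simp add: locus_L_def pow flip: k_def c_def)
  have L2: "\<not> (C + of_int m \<le> iter f (L j) i c \<and> iter f (L j) i c < c + of_int m)"
    if "0 < i" "i \<le> j * q + q2" for i j m
  proof -
    have "iter f (L j) i c \<notin> plus_Ints {C..<c}"
      using L[of j] neq that by (simp add: locus_L_def pow flip: k_def c_def C_def)
    from not_in_plus_Ints[OF this, of m] show ?thesis by auto
  qed
  interpret fa: farey "int p" "int p1" "int p2" q q1 q2 by (rule farey_of_parents[OF par])
  \<comment> \<open>If c > k + 1, the orbit for \<open>R 0\<close> would at time \<open>q1\<close>
    be at c + p1, in the translate of (k, K] by p1 + 1, which the locus forbids.\<close>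
  have ck: "c \<le> k + 1"
  proof (rule ccontr)
    assume "\<not> ?thesis"
    then show False using R2[of "q1" 0 "int p1 + 1"] R1[of 0] fa.q_pos s.ord by simp
  qed
  define h where "h = refl_map (lower_bound_map (refl_map f))"
  interpret bm: bimodal f s.low h "deriv f" "deriv (deriv f)" "deriv (deriv (deriv f))" k C K c
    unfolding h_def
  proof (rule s.bimodal[OF ck class_B_derivs[OF cB]])
    show "0 < deriv f x" if "K - 1 < x" "x < C" for x
      using class_N_bimodal(3)[OF N b CK, of x] that by (simp add: defs)
    show "deriv (deriv (deriv f)) x / deriv f x - 3 / 2 * (deriv (deriv f) x / deriv f x)\<^sup>2 < 0"
      if "deriv f x \<noteq> 0" for x
      using class_N_bimodal(2)[OF N b CK, of x] that
      by (simp add: schwarzian_def eval_nat_numeral flip: f_def)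
  qed
  obtain t1 where t1: "touch_above s.low q (int p) t1" using bm.g.touch_above_exists[OF fa.q0] by blast
  obtain t2 where t2: "touch_below h q (int p) t2" using bm.h.touch_below_exists[OF fa.q0] by blast
  have P1: "\<psi>1 = t1"
    using bm.g.Inf_touch_above[OF bm.g_le bm.common_orbit t1 fa.q0]
    by (simp add: \<psi>1_def Psi1_def Fab)
  have P2: "\<psi>2 = t2"
    using bm.h.Sup_touch_below[OF bm.h_ge bm.common_orbit_upper t2 fa.q0]
    by (simp add: \<psi>2_def Psi2_def Fab)
  \<comment> \<open>The orbit starts at the end \<open>k\<close> of a plateau and is kept off the
    plateaus afterwards by the locus condition, so the lower bound follows the same orbit.\<close>
  have GR: "iter s.low (R j) i k = iter f (R j) i k" if "i \<le> j * q + q1" for i j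
  proof (rule bm.F_eq_G)
    fix i' :: nat and m :: int assume "i' < i"
    show "\<not> (k + of_int m < iter f (R j) i' k \<and> iter f (R j) i' k < K + of_int m)"
    proof (cases "i' = 0")
      case True
      have "\<not> (of_int m < (0::real) \<and> of_int (- 1) < (of_int m :: real))"
        by (simp only: of_int_less_0_iff of_int_less_iff) linarith
      then show ?thesis using True s.ord by auto
    next
      case False
      then show ?thesis using R2[of i' j m] that \<open>i' < i\<close> by auto
    qed
  qed
  have HL: "iter h (L j) i c = iter f (L j) i c" if "i \<le> j * q + q2" for i j
  proof (rule bm.F_eq_H)
    fix i' :: nat and m :: int assume "i' < i"
    show "\<not> (C + of_int m < iter f (L j) i' c \<and> iter f (L j) i' c < c + of_int m)"
    proof (cases "i' = 0")
      case True
      have "\<not> ((0::real) < of_int m \<and> (of_int m :: real) < 1)" by auto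
      then show ?thesis using True s.ord by auto
    next
      case False
      then show ?thesis using L2[of i' j m] that \<open>i' < i\<close> by auto
    qed
  qed
  interpret lo: loci f s.low h "deriv f" "deriv (deriv f)" "deriv (deriv (deriv f))" k C K c
    "int p" "int p1" "int p2" q q1 q2 t1 t2 R L
    by unfold_locales (use t1 t2 R1 R2 L1 L2 GR HL in \<open>simp_all\<close>)
  show ?thesis using lo.trichotomy unfolding P1 P2 .
qed

lemma trichotomy_critical:
  assumes N: "class_N F" and b: "b = critical_line F"
    and par: "farey_parents p q p1 q1 p2 q2"
    and L: "\<And>j. (L j, b) \<in> locus_L F (j * p + p2) (j * q + q2)"
    and R: "\<And>j. (R j, b) \<in> locus_R F (j * p + p1) (j * q + q1)"
  defines "\<psi>1 \<equiv> Psi1 F p q b" and "\<psi>2 \<equiv> Psi2 F p q b"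
  shows "\<psi>1 < \<psi>2 \<and> (\<forall>j. R j < R (Suc j) \<and> R j < \<psi>1) \<and> (\<forall>j. L (Suc j) < L j \<and> \<psi>2 < L j)"
proof -
  define f where "f = F 0 b"
  define k where "k = crit_pt F b"
  have cB: "class_B f" unfolding f_def by (rule class_N_class_B[OF N])
  have Fab: "F a b = (\<lambda>x. f x + a)" for a unfolding f_def by (rule class_N_translation[OF N])
  have pow: "F a b ^^ n = iter f a n" for a n by (simp add: Fab iter_def)
  have kc: "K_minus F b = k" "C_plus F b = k" by (simp_all add: K_minus_def C_plus_def k_def b)
  interpret fa: farey "int p" "int p1" "int p2" q q1 q2 by (rule farey_of_parents[OF par])
  interpret m: mono_lift f
    using critical_line_props(1)[OF N] class_B_lift[OF cB] by unfold_locales (auto simp: f_def b)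
  interpret mf: mono_lift_farey f "int p" "int p1" "int p2" q q1 q2 by unfold_locales
  have k0: "deriv f k = 0" using crit_pt_props[OF N] by (simp add: f_def k_def b)
  have R1: "iter f (R j) (j * q + q1) k = k + of_int (int j * int p + int p1)" for j
    using R[of j] by (simp add: locus_R_def pow kc)
  have L1: "iter f (L j) (j * q + q2) k = k + of_int (int j * int p + int p2)" for j
    using L[of j] by (simp add: locus_L_def pow kc)
  obtain t1 where t1: "touch_above f q (int p) t1" using m.touch_above_exists[OF fa.q0] by blast
  obtain t2 where t2: "touch_below f q (int p) t2" using m.touch_below_exists[OF fa.q0] by blast
  have P1: "\<psi>1 = t1"
    using m.Inf_touch_above[of f, OF _ _ t1 fa.q0] by (simp add: \<psi>1_def Psi1_def Fab)
  have P2: "\<psi>2 = t2"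
    using m.Sup_touch_below[of f, OF _ _ t2 fa.q0] by (simp add: \<psi>2_def Psi2_def Fab)
  show ?thesis
    using mf.critical_case[OF class_B_derivs(1)[OF cB] k0 t1 t2 R1 L1] unfolding P1 P2 by blast
qed

text \<open>\<open>origin\<close> encodes the choice of the origin above the critical line. The
  three cases exclude each other through the order of \<open>Psi1\<close> and \<open>Psi2\<close>
  alone.\<close>

theorem theorem3:
  fixes F :: "real \<Rightarrow> real \<Rightarrow> real \<Rightarrow> real" and b0 :: real
    and p q p1 q1 p2 q2 :: nat
    and L R :: "nat \<Rightarrow> real"
  assumes "class_N F"
    and "critical_line F \<le> b0"
    and origin: "critical_line F < b0 \<Longrightarrow> C_pt F b0 < K_pt F b0"
    and "farey_parents p q p1 q1 p2 q2"
    and L: "\<And>j. (L j, b0) \<in> locus_L F (j * p + p2) (j * q + q2)"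
    and R: "\<And>j. (R j, b0) \<in> locus_R F (j * p + p1) (j * q + q1)"
  shows
    "let \<psi>1 = Psi1 F p q b0;
         \<psi>2 = Psi2 F p q b0;
         case1 = (\<forall>j. L j > L (Suc j)) \<and> (\<forall>j. L j > \<psi>2) \<and> \<psi>2 > \<psi>1 \<and>
                 (\<forall>j. \<psi>1 > R j) \<and> (\<forall>j. R (Suc j) > R j);
         case2 = (\<forall>j. L j < L (Suc j)) \<and> (\<forall>j. L j < \<psi>2) \<and> \<psi>2 < \<psi>1 \<and>
                 (\<forall>j. \<psi>1 < R j) \<and> (\<forall>j. R (Suc j) < R j);
         case3 = (\<forall>j. L j = \<psi>1) \<and> \<psi>1 = \<psi>2 \<and> (\<forall>j. R j = \<psi>2)
     in (case1 \<and> \<not> case2 \<and> \<not> case3) \<or>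
        (\<not> case1 \<and> case2 \<and> \<not> case3) \<or>
        (\<not> case1 \<and> \<not> case2 \<and> case3)"
proof -
  let ?\<psi>1 = "Psi1 F p q b0" and ?\<psi>2 = "Psi2 F p q b0"
  have "(?\<psi>1 < ?\<psi>2 \<and> (\<forall>j. R j < R (Suc j) \<and> R j < ?\<psi>1) \<and> (\<forall>j. L (Suc j) < L j \<and> ?\<psi>2 < L j)) \<or>
   (?\<psi>2 < ?\<psi>1 \<and> (\<forall>j. R (Suc j) < R j \<and> ?\<psi>1 < R j) \<and> (\<forall>j. L j < L (Suc j) \<and> L j < ?\<psi>2)) \<or>
   (?\<psi>1 = ?\<psi>2 \<and> (\<forall>j. R j = ?\<psi>1) \<and> (\<forall>j. L j = ?\<psi>1))"
  proof (cases "b0 = critical_line F")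
    case True
    then show ?thesis using trichotomy_critical[OF assms(1) _ assms(4) L R] by blast
  next
    case False
    then have "critical_line F < b0" using assms(2) by simp
    then show ?thesis using trichotomy_above[OF assms(1) _ origin assms(4) L R] by blast
  qed
  then show ?thesis unfolding Let_def by (elim disjE) (simp_all add: less_imp_not_less)
qed

end
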